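(* Let $G_1,\dots,G_k$ be countably infinite abelian groups and $G=G_1*\cdots*G_k$. Let $\alpha\in\mathit{FR}(G,X,\mu)$ and $\beta\in A(G,X,\mu)$, let $F\subset G$ be finite, $\varepsilon>0$, and $A_1,\dots,A_n\subset X$ Borel. Then there exists $\gamma\in[\alpha]_{\mathit{OE}}$ such that $\mu(g^\gamma A_j\,\triangle\, g^\beta A_j)<\varepsilon$ for all $j\in\{1,\dots,n\}$ and all $g\in F$. Consequently, for every $\alpha\in\mathit{FR}(G,X,\mu)$, $[\alpha]_{\mathit{OE}}$ is weakly dense in $A(G,X,\mu)$.
   Context: $(X,\mu)$ is a non-atomic standard probability space. $\mathrm{Aut}(X,\mu)$ is the group of measure-preserving Borel automorphisms of $(X,\mu)$ modulo null sets, with the weak topology. $A(G,X,\mu)$ is the set of homomorphisms $\alpha:G\to\mathrm{Aut}(X,\mu)$, written $g^\alpha=\alpha(g)$, with the subspace topology of $\prod_G\mathrm{Aut}(X,\mu)$; $\mathit{FR}(G,X,\mu)$ is the subset of essentially free actions. Two actions $\alpha,\beta$ are orbit equivalent if there is $R\in\mathrm{Aut}(X,\mu)$ with $G^\alpha x=RG^\beta R^{-1}x$ for $\mu$-a.e. $x$; $[\alpha]_{\mathit{OE}}$ is the set of actions in $A(G,X,\mu)$ orbit equivalent to $\alpha$. *)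

theory Defs
  imports "HOL-Analysis.Analysis" "HOL-Probability.Probability" "HOL-Algebra.Group"
begin

definition reduced_word :: "('g, 'b) monoid_scheme \<Rightarrow> nat set \<Rightarrow> (nat \<Rightarrow> 'g set) \<Rightarrow> (nat \<times> 'g) list \<Rightarrow> bool" where
  "reduced_word G I H ws \<longleftrightarrow>
     (\<forall>(i, h) \<in> set ws. i \<in> I \<and> h \<in> H i \<and> h \<noteq> \<one>\<^bsub>G\<^esub>) \<and>
     successively (\<lambda>a b. fst a \<noteq> fst b) ws"

definition word_prod :: "('g, 'b) monoid_scheme \<Rightarrow> (nat \<times> 'g) list \<Rightarrow> 'g" where
  "word_prod G ws = foldr (\<lambda>(i, h) acc. h \<otimes>\<^bsub>G\<^esub> acc) ws \<one>\<^bsub>G\<^esub>"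

definition is_free_product :: "('g, 'b) monoid_scheme \<Rightarrow> nat set \<Rightarrow> (nat \<Rightarrow> 'g set) \<Rightarrow> bool" where
  "is_free_product G I H \<longleftrightarrow>
     group G \<and> (\<forall>i \<in> I. subgroup (H i) G) \<and>
     bij_betw (word_prod G) {ws. reduced_word G I H ws} (carrier G)"

definition atomless :: "'a measure \<Rightarrow> bool" where
  "atomless M \<longleftrightarrow> (\<forall>A \<in> sets M. 0 < emeasure M A \<longrightarrow>
      (\<exists>B \<in> sets M. B \<subseteq> A \<and> 0 < emeasure M B \<and> emeasure M B < emeasure M A))"

text \<open>Representatives of elements of Aut(X,mu): measure preserving Borel automorphisms
(Borel bijections with Borel inverse).  Elements of Aut(X,mu) are such maps modulo
mu-a.e. equality; all notions below are invariant under this identification.\<close>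

definition mp_aut :: "'a measure \<Rightarrow> ('a \<Rightarrow> 'a) \<Rightarrow> bool" where
  "mp_aut M T \<longleftrightarrow> bij T \<and> T \<in> M \<rightarrow>\<^sub>M M \<and> inv_into UNIV T \<in> M \<rightarrow>\<^sub>M M \<and> distr M M T = M"

text \<open>A(G,X,mu): homomorphisms G -> Aut(X,mu), i.e. (representatives of) maps g |-> g^alpha
into Aut(X,mu) with (gh)^alpha = g^alpha h^alpha mu-a.e.\<close>

definition actions :: "('g, 'b) monoid_scheme \<Rightarrow> 'a measure \<Rightarrow> ('g \<Rightarrow> 'a \<Rightarrow> 'a) set" where
  "actions G M = {\<alpha>. (\<forall>g \<in> carrier G. mp_aut M (\<alpha> g)) \<and>
      (\<forall>g \<in> carrier G. \<forall>h \<in> carrier G. AE x in M. \<alpha> (g \<otimes>\<^bsub>G\<^esub> h) x = \<alpha> g (\<alpha> h x))}"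

definition free_actions :: "('g, 'b) monoid_scheme \<Rightarrow> 'a measure \<Rightarrow> ('g \<Rightarrow> 'a \<Rightarrow> 'a) set" where
  "free_actions G M = {\<alpha> \<in> actions G M.
      AE x in M. \<forall>g \<in> carrier G. g \<noteq> \<one>\<^bsub>G\<^esub> \<longrightarrow> \<alpha> g x \<noteq> x}"

definition orbit :: "('g, 'b) monoid_scheme \<Rightarrow> ('g \<Rightarrow> 'a \<Rightarrow> 'a) \<Rightarrow> 'a \<Rightarrow> 'a set" where
  "orbit G \<alpha> x = (\<lambda>g. \<alpha> g x) ` carrier G"

definition orbit_equiv :: "('g, 'b) monoid_scheme \<Rightarrow> 'a measure \<Rightarrow> ('g \<Rightarrow> 'a \<Rightarrow> 'a) \<Rightarrow> ('g \<Rightarrow> 'a \<Rightarrow> 'a) \<Rightarrow> bool" where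
  "orbit_equiv G M \<alpha> \<beta> \<longleftrightarrow>
     (\<exists>R. mp_aut M R \<and> (AE x in M. orbit G \<alpha> x = R ` orbit G \<beta> (inv_into UNIV R x)))"

definition OE_class :: "('g, 'b) monoid_scheme \<Rightarrow> 'a measure \<Rightarrow> ('g \<Rightarrow> 'a \<Rightarrow> 'a) \<Rightarrow> ('g \<Rightarrow> 'a \<Rightarrow> 'a) set" where
  "OE_class G M \<alpha> = {\<gamma> \<in> actions G M. orbit_equiv G M \<gamma> \<alpha>}"

definition sym_diff :: "'a set \<Rightarrow> 'a set \<Rightarrow> 'a set" where
  "sym_diff A B = (A - B) \<union> (B - A)"

text \<open>The weak topology on A(G,X,mu): subspace topology of the product over G of the weak
topology of Aut(X,mu); the latter is generated by the sets {S. mu(S A sym_diff T A) < e}.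
Hence the topology on A(G,X,mu) is generated by the subbasic sets below.\<close>

definition weak_topology :: "('g, 'b) monoid_scheme \<Rightarrow> 'a measure \<Rightarrow> ('g \<Rightarrow> 'a \<Rightarrow> 'a) topology" where
  "weak_topology G M = subtopology
     (topology_generated_by
        ({actions G M} \<union>
         {{\<gamma> \<in> actions G M. measure M (sym_diff (\<gamma> g ` A) (T ` A)) < e} | g T A e.
            g \<in> carrier G \<and> mp_aut M T \<and> A \<in> sets M \<and> 0 < e}))
     (actions G M)"

end

(* Let H_i be one of the free factors and fix a finite partition P of X generated by the sets to be
   controlled and their translates.  Ball growing on an independent family of centres (subexponential
   growth of finitely generated abelian groups) gives cells for the free action of H_i; labelling
   each cell by the P-names along a beta-orbit of a sample point yields a label function L_i that
   imitates beta on the generators.  If the sample points are chosen well (a second moment bound, the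
   random choice being removed one sample at a time), then on every H_i-invariant set Z the label a
   has measure about mu(P = a) mu(Z); a single label function L has the same property for all i at
   once.  Hence L_i and L are matched by some S_i in the full group of H_i, and L and P by some
   R in Aut(X, mu).  The conjugates R S_i alpha(h) (R S_i)^-1, h in H_i, are close to beta(h); they
   define an action of the free product, and as S_i preserves the H_i-orbits its orbits are the
   R-images of those of alpha. *)

theory Submission
  imports Defs
begin

section \<open>Measure-preserving maps and partial isomorphisms\<close>

text \<open>All factors must be conjugated by the same R, for otherwise the orbits of the new action
  would not be the R-image of those of \<alpha>; whatever depends on the factor has to stay inside
  the orbits of that factor. The labelling L is the go-between: it knows nothing of the dynamics,
  but it is distributed correctly for every factor. A factor need not act ergodically, so two sets
  can be interchanged along its orbits only as far as their masses agree inside its invariant sets.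
  Equidistribution on all invariant sets with one common error replaces an ergodic decomposition. It
  holds because on an invariant set the mass of a label equals its average over N translates by
  distinct elements of the infinite factor, and N nearly uncorrelated samples have a variance of
  about 1/N. Freeness keeps the translates apart, commutativity bounds the balls by boxes of
  polynomial size, and the free product lets the separately conjugated factors be put together with
  no relation to check between them.\<close>

definition piso :: "'a measure \<Rightarrow> 'a set \<Rightarrow> ('a \<Rightarrow> 'a) \<Rightarrow> bool" where
  "piso M D T \<longleftrightarrow> D \<in> sets M \<and> inj_on T D \<and>
     (\<forall>C\<in>sets M. C \<subseteq> D \<longrightarrow> T ` C \<in> sets M \<and> measure M (T ` C) = measure M C) \<and>
     (\<forall>C\<in>sets M. D \<inter> T -` C \<in> sets M)"

locale std_space = prob_space M for M :: "'a::polish_space measure" +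
  assumes sets_M: "sets M = sets borel"
begin

lemma space_M [simp]: "space M = UNIV"
  using sets_eq_imp_space_eq[OF sets_M] by simp

lemma Compl_in_M [intro]: "A \<in> sets M \<Longrightarrow> - A \<in> sets M"
  using sets.compl_sets[of A M] by (simp add: Compl_eq_Diff_UNIV)

lemma measure_mono_M: "A \<subseteq> B \<Longrightarrow> B \<in> sets M \<Longrightarrow> measure M A \<le> measure M B"
  by (rule finite_measure_mono)

lemma measure_zero_subset: "A \<subseteq> B \<Longrightarrow> B \<in> sets M \<Longrightarrow> measure M B = 0 \<Longrightarrow> measure M A = 0"
  using measure_mono_M[of A B] measure_nonneg[of M A] by linarith

lemma measurable_M_iff: "f \<in> M \<rightarrow>\<^sub>M M \<longleftrightarrow> (\<forall>C\<in>sets M. f -` C \<in> sets M)"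
  by (auto simp: measurable_def)

lemma mp_autI:
  assumes "bij S" and "\<And>C. C \<in> sets M \<Longrightarrow> S -` C \<in> sets M"
    and "\<And>C. C \<in> sets M \<Longrightarrow> S ` C \<in> sets M"
    and "\<And>C. C \<in> sets M \<Longrightarrow> measure M (S ` C) = measure M C"
  shows "mp_aut M S"
proof -
  have m: "S \<in> M \<rightarrow>\<^sub>M M" using assms(2) by (simp add: measurable_M_iff)
  have "inv_into UNIV S \<in> M \<rightarrow>\<^sub>M M"
    using assms(1,3) by (simp add: measurable_M_iff bij_vimage_eq_inv_image[OF bij_imp_bij_inv] inv_inv_eq)
  moreover have "distr M M S = M"
  proof (rule measure_eqI)
    fix C assume "C \<in> sets (distr M M S)"
    then have C: "C \<in> sets M" by simp
    have "S ` (S -` C) = C" using assms(1) by (simp add: surj_image_vimage_eq bij_is_surj)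
    then have "measure M (S -` C) = measure M C" using assms(4)[OF assms(2)[OF C]] by simp
    then show "emeasure (distr M M S) C = emeasure M C"
      using C m by (simp add: emeasure_distr emeasure_eq_measure)
  qed simp
  ultimately show ?thesis using assms(1) m by (simp add: mp_aut_def)
qed

lemma mp_autD:
  assumes "mp_aut M S"
  shows "bij S" and "C \<in> sets M \<Longrightarrow> S -` C \<in> sets M" and "C \<in> sets M \<Longrightarrow> S ` C \<in> sets M"
    and "C \<in> sets M \<Longrightarrow> measure M (S -` C) = measure M C"
    and "C \<in> sets M \<Longrightarrow> measure M (S ` C) = measure M C"
proof -
  show b: "bij S" using assms by (simp add: mp_aut_def)
  show v: "C \<in> sets M \<Longrightarrow> S -` C \<in> sets M" for C
    using assms by (auto simp: mp_aut_def measurable_M_iff)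
  show i: "C \<in> sets M \<Longrightarrow> S ` C \<in> sets M" for C
    using assms b by (auto simp: mp_aut_def measurable_M_iff bij_vimage_eq_inv_image[OF bij_imp_bij_inv] inv_inv_eq)
  show m: "C \<in> sets M \<Longrightarrow> measure M (S -` C) = measure M C" for C
  proof -
    assume C: "C \<in> sets M"
    have "measure (distr M M S) C = measure M (S -` C)"
      using assms C by (subst measure_distr) (auto simp: mp_aut_def)
    then show ?thesis using assms by (simp add: mp_aut_def)
  qed
  show "C \<in> sets M \<Longrightarrow> measure M (S ` C) = measure M C"
    using m[OF i] b by (simp add: inj_vimage_image_eq bij_is_inj)
qed

lemma mp_aut_measurable: "mp_aut M S \<Longrightarrow> S \<in> M \<rightarrow>\<^sub>M M"
  by (simp add: mp_aut_def)

lemma mp_aut_id: "mp_aut M (\<lambda>x. x)"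
  by (rule mp_autI) (auto simp: bij_def)

lemma mp_aut_comp:
  assumes "mp_aut M S" "mp_aut M T" shows "mp_aut M (\<lambda>x. S (T x))"
proof (rule mp_autI)
  show "bij (\<lambda>x. S (T x))"
    using bij_comp[OF mp_autD(1)[OF assms(2)] mp_autD(1)[OF assms(1)]] by (simp add: o_def)
next
  fix C assume C: "C \<in> sets M"
  have e: "(\<lambda>x. S (T x)) -` C = T -` (S -` C)" "(\<lambda>x. S (T x)) ` C = S ` (T ` C)" by auto
  show "(\<lambda>x. S (T x)) -` C \<in> sets M" "(\<lambda>x. S (T x)) ` C \<in> sets M"
    "measure M ((\<lambda>x. S (T x)) ` C) = measure M C"
    unfolding e using C by (simp_all add: mp_autD[OF assms(1)] mp_autD[OF assms(2)])
qed

lemma mp_aut_inv: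
  assumes "mp_aut M S" shows "mp_aut M (inv_into UNIV S)"
proof (rule mp_autI)
  note b = mp_autD(1)[OF assms]
  show "bij (inv_into UNIV S)" using b by (rule bij_imp_bij_inv)
  fix C assume C: "C \<in> sets M"
  have e: "inv_into UNIV S -` C = S ` C" "inv_into UNIV S ` C = S -` C"
    using b by (simp_all add: bij_vimage_eq_inv_image[OF bij_imp_bij_inv] inv_inv_eq bij_vimage_eq_inv_image)
  show "inv_into UNIV S -` C \<in> sets M" "inv_into UNIV S ` C \<in> sets M" "measure M (inv_into UNIV S ` C) = measure M C"
    unfolding e using C by (simp_all add: mp_autD[OF assms])
qed

lemma AE_mp_aut:
  assumes "mp_aut M S" "AE x in M. P x" shows "AE x in M. P (S x)"
proof -
  have "distr M M S = M" using assms(1) by (simp add: mp_aut_def)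
  then have "AE x in distr M M S. P x" using assms(2) by metis
  then show ?thesis
    using assms(1) by (metis AE_distrD mp_aut_measurable)
qed

lemma AE_iff_measure_compl:
  assumes "A \<in> sets M" shows "(AE x in M. x \<in> A) \<longleftrightarrow> measure M (- A) = 0"
  using assms AE_iff_measurable[of "- A" M "\<lambda>x. x \<in> A"]
  by (auto simp: emeasure_eq_measure Compl_in_M)

lemma pisoD:
  assumes "piso M D T"
  shows "D \<in> sets M" "inj_on T D" "C \<in> sets M \<Longrightarrow> C \<subseteq> D \<Longrightarrow> T ` C \<in> sets M"
    "C \<in> sets M \<Longrightarrow> C \<subseteq> D \<Longrightarrow> measure M (T ` C) = measure M C"
    "C \<in> sets M \<Longrightarrow> D \<inter> T -` C \<in> sets M"
  using assms by (auto simp: piso_def)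

lemma piso_cong:
  assumes "piso M D T" "\<And>x. x \<in> D \<Longrightarrow> T' x = T x" shows "piso M D T'"
proof -
  have "T' ` C = T ` C" if "C \<subseteq> D" for C using assms(2) that by (auto intro!: image_cong)
  moreover have "D \<inter> T' -` C = D \<inter> T -` C" for C using assms(2) by auto
  moreover have "inj_on T' D \<longleftrightarrow> inj_on T D" using assms(2) by (rule inj_on_cong)
  ultimately show ?thesis using assms(1) by (simp add: piso_def)
qed

lemma piso_mp_aut:
  assumes "mp_aut M T" "D \<in> sets M" shows "piso M D T"
  using assms mp_autD[OF assms(1)] by (auto simp: piso_def bij_def intro: inj_on_subset)

text \<open>Disjoint images make the union injective. \<open>piso\<close> records measurability of
  images as well as of preimages, so both pass to countable unions.\<close>

lemma piso_UN:
  fixes D :: "nat \<Rightarrow> 'a set"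
  assumes p: "\<And>n. piso M (D n) T" and d: "disjoint_family D" "disjoint_family (\<lambda>n. T ` D n)"
  shows "piso M (\<Union>n. D n) T"
  unfolding piso_def
proof (intro conjI ballI impI)
  note pD = pisoD[OF p]
  show "(\<Union>n. D n) \<in> sets M" using pD(1) by auto
  show "inj_on T (\<Union>n. D n)"
  proof (rule inj_onI)
    fix x y assume "x \<in> (\<Union>n. D n)" "y \<in> (\<Union>n. D n)" and e: "T x = T y"
    then obtain n m where nm: "x \<in> D n" "y \<in> D m" by auto
    then have "T x \<in> T ` D n \<inter> T ` D m" using e by (metis IntI imageI)
    then have "n = m" using d(2) by (auto simp: disjoint_family_on_def)
    then show "x = y" using nm e pD(2)[of n] by (auto dest: inj_onD)
  qed
  fix C assume C: "C \<in> sets M"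
  have e0: "(\<Union>n. D n) \<inter> T -` C = (\<Union>n. D n \<inter> T -` C)" by auto
  show "(\<Union>n. D n) \<inter> T -` C \<in> sets M" unfolding e0 using pD(5)[OF C] by (intro sets.countable_nat_UN) (simp add: image_subset_iff)
  assume CD: "C \<subseteq> (\<Union>n. D n)"
  have Cn: "C \<inter> D n \<in> sets M" for n using C pD(1) by auto
  have e1: "C = (\<Union>n. C \<inter> D n)" using CD by auto
  have e2: "T ` C = (\<Union>n. T ` (C \<inter> D n))" using CD by blast
  have i: "T ` (C \<inter> D n) \<in> sets M" for n using pD(3)[OF Cn] by auto
  then show "T ` C \<in> sets M" unfolding e2 by auto
  have "(\<lambda>n. measure M (C \<inter> D n)) sums measure M (\<Union>n. C \<inter> D n)"
    using Cn d(1) by (intro finite_measure_UNION) (auto simp: disjoint_family_on_def)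
  moreover have "disjoint_family (\<lambda>n. T ` (C \<inter> D n))"
    using d(2) unfolding disjoint_family_on_def by blast
  then have "(\<lambda>n. measure M (T ` (C \<inter> D n))) sums measure M (\<Union>n. T ` (C \<inter> D n))"
    using i by (intro finite_measure_UNION) auto
  moreover have "measure M (T ` (C \<inter> D n)) = measure M (C \<inter> D n)" for n
    using pD(4)[OF Cn, of n] by auto
  ultimately show "measure M (T ` C) = measure M C"
    using e1 e2 sums_unique2 by (metis (no_types, lifting) sums_cong)
qed

lemma piso_glue:
  fixes D :: "nat \<Rightarrow> 'a set"
  assumes p: "\<And>n. piso M (D n) (T n)"
    and d: "disjoint_family D" "disjoint_family (\<lambda>n. T n ` D n)"
  obtains S where "piso M (\<Union>n. D n) S" and "\<And>n x. x \<in> D n \<Longrightarrow> S x = T n x"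
proof -
  \<comment> \<open>By disjointness the least index of a piece containing x is the only one.\<close>
  define S where "S x = T (LEAST n. x \<in> D n) x" for x
  have S: "S x = T n x" if "x \<in> D n" for n x
  proof -
    have "x \<in> D (LEAST n. x \<in> D n)" using that by (rule LeastI)
    then have "(LEAST n. x \<in> D n) = n" using d(1) that by (auto simp: disjoint_family_on_def)
    then show ?thesis by (simp add: S_def)
  qed
  have "S ` D n = T n ` D n" for n using S by (auto intro!: image_cong)
  then have "piso M (\<Union>n. D n) S"
    using d by (intro piso_UN piso_cong[OF p S]) auto
  then show thesis using S that by blast
qed

text \<open>Off the null set \<open>N'\<close>, the closure of the bad points under \<open>T\<close> and its inverse, \<open>T\<close> is a
  bijection; it is replaced by the identity on \<open>N'\<close>.\<close>

lemma piso_extend: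
  assumes p: "piso M D T" and full: "measure M D = 1"
  obtains S where "mp_aut M S" "\<And>x. S x = x \<or> (x \<in> D \<and> S x = T x)" "AE x in M. S x = T x"
proof -
  note pD = pisoD[OF p]
  define N where "N = rec_nat (- (D \<inter> T ` D)) (\<lambda>_ A. A \<union> T ` (A \<inter> D) \<union> (D \<inter> T -` A))"
  have N0: "N 0 = - (D \<inter> T ` D)" and NS: "N (Suc k) = N k \<union> T ` (N k \<inter> D) \<union> (D \<inter> T -` N k)" for k
    by (simp_all add: N_def)
  have TD: "T ` D \<in> sets M" "measure M (T ` D) = 1" using pD(3,4)[OF pD(1)] full by auto
  have null: "N k \<in> sets M \<and> measure M (N k) = 0" for k
  proof (induction k)
    case 0
    have "AE x in M. x \<in> D" "AE x in M. x \<in> T ` D"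
      using full TD pD(1) prob_compl[OF pD(1)] prob_compl[OF TD(1)]
      by (simp_all add: AE_iff_measure_compl Compl_eq_Diff_UNIV)
    then have "AE x in M. x \<in> D \<inter> T ` D" by auto
    then show ?case using TD(1) pD(1) unfolding N0 by (subst (asm) AE_iff_measure_compl) auto
  next
    case (Suc k)
    then have k: "N k \<in> sets M" "measure M (N k) = 0" by auto
    have a: "N k \<inter> D \<in> sets M" "N k \<inter> D \<subseteq> D" using k pD(1) by auto
    have "measure M (N k \<inter> D) = 0" by (rule measure_zero_subset[OF _ k]) auto
    then have A: "T ` (N k \<inter> D) \<in> sets M" "measure M (T ` (N k \<inter> D)) = 0"
      using pD(3,4)[OF a] by auto
    have b: "D \<inter> T -` N k \<in> sets M" using pD(5) k by auto
    \<comment> \<open>The preimage is handled through its image: T carries it into the null set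
      \<open>N k\<close> and preserves its measure.\<close>
    have "measure M (T ` (D \<inter> T -` N k)) = 0" by (rule measure_zero_subset[OF _ k]) auto
    then have "measure M (D \<inter> T -` N k) = 0" using pD(4)[OF b] by auto
    then show ?case using A b k unfolding NS by (simp add: measure_zero_union sets.Un)
  qed
  define N' where "N' = (\<Union>k. N k)"
  have N': "N' \<in> sets M" "measure M N' = 0"
    using null measure_UNION_le[of UNIV] unfolding N'_def
    by (auto intro!: measure_eq_0_null_sets null_sets_UN simp: null_sets_def emeasure_eq_measure)
  have X: "x \<in> D" if "x \<notin> N'" for x using that N0 unfolding N'_def by blast
  have TX: "T x \<notin> N'" if "x \<notin> N'" for x
  proof
    assume "T x \<in> N'"
    then obtain k where "T x \<in> N k" by (auto simp: N'_def)
    then have "x \<in> N (Suc k)" using X[OF that] by (auto simp: NS)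
    then show False using that by (auto simp: N'_def)
  qed
  have surj: "\<exists>x. x \<notin> N' \<and> T x = y" if "y \<notin> N'" for y
  proof -
    have "y \<in> T ` D" using that N0 unfolding N'_def by blast
    then obtain x where x: "x \<in> D" "T x = y" by auto
    have "x \<notin> N k" for k
    proof
      assume "x \<in> N k" then have "y \<in> N (Suc k)" using x by (auto simp: NS)
      then show False using that by (auto simp: N'_def)
    qed
    then show ?thesis using x by (auto simp: N'_def)
  qed
  define S where "S x = (if x \<in> N' then x else T x)" for x
  have bij: "bij S"
  proof (rule bijI)
    show "inj S"
    proof (rule injI)
      fix x y assume "S x = S y"
      then show "x = y" using TX X pD(2) by (auto simp: S_def split: if_splits dest: inj_onD)
    qed
    show "surj S" unfolding surj_def using surj S_def by metis
  qed
  have im: "S ` C = T ` (C - N') \<union> (C \<inter> N')" for C by (auto simp: S_def)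
  have CN: "C \<in> sets M \<Longrightarrow> C - N' \<in> sets M" "C - N' \<subseteq> D" for C using N' X by auto
  have S: "mp_aut M S"
  proof (rule mp_autI[OF bij])
    fix C assume C: "C \<in> sets M"
    have "S -` C = (D \<inter> T -` C - N') \<union> (C \<inter> N')" using X by (auto simp: S_def split: if_splits)
    then show "S -` C \<in> sets M" using pD(5)[OF C] N' C by auto
    show i: "S ` C \<in> sets M" unfolding im using pD(3)[OF CN(1)[OF C] CN(2)] C N' by auto
    have z: "measure M (C \<inter> N') = 0" by (rule measure_zero_subset[OF _ N']) auto
    have "measure M (S ` C) = measure M (T ` (C - N'))"
      unfolding im using pD(3)[OF CN(1)[OF C] CN(2)] C N' z by (intro measure_zero_union) auto
    also have "\<dots> = measure M (C - N')" using pD(4)[OF CN(1)[OF C] CN(2)] .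
    also have "\<dots> = measure M C" using z C N'(1) by (subst finite_measure_Diff') auto
    finally show "measure M (S ` C) = measure M C" .
  qed
  have "AE x in M. x \<in> - N'" using N' by (subst AE_iff_measure_compl) auto
  then have "AE x in M. S x = T x" by eventually_elim (auto simp: S_def)
  moreover have "S x = x \<or> x \<in> D \<and> S x = T x" for x using X by (auto simp: S_def)
  ultimately show thesis using S that by blast
qed

end

section \<open>Isomorphism of standard probability spaces\<close>

lemma sum_ternary_bounds:
  fixes a :: "nat \<Rightarrow> real"
  assumes "\<And>n. 0 \<le> a n" "\<And>n. a n \<le> 1"
  shows "summable (\<lambda>n. a n * (1/3)^n)" "0 \<le> (\<Sum>n. a n * (1/3)^n)" "(\<Sum>n. a n * (1/3)^n) \<le> 3/2"
proof -
  have g: "summable (\<lambda>n. (1/3::real)^n)" "(\<Sum>n. (1/3::real)^n) = 3/2"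
    by (auto simp: summable_geometric suminf_geometric)
  have le: "a n * (1/3)^n \<le> (1/3)^n" "0 \<le> a n * (1/3)^n" for n
    using assms by (auto intro!: mult_left_le_one_le)
  show s: "summable (\<lambda>n. a n * (1/3)^n)"
    by (rule summable_comparison_test'[OF g(1), of 0]) (use le in auto)
  show "0 \<le> (\<Sum>n. a n * (1/3)^n)" by (rule suminf_nonneg[OF s le(2)])
  show "(\<Sum>n. a n * (1/3)^n) \<le> 3/2" unfolding g(2)[symmetric] by (rule suminf_le[OF le(1) s g(1)])
qed

text \<open>Digits 0 and 1 in base 3 leave no room for carries: at the first disagreement the digits
  differ by \<open>(1/3)^n\<close>, while everything after it amounts to at most half of
  that.\<close>

lemma ternary_inject:
  fixes P Q :: "nat \<Rightarrow> bool"
  assumes eq: "(\<Sum>n. of_bool (P n) * (1/3::real)^n) = (\<Sum>n. of_bool (Q n) * (1/3)^n)"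
  shows "P = Q"
proof (rule ccontr)
  assume "P \<noteq> Q"
  then obtain n0 where "P n0 \<noteq> Q n0" by auto
  define n where "n = (LEAST n. P n \<noteq> Q n)"
  have n: "P n \<noteq> Q n" unfolding n_def by (rule LeastI[of _ n0]) fact
  have b: "P m = Q m" if "m < n" for m using not_less_Least[of m "\<lambda>n. P n \<noteq> Q n"] that n_def by auto
  have split: "(\<Sum>m. of_bool (R m) * (1/3::real)^m) =
     (\<Sum>m<n. of_bool (R m) * (1/3::real)^m) + of_bool (R n) * (1/3)^n
       + (1/3)^(Suc n) * (\<Sum>m. of_bool (R (m + Suc n)) * (1/3)^m)" for R
  proof -
    have "(\<Sum>m. of_bool (R m) * (1/3::real)^m) = (\<Sum>m. of_bool (R (m + Suc n)) * (1/3::real)^(m + Suc n))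
         + (\<Sum>m<Suc n. of_bool (R m) * (1/3::real)^m)"
      by (rule suminf_split_initial_segment) (rule sum_ternary_bounds; simp)
    also have "(\<Sum>m. of_bool (R (m + Suc n)) * (1/3::real)^(m + Suc n)) =
        (\<Sum>m. (1/3)^(Suc n) * (of_bool (R (m + Suc n)) * (1/3::real)^m))"
      by (intro suminf_cong) (simp add: power_add)
    also have "\<dots> = (1/3)^(Suc n) * (\<Sum>m. of_bool (R (m + Suc n)) * (1/3::real)^m)"
      by (rule suminf_mult) (rule sum_ternary_bounds; simp)
    finally show ?thesis by simp
  qed
  have bd: "0 \<le> (1/3)^(Suc n) * (\<Sum>m. of_bool (R (m + Suc n)) * (1/3::real)^m)"
     "(1/3)^(Suc n) * (\<Sum>m. of_bool (R (m + Suc n)) * (1/3::real)^m) \<le> (1/3)^n / 2" for R :: "nat \<Rightarrow> bool"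
    using sum_ternary_bounds(2,3)[of "\<lambda>m. of_bool (R (m + Suc n))"] by (auto simp: field_simps)
  have s: "(\<Sum>m<n. of_bool (P m) * (1/3::real)^m) = (\<Sum>m<n. of_bool (Q m) * (1/3::real)^m)"
    using b by (intro sum.cong) auto
  define t where "t R = (1/3)^(Suc n) * (\<Sum>m. of_bool (R (m + Suc n)) * (1/3::real)^m)" for R
  define x :: real where "x = (1/3)^n"
  have "x > 0" by (simp add: x_def)
  moreover have "of_bool (P n) * x + t P = of_bool (Q n) * x + t Q"
    using eq[unfolded split[of P] split[of Q] s] unfolding t_def x_def by linarith
  moreover have "0 \<le> t P" "t P \<le> x / 2" "0 \<le> t Q" "t Q \<le> x / 2" using bd by (auto simp only: t_def x_def)
  ultimately show False using n by (cases "P n"; cases "Q n") auto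
qed

context std_space
begin

text \<open>An enumerated base serves twice: to tell points apart by countably many tests, and to
  find a basic set inside a given neighbourhood.\<close>

lemma separating_sequence:
  obtains B :: "nat \<Rightarrow> 'a set" where "\<And>n. open (B n)"
    and "\<And>U x. open U \<Longrightarrow> x \<in> U \<Longrightarrow> \<exists>n. x \<in> B n \<and> B n \<subseteq> U"
proof -
  obtain \<B> :: "'a set set" where B: "countable \<B>" "topological_basis \<B>" using ex_countable_basis by auto
  then have ne: "\<B> \<noteq> {}" using topological_basisE[OF B(2) open_UNIV] by auto
  show thesis
  proof
    show "open (from_nat_into \<B> n)" for n
      using B(2) from_nat_into[OF ne] topological_basis_open by blast
    fix U :: "'a set" and x assume "open U" "x \<in> U"
    then obtain V where "V \<in> \<B>" "x \<in> V" "V \<subseteq> U" using topological_basisE[OF B(2)] by metis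
    then show "\<exists>n. x \<in> from_nat_into \<B> n \<and> from_nat_into \<B> n \<subseteq> U"
      using from_nat_into_surj[OF B(1)] by metis
  qed
qed

text \<open>Membership of x in the sets of a countable base, read as ternary digits, determines
  x.\<close>

lemma real_coordinate:
  obtains h :: "'a \<Rightarrow> real" where "inj h" "h \<in> borel_measurable M"
proof -
  obtain B :: "nat \<Rightarrow> 'a set" where B: "\<And>n. open (B n)"
    and sep: "\<And>U x. open U \<Longrightarrow> x \<in> U \<Longrightarrow> \<exists>n. x \<in> B n \<and> B n \<subseteq> U"
    using separating_sequence by metis
  define h where "h x = (\<Sum>n. of_bool (x \<in> B n) * (1/3::real)^n)" for x
  have "inj h"
  proof (rule injI, rule ccontr)
    fix x y assume e: "h x = h y" and ne: "x \<noteq> y"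
    have iff: "x \<in> B n \<longleftrightarrow> y \<in> B n" for n
      using fun_cong[OF ternary_inject[OF e[unfolded h_def]]] .
    obtain n where "x \<in> B n" "B n \<subseteq> - {y}" using sep[of "- {y}" x] ne by auto
    then show False using iff by auto
  qed
  moreover have "h \<in> borel_measurable M"
    unfolding h_def
  proof (rule borel_measurable_suminf)
    fix n
    have "B n \<in> sets M" using B sets_M by auto
    then have "(\<lambda>x. indicator (B n) x * (1/3::real)^n) \<in> borel_measurable M" by measurable
    then show "(\<lambda>x. of_bool (x \<in> B n) * (1/3::real)^n) \<in> borel_measurable M"
      by (simp add: indicator_def of_bool_def cong: if_cong)
  qed
  ultimately show thesis using that by blast
qed

abbreviation push :: "'a set \<Rightarrow> ('a \<Rightarrow> real) \<Rightarrow> real measure" where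
  "push U g \<equiv> distr (restrict_space M U) borel g"

lemma push:
  assumes "g \<in> borel_measurable M" "U \<in> sets M"
  shows "finite_borel_measure (push U g)"
    and "A \<in> sets borel \<Longrightarrow> measure (push U g) A = measure M (U \<inter> g -` A)"
proof -
  have m: "g \<in> borel_measurable (restrict_space M U)" using assms(1) by (rule measurable_restrict_space1)
  have f: "finite_measure (restrict_space M U)"
    using assms(2) by (intro finite_measure_restrict_space finite_measure_axioms) auto
  show "finite_borel_measure (push U g)"
    using finite_measure.finite_measure_distr[OF f m]
    by (simp add: finite_borel_measure_def finite_borel_measure_axioms_def)
  show "measure (push U g) A = measure M (U \<inter> g -` A)" if "A \<in> sets borel"
    using m that assms(2)
    by (subst measure_distr) (auto simp: space_restrict_space measure_restrict_space Int_commute)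
qed

lemma vimage_borel: "g \<in> borel_measurable M \<Longrightarrow> A \<in> sets borel \<Longrightarrow> g -` A \<in> sets M"
  using measurable_sets[of g M borel A] by simp

text \<open>Lusin's theorem. Each preimage of a basic open set \<open>V n\<close> is enclosed in an
  open \<open>W n\<close> of little excess. Off the union of the excesses these preimages are
  relatively open, so g is continuous there, and inner regularity supplies a compact set.\<close>

lemma lusin:
  fixes g :: "'a \<Rightarrow> real"
  assumes g: "g \<in> borel_measurable M" and U: "U \<in> sets M" and e: "e > 0"
  obtains K where "compact K" "K \<subseteq> U" "continuous_on K g" "measure M (U - K) < e"
proof -
  obtain \<B> :: "real set set" where B: "countable \<B>" "topological_basis \<B>" using ex_countable_basis by auto
  then have ne: "\<B> \<noteq> {}" using topological_basisE[OF B(2) open_UNIV] by auto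
  define V where "V = from_nat_into \<B>"
  have oV: "open (V n)" for n
    unfolding V_def using B(2) from_nat_into[OF ne] topological_basis_open by blast
  have gV: "g -` V n \<in> sets M" for n using vimage_borel[OF g] oV by auto
  have fin: "emeasure M A \<noteq> \<infinity>" for A by (simp add: emeasure_eq_measure)
  \<comment> \<open>Half of e is spread geometrically over the excesses; the other half is lost in
    passing to the compact set.\<close>
  have "\<exists>W. open W \<and> g -` V n \<subseteq> W \<and> measure M (W - g -` V n) < e / 2 * (1/2)^(Suc n)" for n
  proof -
    define d where "d = e / 2 * (1/2)^(Suc n)"
    have d: "d > 0" using e by (simp add: d_def)
    have "emeasure M (g -` V n) = (INF W \<in> {W. g -` V n \<subseteq> W \<and> open W}. emeasure M W)"
      using gV[of n] sets_M by (intro outer_regular) (auto simp: emeasure_eq_measure)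
    moreover have "emeasure M (g -` V n) < ennreal (measure M (g -` V n) + d)"
      using d by (simp add: emeasure_eq_measure ennreal_less_iff)
    ultimately obtain W where W: "g -` V n \<subseteq> W" "open W" "emeasure M W < ennreal (measure M (g -` V n) + d)"
      by (auto simp: INF_less_iff)
    have Ws: "W \<in> sets M" using W sets_M by auto
    have "measure M W < measure M (g -` V n) + d"
      using W(3) by (simp add: emeasure_eq_measure ennreal_less_iff)
    then have "measure M (W - g -` V n) < d" using W(1) Ws gV by (subst finite_measure_Diff) auto
    then show ?thesis using W unfolding d_def by blast
  qed
  then obtain W where W: "\<And>n. open (W n)" "\<And>n. g -` V n \<subseteq> W n"
      "\<And>n. measure M (W n - g -` V n) < e / 2 * (1/2)^(Suc n)" by metis
  define E where "E n = W n - g -` V n" for n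
  have Es: "E n \<in> sets M" for n unfolding E_def using W(1) sets_M gV by auto
  have sm: "(\<lambda>n. e / 2 * (1/2)^(Suc n)) sums (e / 2)"
    using sums_mult[OF power_half_series, of "e/2"] by simp
  have sE: "summable (\<lambda>n. measure M (E n))"
    by (rule summable_comparison_test'[OF sums_summable[OF sm], of 0]) (use W(3) in \<open>auto simp: E_def intro: less_imp_le\<close>)
  have "measure M (\<Union>n. E n) \<le> (\<Sum>n. measure M (E n))"
    using Es sE by (intro finite_measure_subadditive_countably) auto
  also have "\<dots> \<le> (\<Sum>n. e / 2 * (1/2)^(Suc n))"
    by (rule suminf_le[OF _ sE sums_summable[OF sm]]) (use W(3) in \<open>auto simp: E_def intro: less_imp_le\<close>)
  also have "\<dots> = e / 2" using sm by (simp add: sums_iff)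
  finally have mE: "measure M (\<Union>n. E n) \<le> e / 2" .
  define U' where "U' = U - (\<Union>n. E n)"
  have U's: "U' \<in> sets M" unfolding U'_def using U Es by auto
  have "\<exists>K. compact K \<and> K \<subseteq> U' \<and> measure M U' - e / 2 < measure M K"
  \<comment> \<open>A negative bound would be truncated to 0 in \<open>ennreal\<close>, which spoils
    the strict inequality; then the empty set serves.\<close>
  proof (cases "measure M U' - e / 2 < 0")
    case True then show ?thesis by (intro exI[of _ "{}"]) auto
  next
    case False
    have "emeasure M U' = (SUP K \<in> {K. K \<subseteq> U' \<and> compact K}. emeasure M K)"
      using U's sets_M by (intro inner_regular) (auto simp: emeasure_eq_measure)
    moreover have "ennreal (measure M U' - e / 2) < emeasure M U'"
      using e False by (simp add: emeasure_eq_measure ennreal_less_iff)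
    ultimately obtain K where "K \<subseteq> U'" "compact K" "ennreal (measure M U' - e / 2) < emeasure M K"
      by (auto simp: less_SUP_iff)
    then show ?thesis using False by (auto simp: emeasure_eq_measure ennreal_less_iff)
  qed
  then obtain K where K: "compact K" "K \<subseteq> U'" "measure M U' - e / 2 < measure M K" by auto
  have Ks: "K \<in> sets M" using compact_imp_closed[OF K(1)] sets_M by auto
  show thesis
  proof
    show "compact K" "K \<subseteq> U" using K by (auto simp: U'_def)
    show "continuous_on K g"
      unfolding continuous_on_topological
    proof (intro ballI allI impI)
      fix x O' assume x: "x \<in> K" and O': "open O'" "g x \<in> O'"
      then obtain v where v: "v \<in> \<B>" "g x \<in> v" "v \<subseteq> O'" using topological_basisE[OF B(2)] by metis
      then obtain n where n: "v = V n" using from_nat_into_surj[OF B(1)] unfolding V_def by metis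
      have "g y \<in> O'" if "y \<in> K" "y \<in> W n" for y
      proof -
        have "y \<notin> E n" using that K(2) by (auto simp: U'_def)
        then show ?thesis using that n v by (auto simp: E_def)
      qed
      moreover have "x \<in> W n" using W(2)[of n] v n by auto
      ultimately show "\<exists>A. open A \<and> x \<in> A \<and> (\<forall>y\<in>K. y \<in> A \<longrightarrow> g y \<in> O')" using W(1) by blast
    qed
    have "measure M (U - K) \<le> measure M ((U' - K) \<union> (\<Union>n. E n))"
      using U's Ks Es by (intro measure_mono_M) (auto simp: U'_def)
    also have "\<dots> \<le> measure M (U' - K) + measure M (\<Union>n. E n)"
      using U's Ks Es by (intro measure_Un_le) auto
    also have "measure M (U' - K) = measure M U' - measure M K"
      using U's Ks K(2) by (intro finite_measure_Diff) auto
    finally show "measure M (U - K) < e" using K(3) mE by simp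
  qed
qed

text \<open>An injective continuous function on a compact set has a continuous inverse, so it sends
  Borel subsets to Borel sets. Countably many compact sets from Lusin's theorem exhaust U up to a
  null set.\<close>

lemma lusin_souslin_ae:
  fixes g :: "'a \<Rightarrow> real"
  assumes g: "g \<in> borel_measurable M" and U: "U \<in> sets M" and inj: "inj_on g U"
  obtains U' where "U' \<in> sets M" "U' \<subseteq> U" "measure M (U - U') = 0"
    "\<And>C. C \<in> sets M \<Longrightarrow> C \<subseteq> U' \<Longrightarrow> g ` C \<in> sets borel"
proof -
  have "\<exists>K. compact K \<and> K \<subseteq> U \<and> continuous_on K g \<and> measure M (U - K) < 1 / real (Suc n)" for n
    using lusin[OF g U, of "1 / real (Suc n)"] by (metis of_nat_0_less_iff zero_less_Suc zero_less_divide_1_iff)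
  then obtain K where K: "\<And>n. compact (K n)" "\<And>n. K n \<subseteq> U" "\<And>n. continuous_on (K n) g"
      "\<And>n. measure M (U - K n) < 1 / real (Suc n)" by metis
  have Ks: "K n \<in> sets M" for n using compact_imp_closed[OF K(1)] sets_M by auto
  show thesis
  proof
    show U's: "(\<Union>n. K n) \<in> sets M" using Ks by auto
    show "(\<Union>n. K n) \<subseteq> U" using K(2) by auto
    have "measure M (U - (\<Union>n. K n)) \<le> 1 / real (Suc n)" for n
      using measure_mono_M[of "U - (\<Union>n. K n)" "U - K n"] K(4)[of n] U Ks[of n] by fastforce
    then have "measure M (U - (\<Union>n. K n)) \<le> 0"
      by (intro LIMSEQ_le_const[OF LIMSEQ_inverse_real_of_nat]) (auto simp: inverse_eq_divide)
    then show "measure M (U - (\<Union>n. K n)) = 0" by (simp add: measure_le_0_iff)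
    fix C assume C: "C \<in> sets M" "C \<subseteq> (\<Union>n. K n)"
    have "g ` (C \<inter> K n) \<in> sets borel" for n
    proof -
      define k where "k = inv_into U g"
      have k: "\<forall>x\<in>K n. k (g x) = x" using K(2)[of n] inj unfolding k_def by (auto intro: inv_into_f_f)
      have gK: "closed (g ` K n)" using compact_continuous_image[OF K(3) K(1)] compact_imp_closed by blast
      have "k \<in> borel_measurable (restrict_space borel (g ` K n))"
        by (rule borel_measurable_continuous_on_restrict[OF continuous_on_inv[OF K(3) K(1) k]])
      then have "k -` C \<inter> space (restrict_space borel (g ` K n)) \<in> sets (restrict_space borel (g ` K n))"
        using C sets_M by (intro measurable_sets) auto
      then have "k -` C \<inter> g ` K n \<in> sets borel"
        using gK by (auto simp: space_restrict_space sets_restrict_space_iff)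
      moreover have "k -` C \<inter> g ` K n = g ` (C \<inter> K n)" using k by force
      ultimately show ?thesis by simp
    qed
    moreover have "g ` C = (\<Union>n. g ` (C \<inter> K n))" using C(2) by blast
    ultimately show "g ` C \<in> sets borel" by auto
  qed
qed

lemma measure_singleton:
  assumes "atomless M" shows "measure M {x} = 0"
proof (rule ccontr)
  assume a: "measure M {x} \<noteq> 0"
  have "{x} \<in> sets M" using sets_M by auto
  moreover have "0 < emeasure M {x}" using a by (simp add: emeasure_eq_measure zero_less_measure_iff)
  ultimately obtain B where "B \<subseteq> {x}" "0 < emeasure M B" "emeasure M B < emeasure M {x}"
    using assms unfolding atomless_def by blast
  then show False by (auto simp: subset_singleton_iff)
qed

text \<open>The probability integral transform: a real coordinate h followed by its own distribution
  function F on U. As points have measure zero, F is continuous and g carries the measure on U to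
  Lebesgue measure on an interval of length \<open>measure M U\<close>.\<close>

lemma interval_coordinate:
  assumes atomless: "atomless M" and U: "U \<in> sets M"
  obtains g :: "'a \<Rightarrow> real" and U' where "g \<in> borel_measurable M" "U' \<in> sets M" "U' \<subseteq> U"
    "measure M (U - U') = 0" "inj_on g U'" "g ` U' \<subseteq> {0..measure M U}"
    "\<And>C. C \<in> sets M \<Longrightarrow> C \<subseteq> U' \<Longrightarrow> g ` C \<in> sets borel"
    "\<And>B. B \<in> sets borel \<Longrightarrow> measure M (U \<inter> g -` B) = measure lborel (B \<inter> {0..measure M U})"
proof -
  obtain h :: "'a \<Rightarrow> real" where h: "inj h" "h \<in> borel_measurable M" using real_coordinate by auto
  define m where "m = measure M U"
  define F where "F s = measure M (U \<inter> h -` {..s})" for s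
  interpret N: finite_borel_measure "push U h" by (rule push[OF h(2) U])
  have F: "F = cdf (push U h)"
    by (rule ext) (simp add: F_def cdf_def push(2)[OF h(2) U])
  have z: "measure (push U h) {s} = 0" for s
  proof -
    have "U \<inter> h -` {s} \<subseteq> {inv_into UNIV h s}" using h(1) by auto
    moreover have "{inv_into UNIV h s} \<in> sets M" using sets_M by auto
    ultimately have "measure M (U \<inter> h -` {s}) = 0"
      using measure_zero_subset measure_singleton[OF atomless] by blast
    then show ?thesis by (simp add: push(2)[OF h(2) U])
  qed
  have cont: "continuous_on UNIV F" unfolding F
    using N.isCont_cdf z by (auto simp: continuous_on_eq_continuous_at)
  have mono: "F s \<le> F t" if "s \<le> t" for s t unfolding F using N.cdf_nondecreasing that .
  have F01: "0 \<le> F s" "F s \<le> m" for s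
    using U by (auto simp: F_def m_def intro!: measure_mono_M)
  have top: "(F \<longlongrightarrow> m) at_top"
  proof -
    have "measure (push U h) (space (push U h)) = m" using push(2)[OF h(2) U, of UNIV] by (simp add: m_def)
    then show ?thesis unfolding F using N.cdf_lim_at_top by simp
  qed
  have bot: "(F \<longlongrightarrow> 0) at_bot" unfolding F by (rule N.cdf_lim_at_bot)
  define g where "g x = F (h x)" for x
  have gm: "g \<in> borel_measurable M"
    unfolding g_def using borel_measurable_continuous_onI[OF cont] h(2) by measurable
  have mid: "measure M (U \<inter> g -` {..t}) = t" if t: "0 < t" "t < m" for t
  proof -
    \<comment> \<open>The sublevel set of F at t is a half line ending at s, and F attains t exactly
      there, so the condition on g becomes one on h.\<close>
    define S where "S = {s. F s \<le> t}"
    have cS: "closed S" unfolding S_def by (intro closed_Collect_le cont continuous_intros)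
    obtain s0 where s0: "F s0 < t" using order_tendstoD(2)[OF bot t(1)] by (auto simp: eventually_at_bot_linorder)
    obtain s1 where s1: "t < F s1" using order_tendstoD(1)[OF top t(2)] by (auto simp: eventually_at_top_linorder)
    have ub: "s \<le> s1" if "s \<in> S" for s
    proof (rule ccontr)
      assume "\<not> s \<le> s1" then have "F s1 \<le> F s" using mono by simp
      then show False using that s1 by (simp add: S_def)
    qed
    then have bdd: "bdd_above S" by (auto simp: bdd_above_def)
    have ne: "S \<noteq> {}" using less_imp_le[OF s0] by (auto simp: S_def)
    define s where "s = Sup S"
    have sS: "s \<in> S" unfolding s_def by (rule closed_contains_Sup[OF ne bdd cS])
    have iff: "F r \<le> t \<longleftrightarrow> r \<le> s" for r
      using mono[of r s] sS cSup_upper[OF _ bdd, of r] by (auto simp: S_def s_def)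
    have "s \<le> s1" using ub sS by blast
    then obtain r where r: "s \<le> r" "F r = t"
      using IVT'[of F s t s1] sS s1 continuous_on_subset[OF cont] by (auto simp: S_def)
    then have "r = s" using iff[of r] by auto
    then have "F s = t" using r by simp
    moreover have "U \<inter> g -` {..t} = U \<inter> h -` {..s}" using iff by (auto simp: g_def)
    ultimately show ?thesis by (simp add: F_def)
  qed
  interpret P: finite_borel_measure "push U g" by (rule push[OF gm U])
  have cP: "cdf (push U g) t = measure M (U \<inter> g -` {..t})" for t
    by (simp add: cdf_def push(2)[OF gm U])
  have m0: "0 \<le> m" by (simp add: m_def)
  have cdf: "cdf (push U g) t = max 0 (min t m)" for t
  proof (cases "t \<ge> m")
    case True
    then have "g x \<le> t" for x using F01(2)[of "h x"] by (simp add: g_def)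
    then have "U \<inter> g -` {..t} = U" by auto
    then show ?thesis using True m0 by (simp add: cP m_def)
  next
    case F: False
    show ?thesis
    proof (cases "t > 0")
      case True then show ?thesis using mid[of t] F by (simp add: cP)
    next
      case False
      have mp: "m > 0 \<or> m = 0" using m0 by linarith
      have "measure M (U \<inter> g -` {..t}) \<le> 0"
        using mp
      proof
        assume "m = 0" then show ?thesis using measure_mono_M[of "U \<inter> g -` {..t}" U] U by (auto simp: m_def)
      next
        assume mp: "m > 0"
        show ?thesis
        proof (rule field_le_epsilon)
          fix e :: real assume e: "e > 0"
          \<comment> \<open>For t at most 0 the mass is compared with that at a small positive
            level, where it is already known.\<close>
          define e' where "e' = min e (m/2)"
          have e': "0 < e'" "e' < m" "e' \<le> e" using e mp by (auto simp: e'_def)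
          have "measure M (U \<inter> g -` {..t}) \<le> measure M (U \<inter> g -` {..e'})"
            using False e' U vimage_borel[OF gm] by (intro measure_mono_M) auto
          then show "measure M (U \<inter> g -` {..t}) \<le> 0 + e" using mid[OF e'(1,2)] e' by simp
        qed
      qed
      then show ?thesis using False by (simp add: cP measure_le_0_iff)
    qed
  qed
  define L where "L = distr (restrict_space lborel {0..m}) borel (\<lambda>x. x)"
  have Lm: "measure L B = measure lborel (B \<inter> {0..m})" if "B \<in> sets borel" for B
  proof -
    have "(\<lambda>x. x) \<in> borel_measurable (restrict_space lborel {0..m})" by (rule measurable_restrict_space1) simp
    then show ?thesis unfolding L_def using that
      by (subst measure_distr) (auto simp: space_restrict_space measure_restrict_space)
  qed
  have Lf: "finite_borel_measure L"
  proof -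
    have "finite_measure (restrict_space lborel {0..m})"
      using m0 by (intro finite_measureI) (simp add: emeasure_restrict_space space_restrict_space)
    then have "finite_measure L" unfolding L_def
      by (rule finite_measure.finite_measure_distr) (rule measurable_restrict_space1, simp)
    then show ?thesis by (simp add: finite_borel_measure_def finite_borel_measure_axioms_def L_def)
  qed
  have "cdf L t = max 0 (min t m)" for t
  proof -
    have "{..t} \<inter> {0..m} = {0..min t m}" by auto
    then show ?thesis using m0 by (auto simp: cdf_def Lm)
  qed
  then have eq: "push U g = L"
    using cdf by (intro cdf_unique' push(1)[OF gm U] Lf) auto
  have gB: "measure M (U \<inter> g -` B) = measure lborel (B \<inter> {0..m})" if "B \<in> sets borel" for B
    using push(2)[OF gm U that] Lm[OF that] eq by simp
  \<comment> \<open>Two points can share a value of g only where F is constant between their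
    coordinates. A rational lies between them, so deleting the countably many null fibres over
    \<open>F r\<close> with r rational makes g injective.\<close>
  define U1 where "U1 = U - (\<Union>r\<in>\<rat>. g -` {F r})"
  have zr: "measure M (U \<inter> g -` {c}) = 0" for c
    by (subst gB) (auto simp: Int_insert_left measure_def)
  have U1: "U1 \<in> sets M" unfolding U1_def
    using U vimage_borel[OF gm] by (intro sets.Diff sets.countable_UN' countable_rat) auto
  have "measure M (\<Union>r\<in>\<rat>. U \<inter> g -` {F r}) = 0"
  proof -
    have "(\<Union>r\<in>\<rat>. U \<inter> g -` {F r}) \<in> null_sets M"
      using zr U vimage_borel[OF gm]
      by (intro null_sets_UN' countable_rat) (auto simp: null_sets_def emeasure_eq_measure)
    then show ?thesis by (simp add: null_sets_def measure_def)
  qed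
  moreover have "U - U1 = (\<Union>r\<in>\<rat>. U \<inter> g -` {F r})" by (auto simp: U1_def)
  ultimately have UU1: "measure M (U - U1) = 0" by simp
  have ne: False if xy: "x \<in> U1" "y \<in> U1" "g x = g y" "h x < h y" for x y
  proof -
    obtain r where r: "r \<in> \<rat>" "h x < r" "r < h y" using Rats_dense_in_real[OF xy(4)] by auto
    have "F (h x) \<le> F r" "F r \<le> F (h y)" using mono r by auto
    then have "g x = F r" using xy(3) by (simp add: g_def)
    then show False using xy(1) r by (auto simp: U1_def)
  qed
  have inj: "inj_on g U1"
  proof (rule inj_onI)
    fix x y assume xy: "x \<in> U1" "y \<in> U1" "g x = g y"
    then have "\<not> h x < h y" "\<not> h y < h x" using ne[of x y] ne[of y x] by auto
    then show "x = y" using h(1) by (auto dest: injD)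
  qed
  obtain U' where U': "U' \<in> sets M" "U' \<subseteq> U1" "measure M (U1 - U') = 0"
    "\<And>C. C \<in> sets M \<Longrightarrow> C \<subseteq> U' \<Longrightarrow> g ` C \<in> sets borel"
    using lusin_souslin_ae[OF gm U1 inj] by metis
  show thesis
  proof
    show "U' \<subseteq> U" using U'(2) by (auto simp: U1_def)
    have "U - U' = (U - U1) \<union> (U1 - U')" using U'(2) by (auto simp: U1_def)
    then show "measure M (U - U') = 0" using UU1 U'(1,3) U1 U by (simp add: measure_zero_union)
    show "inj_on g U'" using inj U'(2) by (rule inj_on_subset)
    show "g ` U' \<subseteq> {0..measure M U}" using F01 by (auto simp: g_def m_def)
  qed (use U' gm gB m_def in auto)
qed

text \<open>Both sets are coordinatised by intervals starting at 0, and points with equal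
  coordinates are matched. The shorter interval is then used up, which exhausts the domain or the
  range.\<close>

lemma piso_exists:
  assumes atomless: "atomless M" and U: "U \<in> sets M" and V: "V \<in> sets M"
  obtains D T where "piso M D T" "D \<subseteq> U" "T ` D \<subseteq> V"
    "measure M (U - D) = 0 \<or> measure M (V - T ` D) = 0"
proof -
  obtain g U' where g: "g \<in> borel_measurable M" "U' \<in> sets M" "U' \<subseteq> U"
    "measure M (U - U') = 0" "inj_on g U'" "g ` U' \<subseteq> {0..measure M U}"
    "\<And>C. C \<in> sets M \<Longrightarrow> C \<subseteq> U' \<Longrightarrow> g ` C \<in> sets borel"
    "\<And>B. B \<in> sets borel \<Longrightarrow> measure M (U \<inter> g -` B) = measure lborel (B \<inter> {0..measure M U})"
    using interval_coordinate[OF atomless U] by metis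
  obtain f V' where f: "f \<in> borel_measurable M" "V' \<in> sets M" "V' \<subseteq> V"
    "measure M (V - V') = 0" "inj_on f V'" "f ` V' \<subseteq> {0..measure M V}"
    "\<And>C. C \<in> sets M \<Longrightarrow> C \<subseteq> V' \<Longrightarrow> f ` C \<in> sets borel"
    "\<And>B. B \<in> sets borel \<Longrightarrow> measure M (V \<inter> f -` B) = measure lborel (B \<inter> {0..measure M V})"
    using interval_coordinate[OF atomless V] by metis
  define D where "D = U' \<inter> g -` (f ` V')"
  define T where "T x = inv_into V' f (g x)" for x
  have fV: "f ` V' \<in> sets borel" and gU: "g ` U' \<in> sets borel" using f(2,7) g(2,7) by auto
  have D: "D \<in> sets M" unfolding D_def using g(1,2) fV vimage_borel by auto
  have T: "T x \<in> V'" "f (T x) = g x" if "x \<in> D" for x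
    using that by (auto simp: D_def T_def intro: inv_into_into f_inv_into_f)
  have TC: "T ` C = V' \<inter> f -` (g ` C)" if "C \<subseteq> D" for C
  proof
    show "T ` C \<subseteq> V' \<inter> f -` (g ` C)" using T that by auto
    show "V' \<inter> f -` (g ` C) \<subseteq> T ` C"
    proof
      fix y assume "y \<in> V' \<inter> f -` (g ` C)"
      then obtain x where x: "y \<in> V'" "x \<in> C" "f y = g x" by auto
      then have "x \<in> D" using that by auto
      then have "y = T x" using T[of x] x inj_onD[OF f(5), of y "T x"] by auto
      then show "y \<in> T ` C" using x by auto
    qed
  qed
  have nullV: "measure M (V' \<inter> f -` B) = measure M (V \<inter> f -` B)" if "B \<in> sets borel" for B
  proof -
    have z: "measure M (V \<inter> f -` B - V') = 0"
      by (rule measure_zero_subset[OF _ _ f(4)]) (use V f(2) in auto)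
    have "V \<inter> f -` B = (V' \<inter> f -` B) \<union> (V \<inter> f -` B - V')" using f(3) by auto
    then show ?thesis using z V f(1,2) vimage_borel[OF f(1) that]
      by (metis measure_zero_union sets.Diff sets.Int)
  qed
  have nullU: "measure M (U' \<inter> g -` B) = measure M (U \<inter> g -` B)" if "B \<in> sets borel" for B
  proof -
    have z: "measure M (U \<inter> g -` B - U') = 0"
      by (rule measure_zero_subset[OF _ _ g(4)]) (use U g(2) in auto)
    have "U \<inter> g -` B = (U' \<inter> g -` B) \<union> (U \<inter> g -` B - U')" using g(3) by auto
    then show ?thesis using z U g(1,2) vimage_borel[OF g(1) that]
      by (metis measure_zero_union sets.Diff sets.Int)
  qed
  have p: "piso M D T" unfolding piso_def
  proof (intro conjI ballI impI D)
    show "inj_on T D"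
    proof (rule inj_onI)
      fix x y assume "x \<in> D" "y \<in> D" "T x = T y"
      then have "g x = g y" using T(2) by metis
      then show "x = y" using \<open>x \<in> D\<close> \<open>y \<in> D\<close> g(5) by (auto simp: D_def dest: inj_onD)
    qed
    fix C assume C: "C \<in> sets M"
    have "D \<inter> T -` C = D \<inter> g -` (f ` (C \<inter> V'))"
    proof -
      have "T x \<in> C \<longleftrightarrow> g x \<in> f ` (C \<inter> V')" if "x \<in> D" for x
        using T[OF that] f(5) by (auto dest: inj_onD) (metis IntI image_eqI)
      then show ?thesis by auto
    qed
    moreover have "f ` (C \<inter> V') \<in> sets borel" using f(2,7) C by auto
    ultimately show "D \<inter> T -` C \<in> sets M" using D vimage_borel[OF g(1)] by auto
    assume CD: "C \<subseteq> D"
    have gC: "g ` C \<in> sets borel" using g(7)[OF C] CD by (auto simp: D_def)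
    show "T ` C \<in> sets M" unfolding TC[OF CD] using f(2) vimage_borel[OF f(1) gC] by auto
    have s: "g ` C \<subseteq> {0..measure M U}" "g ` C \<subseteq> {0..measure M V}"
      using g(6) f(6) CD unfolding D_def by blast+
    have "measure M (T ` C) = measure lborel (g ` C \<inter> {0..measure M V})"
      unfolding TC[OF CD] nullV[OF gC] by (rule f(8)[OF gC])
    also have "\<dots> = measure lborel (g ` C \<inter> {0..measure M U})"
      using s by (simp add: Int_absorb2)
    also have "\<dots> = measure M (U' \<inter> g -` (g ` C))" unfolding nullU[OF gC] by (rule g(8)[OF gC, symmetric])
    also have "U' \<inter> g -` (g ` C) = C" using g(5) CD by (auto simp: D_def dest: inj_onD)
    finally show "measure M (T ` C) = measure M C" .
  qed
  have TD: "T ` D = V' \<inter> f -` (g ` U')"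
  proof -
    have "g x \<in> g ` D" if "y \<in> V'" "f y = g x" "x \<in> U'" for x y
    proof -
      have "g x \<in> f ` V'" using that by (metis imageI)
      then show ?thesis using that by (simp add: D_def)
    qed
    then have "V' \<inter> f -` (g ` D) = V' \<inter> f -` (g ` U')" by (auto simp: D_def)
    then show ?thesis using TC[of D] by simp
  qed
  have fmeas: "{0..measure M A} \<in> fmeasurable lborel" for A by (rule fmeasurableI) auto
  have "measure M (U - D) = 0 \<or> measure M (V - T ` D) = 0"
  \<comment> \<open>If U has the smaller mass, its unmatched coordinates are coordinates that
    \<open>V'\<close> misses, and these form a null part of the longer interval. The other case is
    symmetric.\<close>
  proof (cases "measure M U \<le> measure M V")
    case True
    have "measure M (U \<inter> g -` (- f ` V')) = measure lborel (- f ` V' \<inter> {0..measure M U})"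
      using fV by (intro g(8)) auto
    also have "\<dots> \<le> measure lborel (- f ` V' \<inter> {0..measure M V})"
      using True fV by (intro measure_mono_fmeasurable fmeasurableI2[OF fmeas[of V]]) auto
    also have "\<dots> = measure M (V \<inter> f -` (- f ` V'))" using fV by (intro f(8)[symmetric]) auto
    also have "\<dots> = 0" by (rule measure_zero_subset[OF _ _ f(4)]) (use V f(2) in auto)
    finally have z: "measure M (U \<inter> g -` (- f ` V')) = 0" by (simp add: measure_le_0_iff)
    have "U - D = (U - U') \<union> (U \<inter> g -` (- f ` V'))" using g(3) by (auto simp: D_def)
    then show ?thesis using z g(2,4) U fV vimage_borel[OF g(1)] by (simp add: measure_zero_union)
  next
    case False
    have "measure M (V \<inter> f -` (- g ` U')) = measure lborel (- g ` U' \<inter> {0..measure M V})"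
      using gU by (intro f(8)) auto
    also have "\<dots> \<le> measure lborel (- g ` U' \<inter> {0..measure M U})"
      using False gU by (intro measure_mono_fmeasurable fmeasurableI2[OF fmeas[of U]]) auto
    also have "\<dots> = measure M (U \<inter> g -` (- g ` U'))" using gU by (intro g(8)[symmetric]) auto
    also have "\<dots> = 0" by (rule measure_zero_subset[OF _ _ g(4)]) (use U g(2) in auto)
    finally have z: "measure M (V \<inter> f -` (- g ` U')) = 0" by (simp add: measure_le_0_iff)
    have "V - T ` D = (V - V') \<union> (V \<inter> f -` (- g ` U'))" using f(3) by (auto simp: TD)
    then show ?thesis using z f(2,4) V gU vimage_borel[OF f(1)] by (simp add: measure_zero_union)
  qed
  moreover have "D \<subseteq> U" "T ` D \<subseteq> V" using g(3) f(3) T(1) by (auto simp: D_def)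
  ultimately show thesis using that p by blast
qed

end

section \<open>Matching of labels\<close>

lemma piso_empty [simp]: "piso M {} T"
  by (auto simp: piso_def)

context std_space
begin

lemma piso_glue2:
  assumes p: "piso M D T" "piso M D' T'" and d: "D \<inter> D' = {}" "T ` D \<inter> T' ` D' = {}"
  obtains S where "piso M (D \<union> D') S" "\<And>x. x \<in> D \<Longrightarrow> S x = T x" "\<And>x. x \<in> D' \<Longrightarrow> S x = T' x"
proof -
  define E where "E n = (if n = 0 then D else if n = Suc 0 then D' else {})" for n :: nat
  define R where "R n = (if n = 0 then T else T')" for n :: nat
  have "piso M (E n) (R n)" for n using p by (auto simp: E_def R_def)
  moreover have "disjoint_family E" using d(1) by (auto simp: disjoint_family_on_def E_def)
  moreover have "disjoint_family (\<lambda>n. R n ` E n)"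
    using d(2) by (auto simp: disjoint_family_on_def E_def R_def split: if_splits)
  ultimately obtain S where S: "piso M (\<Union>n. E n) S" "\<And>n x. x \<in> E n \<Longrightarrow> S x = R n x"
    using piso_glue by metis
  have "(\<Union>n. E n) = D \<union> D'" by (auto simp: E_def split: if_splits)
  moreover have "S x = T x" if "x \<in> D" for x using S(2)[of x 0] that by (simp add: E_def R_def)
  moreover have "S x = T' x" if "x \<in> D'" for x using S(2)[of x 1] that by (simp add: E_def R_def)
  ultimately show thesis using S that by simp
qed

lemma piso_glue_finite:
  assumes fin: "finite I" and p: "\<And>i. i \<in> I \<Longrightarrow> piso M (D i) (T i)"
    and d: "disjoint_family_on D I" "disjoint_family_on (\<lambda>i. T i ` D i) I"
  obtains S where "piso M (\<Union>i\<in>I. D i) S" "\<And>i x. i \<in> I \<Longrightarrow> x \<in> D i \<Longrightarrow> S x = T i x"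
proof -
  obtain e where e: "bij_betw e {0..<card I} I" using ex_bij_betw_nat_finite[OF fin] by auto
  have eI: "e n \<in> I" if "n < card I" for n using e that by (auto simp: bij_betw_def)
  have inj: "e n = e m \<longleftrightarrow> n = m" if "n < card I" "m < card I" for n m
    using e that by (auto simp: bij_betw_def inj_on_def)
  define E where "E n = (if n < card I then D (e n) else {})" for n
  define R where "R n = T (e n)" for n
  have "piso M (E n) (R n)" for n using p eI by (auto simp: E_def R_def)
  moreover have "disjoint_family E"
    using d(1) inj eI unfolding disjoint_family_on_def E_def by auto
  moreover have "disjoint_family (\<lambda>n. R n ` E n)"
    using d(2) inj eI unfolding disjoint_family_on_def E_def R_def by auto
  ultimately obtain S where S: "piso M (\<Union>n. E n) S" "\<And>n x. x \<in> E n \<Longrightarrow> S x = R n x"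
    using piso_glue by metis
  have sur: "\<exists>n<card I. e n = i" if "i \<in> I" for i
    using e that unfolding bij_betw_def by (metis atLeastLessThan_iff imageE)
  have "(\<Union>n. E n) = (\<Union>i\<in>I. D i)"
    using eI by (auto simp: E_def split: if_splits) (metis sur)
  moreover have "S x = T i x" if i: "i \<in> I" "x \<in> D i" for i x
  proof -
    obtain n where "n < card I" "e n = i" using sur[OF i(1)] by auto
    then show ?thesis using S(2)[of x n] i by (simp add: E_def R_def)
  qed
  ultimately show thesis using S that by simp
qed

text \<open>The relation \<open>r\<close> constrains the partial isomorphisms available and \<open>Z\<close> is the class of sets
  they preserve: a partial isomorphism that cannot be extended has its unmatched domain and its
  unmatched range separated by a member of \<open>Z\<close>, so agreement of the conditional distributions of
  the labels on \<open>Z\<close> bounds what remains unmatched.\<close>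

lemma label_matching:
  fixes L L' :: "'a \<Rightarrow> 'l" and \<Lambda> :: "'l set" and d :: real
  assumes ex: "\<And>U V. U \<in> sets M \<Longrightarrow> V \<in> sets M \<Longrightarrow> \<exists>D T. piso M D T \<and> D \<subseteq> U \<and> T ` D \<subseteq> V \<and>
      (\<forall>x\<in>D. r x (T x)) \<and> (\<exists>z\<in>Z. measure M ((U - D) - z) = 0 \<and> measure M ((V - T ` D) \<inter> z) = 0)"
    and Z: "Z \<subseteq> sets M"
    and inv: "\<And>D T z. piso M D T \<Longrightarrow> \<forall>x\<in>D. r x (T x) \<Longrightarrow> z \<in> Z \<Longrightarrow> measure M (T ` D \<inter> z) = measure M (D \<inter> z)"
    and \<Lambda>: "finite \<Lambda>" "\<And>x. L x \<in> \<Lambda>" "\<And>x. L' x \<in> \<Lambda>"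
    and m: "\<And>a. a \<in> \<Lambda> \<Longrightarrow> {x. L x = a} \<in> sets M" "\<And>a. a \<in> \<Lambda> \<Longrightarrow> {x. L' x = a} \<in> sets M"
    and close: "\<And>a z. a \<in> \<Lambda> \<Longrightarrow> z \<in> Z \<Longrightarrow> \<bar>measure M ({x. L x = a} \<inter> z) - measure M ({x. L' x = a} \<inter> z)\<bar> \<le> d"
  obtains S where "mp_aut M S" "\<And>x. S x = x \<or> r x (S x)" "measure M {x. L (S x) \<noteq> L' x} \<le> card \<Lambda> * d"
proof -
  define U where "U a = {x. L' x = a}" for a
  define V where "V a = {x. L x = a}" for a
  have UV: "U a \<in> sets M" "V a \<in> sets M" if "a \<in> \<Lambda>" for a using m that by (auto simp: U_def V_def)
  have "\<forall>a\<in>\<Lambda>. \<exists>D T. piso M D T \<and> D \<subseteq> U a \<and> T ` D \<subseteq> V a \<and> (\<forall>x\<in>D. r x (T x)) \<and>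
      (\<exists>z\<in>Z. measure M ((U a - D) - z) = 0 \<and> measure M ((V a - T ` D) \<inter> z) = 0)"
    using ex[OF UV] by blast
  then obtain D T where DT: "\<And>a. a \<in> \<Lambda> \<Longrightarrow> piso M (D a) (T a)" "\<And>a. a \<in> \<Lambda> \<Longrightarrow> D a \<subseteq> U a"
      "\<And>a. a \<in> \<Lambda> \<Longrightarrow> T a ` D a \<subseteq> V a" "\<And>a x. a \<in> \<Lambda> \<Longrightarrow> x \<in> D a \<Longrightarrow> r x (T a x)"
      "\<And>a. a \<in> \<Lambda> \<Longrightarrow> \<exists>z\<in>Z. measure M ((U a - D a) - z) = 0 \<and> measure M ((V a - T a ` D a) \<inter> z) = 0"
    by metis
  \<comment> \<open>Outside z nothing is left of the domain, inside z nothing of the range. Hence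
    what is left of the domain is the difference of the two masses inside z.\<close>
  have rest: "measure M (U a - D a) \<le> d" if a: "a \<in> \<Lambda>" for a
  proof -
    obtain z where z: "z \<in> Z" "measure M ((U a - D a) - z) = 0" "measure M ((V a - T a ` D a) \<inter> z) = 0"
      using DT(5)[OF a] by auto
    have s: "z \<in> sets M" "D a \<in> sets M" "T a ` D a \<in> sets M"
      using Z z(1) pisoD(1,3)[OF DT(1)[OF a]] by auto
    have "measure M (U a - D a) = measure M (((U a - D a) \<inter> z) \<union> ((U a - D a) - z))"
      by (rule arg_cong[of _ _ "measure M"]) auto
    also have "\<dots> = measure M ((U a - D a) \<inter> z)" using z(2) s UV[OF a] by (intro measure_zero_union) auto
    also have "\<dots> = measure M ((U a \<inter> z) - (D a \<inter> z))" by (rule arg_cong[of _ _ "measure M"]) auto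
    also have "\<dots> = measure M (U a \<inter> z) - measure M (D a \<inter> z)"
      using s UV[OF a] DT(2)[OF a] by (intro finite_measure_Diff) auto
    also have "measure M (D a \<inter> z) = measure M (T a ` D a \<inter> z)"
      using inv[OF DT(1)[OF a] _ z(1)] DT(4)[OF a] by simp
    also have "\<dots> = measure M ((T a ` D a \<inter> z) \<union> ((V a - T a ` D a) \<inter> z))"
      using z(3) s UV[OF a] by (intro measure_zero_union[symmetric]) auto
    also have "(T a ` D a \<inter> z) \<union> ((V a - T a ` D a) \<inter> z) = V a \<inter> z" using DT(3)[OF a] by auto
    finally show ?thesis using close[OF a z(1)] by (simp add: U_def V_def)
  qed
  have d1: "disjoint_family_on D \<Lambda>"
    unfolding disjoint_family_on_def
  proof (intro ballI impI)
    fix a b assume ab: "a \<in> \<Lambda>" "b \<in> \<Lambda>" "a \<noteq> b"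
    then have "U a \<inter> U b = {}" by (auto simp: U_def)
    then show "D a \<inter> D b = {}" using DT(2)[OF ab(1)] DT(2)[OF ab(2)] by blast
  qed
  have d2: "disjoint_family_on (\<lambda>a. T a ` D a) \<Lambda>"
    unfolding disjoint_family_on_def
  proof (intro ballI impI)
    fix a b assume ab: "a \<in> \<Lambda>" "b \<in> \<Lambda>" "a \<noteq> b"
    then have "V a \<inter> V b = {}" by (auto simp: V_def)
    then show "T a ` D a \<inter> T b ` D b = {}" using DT(3)[OF ab(1)] DT(3)[OF ab(2)] by blast
  qed
  obtain S0 where S0: "piso M (\<Union>a\<in>\<Lambda>. D a) S0" "\<And>a x. a \<in> \<Lambda> \<Longrightarrow> x \<in> D a \<Longrightarrow> S0 x = T a x"
    using piso_glue_finite[OF \<Lambda>(1) DT(1) d1 d2] by blast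
  define D0 where "D0 = (\<Union>a\<in>\<Lambda>. D a)"
  have D0: "piso M D0 S0" "D0 \<in> sets M" "S0 ` D0 \<in> sets M" using S0(1) pisoD(1,3)[OF S0(1)] by (auto simp: D0_def)
  have r0: "\<forall>x\<in>D0. r x (S0 x)" using S0(2) DT(4) by (auto simp: D0_def)
  have L0: "L (S0 x) = L' x" if x: "x \<in> D0" for x
  proof -
    obtain a where a: "a \<in> \<Lambda>" "x \<in> D a" using x unfolding D0_def by blast
    then have "S0 x \<in> V a" "x \<in> U a" using S0(2)[OF a] DT(2,3)[OF a(1)] by auto
    then show ?thesis by (simp add: U_def V_def)
  qed
  \<comment> \<open>A second matching, now ignoring the labels, joins what remains of the space on
    both sides, so that the map is defined almost everywhere.\<close>
  have "- D0 \<in> sets M" "- (S0 ` D0) \<in> sets M" using D0 by auto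
  then obtain D1 T1 z where D1: "piso M D1 T1" "D1 \<subseteq> - D0" "T1 ` D1 \<subseteq> - (S0 ` D0)" "\<forall>x\<in>D1. r x (T1 x)"
      "z \<in> Z" "measure M ((- D0 - D1) - z) = 0" "measure M ((- (S0 ` D0) - T1 ` D1) \<inter> z) = 0"
    using ex by metis
  have disj: "D0 \<inter> D1 = {}" "S0 ` D0 \<inter> T1 ` D1 = {}" using D1(2,3) by auto
  obtain S1 where S1: "piso M (D0 \<union> D1) S1" "\<And>x. x \<in> D0 \<Longrightarrow> S1 x = S0 x" "\<And>x. x \<in> D1 \<Longrightarrow> S1 x = T1 x"
    using piso_glue2[OF D0(1) D1(1) disj] by metis
  have s: "z \<in> sets M" "D1 \<in> sets M" "T1 ` D1 \<in> sets M"
    using Z D1(5) pisoD(1,3)[OF D1(1)] by auto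
  have r1: "\<forall>x\<in>D0 \<union> D1. r x (S1 x)" using S1 r0 D1(4) by auto
  have im: "S1 ` (D0 \<union> D1) = S0 ` D0 \<union> T1 ` D1" using S1(2,3) by (auto simp: image_Un intro!: image_cong)
  \<comment> \<open>The glued map preserves the mass of its domain inside z, so the complements of
    domain and range have equal mass there. The latter is null in z, and the former is null outside
    z.\<close>
  have "measure M (- (D0 \<union> D1)) = 0"
  proof -
    have "measure M (- (D0 \<union> D1)) = measure M (((- D0 - D1) \<inter> z) \<union> ((- D0 - D1) - z))"
      by (rule arg_cong[of _ _ "measure M"]) auto
    also have "\<dots> = measure M ((- D0 - D1) \<inter> z)" using D1(6) s D0 by (intro measure_zero_union) auto
    also have "\<dots> = measure M (z - (D0 \<union> D1) \<inter> z)" by (rule arg_cong[of _ _ "measure M"]) auto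
    also have "\<dots> = measure M z - measure M ((D0 \<union> D1) \<inter> z)"
      using s D0 by (intro finite_measure_Diff) auto
    also have "measure M ((D0 \<union> D1) \<inter> z) = measure M (S1 ` (D0 \<union> D1) \<inter> z)"
      using inv[OF S1(1) r1 D1(5)] by simp
    also have "measure M z - \<dots> = measure M (z - S1 ` (D0 \<union> D1) \<inter> z)"
      using s D0 unfolding im by (intro finite_measure_Diff[symmetric]) auto
    also have "z - S1 ` (D0 \<union> D1) \<inter> z = (- (S0 ` D0) - T1 ` D1) \<inter> z" unfolding im by auto
    finally show ?thesis using D1(7) by simp
  qed
  then have "measure M (D0 \<union> D1) = 1"
    using prob_compl[of "D0 \<union> D1"] D0 s by (simp add: Compl_eq_Diff_UNIV)
  then obtain S where S: "mp_aut M S" "\<And>x. S x = x \<or> x \<in> D0 \<union> D1 \<and> S x = S1 x" "AE x in M. S x = S1 x"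
    using piso_extend[OF S1(1)] by metis
  obtain N where N: "N \<in> null_sets M" "{x. S x \<noteq> S1 x} \<subseteq> N"
    using S(3) by (auto simp: eventually_ae_filter)
  have "{x. L (S x) \<noteq> L' x} \<subseteq> (\<Union>a\<in>\<Lambda>. U a - D a) \<union> N"
  proof
    fix x assume "x \<in> {x. L (S x) \<noteq> L' x}"
    then have x: "L (S x) \<noteq> L' x" by simp
    show "x \<in> (\<Union>a\<in>\<Lambda>. U a - D a) \<union> N"
    proof (cases "x \<in> N")
      case False
      then have "S x = S1 x" using N by auto
      then have "x \<notin> D0" using x S1(2) L0 by auto
      then show ?thesis using \<Lambda>(3) by (auto simp: D0_def U_def)
    qed simp
  qed
  moreover have Us: "U a - D a \<in> sets M" if "a \<in> \<Lambda>" for a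
    using UV[OF that] pisoD(1)[OF DT(1)[OF that]] by auto
  moreover have Uss: "(\<Union>a\<in>\<Lambda>. U a - D a) \<in> sets M" by (rule sets.finite_UN[OF \<Lambda>(1) Us])
  ultimately have "measure M {x. L (S x) \<noteq> L' x} \<le> measure M ((\<Union>a\<in>\<Lambda>. U a - D a) \<union> N)"
    using N by (intro measure_mono_M) (auto simp: null_sets_def)
  also have "\<dots> = measure M (\<Union>a\<in>\<Lambda>. U a - D a)"
    using N Uss by (intro measure_zero_union) (auto simp: null_sets_def measure_def)
  also have "\<dots> \<le> (\<Sum>a\<in>\<Lambda>. measure M (U a - D a))"
    using Us \<Lambda>(1) by (intro finite_measure_subadditive_finite) auto
  also have "\<dots> \<le> card \<Lambda> * d" using rest by (rule sum_bounded_above)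
  finally have fin: "measure M {x. L (S x) \<noteq> L' x} \<le> card \<Lambda> * d" .
  have "S x = x \<or> r x (S x)" for x using S(2)[of x] r1 by metis
  then show thesis using that S(1) fin by blast
qed

text \<open>With no constraint on the maps the separating set is trivial: empty when the domain is
  exhausted, the whole space when the range is.\<close>

lemma label_matching_global:
  fixes L L' :: "'a \<Rightarrow> 'l" and \<Lambda> :: "'l set" and d :: real
  assumes atomless: "atomless M"
    and \<Lambda>: "finite \<Lambda>" "\<And>x. L x \<in> \<Lambda>" "\<And>x. L' x \<in> \<Lambda>"
    and m: "\<And>a. a \<in> \<Lambda> \<Longrightarrow> {x. L x = a} \<in> sets M" "\<And>a. a \<in> \<Lambda> \<Longrightarrow> {x. L' x = a} \<in> sets M"
    and close: "\<And>a. a \<in> \<Lambda> \<Longrightarrow> \<bar>measure M {x. L x = a} - measure M {x. L' x = a}\<bar> \<le> d"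
  obtains R where "mp_aut M R" "measure M {x. L (R x) \<noteq> L' x} \<le> card \<Lambda> * d"
 proof (rule label_matching[where r = "\<lambda>_ _. True" and Z = "{{}, UNIV}" and d = d, OF _ _ _ \<Lambda> m])
  fix U V assume UV: "U \<in> sets M" "V \<in> sets M"
  show "\<exists>D T. piso M D T \<and> D \<subseteq> U \<and> T ` D \<subseteq> V \<and> (\<forall>x\<in>D. True) \<and>
     (\<exists>z\<in>{{}, UNIV}. measure M ((U - D) - z) = 0 \<and> measure M ((V - T ` D) \<inter> z) = 0)"
  proof -
    obtain D T where D: "piso M D T" "D \<subseteq> U" "T ` D \<subseteq> V" "measure M (U - D) = 0 \<or> measure M (V - T ` D) = 0"
      using piso_exists[OF atomless UV] by metis
    then have "\<exists>z\<in>{{}, UNIV}. measure M ((U - D) - z) = 0 \<and> measure M ((V - T ` D) \<inter> z) = 0" by auto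
    then show ?thesis using D by blast
  qed
next
  show "{{}, UNIV} \<subseteq> sets M" by (metis insert_subset empty_subsetI sets.empty_sets sets.top space_M)
next
  fix D T and z :: "'a set" assume p: "piso M D T" and "z \<in> {{}, UNIV}"
  then show "measure M (T ` D \<inter> z) = measure M (D \<inter> z)"
    using pisoD(4)[OF p pisoD(1)[OF p] subset_refl] by auto
next
  fix a and z :: "'a set" assume a: "a \<in> \<Lambda>" "z \<in> {{}, UNIV}"
  have "0 \<le> d" using close[OF a(1)] by linarith
  then show "\<bar>measure M ({x. L x = a} \<inter> z) - measure M ({x. L' x = a} \<inter> z)\<bar> \<le> d"
    using close[OF a(1)] a(2) by auto
qed (use that in auto)

end

text \<open>The homomorphism identity is demanded at every point, so that orbits and invariant sets
  can be treated pointwise. \<open>actions_everywhere\<close> turns elements of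
  \<open>actions\<close> into this form.\<close>

locale haction = std_space M + group G for M :: "'a::polish_space measure" and G :: "('g, 'b) monoid_scheme" +
  fixes \<alpha> :: "'g \<Rightarrow> 'a \<Rightarrow> 'a"
  assumes mp: "g \<in> carrier G \<Longrightarrow> mp_aut M (\<alpha> g)"
    and hom: "g \<in> carrier G \<Longrightarrow> h \<in> carrier G \<Longrightarrow> \<alpha> (g \<otimes>\<^bsub>G\<^esub> h) x = \<alpha> g (\<alpha> h x)"
begin

lemma act_one [simp]: "\<alpha> \<one>\<^bsub>G\<^esub> x = x"
proof -
  have "\<alpha> \<one>\<^bsub>G\<^esub> (\<alpha> \<one>\<^bsub>G\<^esub> x) = \<alpha> \<one>\<^bsub>G\<^esub> x" using hom[of "\<one>\<^bsub>G\<^esub>" "\<one>\<^bsub>G\<^esub>"] by simp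
  then show ?thesis using mp_autD(1)[OF mp[of "\<one>\<^bsub>G\<^esub>"]] by (simp add: bij_def inj_eq)
qed

lemma act_inv [simp]:
  "g \<in> carrier G \<Longrightarrow> \<alpha> (m_inv G g) (\<alpha> g x) = x" "g \<in> carrier G \<Longrightarrow> \<alpha> g (\<alpha> (m_inv G g) x) = x"
  using hom[of "m_inv G g" g x] hom[of g "m_inv G g" x] by simp_all

definition invariant_sets :: "'a set set" where
  "invariant_sets = {z \<in> sets M. \<forall>g\<in>carrier G. \<forall>x. \<alpha> g x \<in> z \<longleftrightarrow> x \<in> z}"

text \<open>Greedy exhaustion along an enumeration of the group: stage n matches by
  \<open>\<alpha> (e n)\<close> all that it can of what is left. The saturation z of the unmatched
  domain then contains no unmatched point of the range, because the group element joining two such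
  points had its stage.\<close>

lemma orbit_matching:
  assumes c: "countable (carrier G)" and UV: "U \<in> sets M" "V \<in> sets M"
  shows "\<exists>D T. piso M D T \<and> D \<subseteq> U \<and> T ` D \<subseteq> V \<and> (\<forall>x\<in>D. \<exists>g\<in>carrier G. T x = \<alpha> g x) \<and>
     (\<exists>z\<in>invariant_sets. measure M ((U - D) - z) = 0 \<and> measure M ((V - T ` D) \<inter> z) = 0)"
proof -
  define e where "e = from_nat_into (carrier G)"
  have e: "e n \<in> carrier G" for n unfolding e_def by (rule from_nat_into) auto
  \<comment> \<open>The pair of leftovers of U and V before stage n.\<close>
  define W where "W = rec_nat (U, V) (\<lambda>n (A, B). (A - (A \<inter> \<alpha> (e n) -` B), B - \<alpha> (e n) ` (A \<inter> \<alpha> (e n) -` B)))"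
  define P where "P n = fst (W n)" for n
  define Q where "Q n = snd (W n)" for n
  define D where "D n = P n \<inter> \<alpha> (e n) -` Q n" for n
  have P0: "P 0 = U" "Q 0 = V" by (simp_all add: P_def Q_def W_def)
  have PS: "P (Suc n) = P n - D n" "Q (Suc n) = Q n - \<alpha> (e n) ` D n" for n
    by (simp_all add: P_def Q_def W_def D_def split_beta)
  have s: "P n \<in> sets M \<and> Q n \<in> sets M" for n
  proof (induction n)
    case (Suc n)
    then have "D n \<in> sets M" unfolding D_def using mp_autD(2)[OF mp[OF e]] by auto
    then show ?case using Suc mp_autD(3)[OF mp[OF e]] by (auto simp: PS)
  qed (use UV P0 in auto)
  have Ds: "D n \<in> sets M" for n unfolding D_def using s mp_autD(2)[OF mp[OF e]] by auto
  have dP: "P m \<subseteq> P n" "Q m \<subseteq> Q n" if "n \<le> m" for n m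
    by (rule lift_Suc_antimono_le[OF _ that]; simp add: PS; blast)+
  have d1: "D n \<inter> D m = {}" if "n < m" for n m
    using dP(1)[of "Suc n" m] that PS(1)[of n] by (auto simp: D_def)
  have d2: "\<alpha> (e n) ` D n \<inter> \<alpha> (e m) ` D m = {}" if "n < m" for n m
  proof -
    have "\<alpha> (e m) ` D m \<subseteq> Q m" by (auto simp: D_def)
    then show ?thesis using dP(2)[of "Suc n" m] that PS(2)[of n] by auto
  qed
  have "disjoint_family D"
    unfolding disjoint_family_on_def using d1 by (metis Int_commute linorder_neqE_nat)
  moreover have "disjoint_family (\<lambda>n. \<alpha> (e n) ` D n)"
    unfolding disjoint_family_on_def using d2 by (metis Int_commute linorder_neqE_nat)
  ultimately obtain T where T: "piso M (\<Union>n. D n) T" "\<And>n x. x \<in> D n \<Longrightarrow> T x = \<alpha> (e n) x"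
    using piso_glue[of D "\<lambda>n. \<alpha> (e n)"] piso_mp_aut[OF mp[OF e] Ds] by metis
  define z where "z = (\<Union>g\<in>carrier G. \<alpha> g -` (U - (\<Union>n. D n)))"
  have zi: "z \<in> invariant_sets" unfolding invariant_sets_def
  proof (intro CollectI conjI ballI allI)
    have "U - (\<Union>n. D n) \<in> sets M" using UV Ds by auto
    then have "\<alpha> g -` (U - (\<Union>n. D n)) \<in> sets M" if "g \<in> carrier G" for g
      using mp_autD(2)[OF mp[OF that]] by blast
    then show "z \<in> sets M" unfolding z_def by (intro sets.countable_UN'[OF c]) blast
    fix g x assume g: "g \<in> carrier G"
    show "\<alpha> g x \<in> z \<longleftrightarrow> x \<in> z"
    proof
      assume "\<alpha> g x \<in> z"
      then obtain h where "h \<in> carrier G" "\<alpha> h (\<alpha> g x) \<in> U - (\<Union>n. D n)" by (auto simp: z_def)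
      then show "x \<in> z" using g unfolding z_def by (auto simp: hom intro!: bexI[of _ "h \<otimes>\<^bsub>G\<^esub> g"])
    next
      assume "x \<in> z"
      then obtain h where h: "h \<in> carrier G" "\<alpha> h x \<in> U - (\<Union>n. D n)" by (auto simp: z_def)
      have "\<alpha> (h \<otimes>\<^bsub>G\<^esub> m_inv G g) (\<alpha> g x) = \<alpha> h x" using g h(1) by (simp add: hom)
      then show "\<alpha> g x \<in> z" unfolding z_def using g h
        by (intro UN_I[of "h \<otimes>\<^bsub>G\<^esub> m_inv G g"]) simp_all
    qed
  qed
  have P: "x \<in> P n" if x: "x \<in> U" "x \<notin> (\<Union>n. D n)" for x n
  proof (induction n)
    case (Suc n)
    have "x \<notin> D n" using x(2) by blast
    then show ?case using Suc by (simp add: PS)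
  qed (simp add: P0 x)
  have Q: "y \<in> Q n" if y: "y \<in> V" "y \<notin> T ` (\<Union>n. D n)" for y n
  proof (induction n)
    case (Suc n)
    have "y \<notin> \<alpha> (e n) ` D n"
    proof
      assume "y \<in> \<alpha> (e n) ` D n"
      then obtain x where "x \<in> D n" "y = T x" using T(2) by auto
      then show False using y(2) by blast
    qed
    then show ?case using Suc by (simp add: PS)
  qed (simp add: P0 y)
  have "U - (\<Union>n. D n) - z = {}" unfolding z_def using one_closed act_one by blast
  moreover have "(V - T ` (\<Union>n. D n)) \<inter> z = {}"
  proof (rule ccontr)
    assume "(V - T ` (\<Union>n. D n)) \<inter> z \<noteq> {}"
    then obtain y g where y: "y \<in> V" "y \<notin> T ` (\<Union>n. D n)" "g \<in> carrier G"
        "\<alpha> g y \<in> U" "\<alpha> g y \<notin> (\<Union>n. D n)" by (auto simp: z_def)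
    \<comment> \<open>The stage of the inverse of g should have matched \<open>\<alpha> g y\<close>
      with y, as both were still available.\<close>
    obtain n where n: "e n = m_inv G g"
      using from_nat_into_surj[OF c] y(3) unfolding e_def by (metis inv_closed)
    have "\<alpha> g y \<in> D n" unfolding D_def using P[OF y(4,5), of n] Q[OF y(1,2), of n] y(3) by (simp add: n)
    then show False using y by auto
  qed
  moreover have "(\<Union>n. D n) \<subseteq> U" using dP(1)[of 0] by (auto simp: D_def P0)
  moreover have "T ` (\<Union>n. D n) \<subseteq> V"
  proof
    fix y assume "y \<in> T ` (\<Union>n. D n)"
    then obtain n x where "x \<in> D n" "y = T x" by auto
    then have "y \<in> Q n" using T(2) by (auto simp: D_def)
    then show "y \<in> V" using dP(2)[of 0 n] by (auto simp: P0)
  qed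
  moreover have "\<forall>x\<in>\<Union>n. D n. \<exists>g\<in>carrier G. T x = \<alpha> g x" using T(2) e by blast
  ultimately show ?thesis using zi T(1) by (metis measure_empty)
qed

text \<open>The admissible maps move points inside their orbits, so they preserve the mass of every
  invariant set, as \<open>label_matching\<close> demands.\<close>

lemma label_matching_orbit:
  fixes L L' :: "'a \<Rightarrow> 'l" and \<Lambda> :: "'l set" and d :: real
  assumes c: "countable (carrier G)"
    and \<Lambda>: "finite \<Lambda>" "\<And>x. L x \<in> \<Lambda>" "\<And>x. L' x \<in> \<Lambda>"
    and m: "\<And>a. a \<in> \<Lambda> \<Longrightarrow> {x. L x = a} \<in> sets M" "\<And>a. a \<in> \<Lambda> \<Longrightarrow> {x. L' x = a} \<in> sets M"
    and close: "\<And>a z. a \<in> \<Lambda> \<Longrightarrow> z \<in> invariant_sets \<Longrightarrow>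
       \<bar>measure M ({x. L x = a} \<inter> z) - measure M ({x. L' x = a} \<inter> z)\<bar> \<le> d"
  obtains S where "mp_aut M S" "\<And>x. \<exists>g\<in>carrier G. S x = \<alpha> g x" "measure M {x. L (S x) \<noteq> L' x} \<le> card \<Lambda> * d"
proof (rule label_matching[where r = "\<lambda>x y. \<exists>g\<in>carrier G. y = \<alpha> g x" and Z = invariant_sets and d = d,
      OF orbit_matching[OF c] _ _ \<Lambda> m close])
  show "invariant_sets \<subseteq> sets M" by (auto simp: invariant_sets_def)
  fix D T z assume a: "piso M D T" "\<forall>x\<in>D. \<exists>g\<in>carrier G. T x = \<alpha> g x" "z \<in> invariant_sets"
  have iff: "T x \<in> z \<longleftrightarrow> x \<in> z" if "x \<in> D" for x
    using a(2,3) that unfolding invariant_sets_def by fastforce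
  have "T ` D \<inter> z = T ` (D \<inter> z)" using iff by auto
  moreover have "D \<inter> z \<in> sets M" using a(3) pisoD(1)[OF a(1)] by (auto simp: invariant_sets_def)
  ultimately show "measure M (T ` D \<inter> z) = measure M (D \<inter> z)"
    using pisoD(4)[OF a(1)] by simp
next
  fix S assume S: "mp_aut M S" "\<And>x. S x = x \<or> (\<exists>g\<in>carrier G. S x = \<alpha> g x)"
    "measure M {x. L (S x) \<noteq> L' x} \<le> card \<Lambda> * d"
  have "\<exists>g\<in>carrier G. S x = \<alpha> g x" for x using S(2)[of x] act_one one_closed by metis
  then show thesis using that S by blast
qed

end

context std_space
begin

lemma prob_UNIV [simp]: "measure M UNIV = 1"
  using prob_space by simp

section \<open>Random labellings\<close>

lemma exists_le_expectation:
  fixes f :: "'a \<Rightarrow> real"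
  assumes "integrable M f" shows "\<exists>w. f w \<le> expectation f"
proof (rule ccontr)
  assume "\<not> ?thesis"
  then have "\<And>w. expectation f < f w" by (simp add: not_le)
  then have "expectation f < expectation f" using expectation_greater[OF assms, of "expectation f"] by simp
  then show False by simp
qed

lemma square_expectation_le:
  fixes g :: "'a \<Rightarrow> real"
  assumes "g \<in> borel_measurable M" "\<And>x. \<bar>g x\<bar> \<le> B"
  shows "(expectation g)\<^sup>2 \<le> expectation (\<lambda>x. (g x)\<^sup>2)"
proof -
  have i: "integrable M g" using assms by (intro integrable_const_bound[of _ B]) auto
  have "\<bar>(g x)\<^sup>2\<bar> \<le> B\<^sup>2" for x using power_mono[OF assms(2)[of x], of 2] by simp
  then have i2: "integrable M (\<lambda>x. (g x)\<^sup>2)" using assms by (intro integrable_const_bound[of _ "B\<^sup>2"]) auto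
  show ?thesis using variance_eq[OF i i2] variance_positive[of g] by linarith
qed

text \<open>Choosing the samples \<open>w n\<close> one at a time, the cross terms vanish in expectation because
  \<open>K n w\<close> has mean zero in \<open>w\<close>, so no product measure is needed.\<close>

lemma sequential_choice:
  fixes K :: "nat \<Rightarrow> 'a \<Rightarrow> 'a \<Rightarrow> 't \<Rightarrow> real"
  assumes T: "finite T"
    and meas: "\<And>n t. t \<in> T \<Longrightarrow> (\<lambda>(w, x). K n w x t) \<in> borel_measurable (M \<Otimes>\<^sub>M M)"
    and bound: "\<And>n w x t. t \<in> T \<Longrightarrow> \<bar>K n w x t\<bar> \<le> B"
    and mean: "\<And>n x t. t \<in> T \<Longrightarrow> (\<integral>w. K n w x t \<partial>M) = 0"
  shows "\<exists>ws. (\<Sum>t\<in>T. \<integral>x. (\<Sum>n<m. K n (ws n) x t)\<^sup>2 \<partial>M) \<le> (\<Sum>n<m. \<Sum>t\<in>T. \<integral>w. \<integral>x. (K n w x t)\<^sup>2 \<partial>M \<partial>M)"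
proof (induction m)
  case 0 then show ?case by simp
next
  case (Suc m)
  then obtain ws where ws: "(\<Sum>t\<in>T. \<integral>x. (\<Sum>n<m. K n (ws n) x t)\<^sup>2 \<partial>M) \<le>
      (\<Sum>n<m. \<Sum>t\<in>T. \<integral>w. \<integral>x. (K n w x t)\<^sup>2 \<partial>M \<partial>M)" by blast
  interpret P: pair_prob_space M M by unfold_locales
  define S where "S x t = (\<Sum>n<m. K n (ws n) x t)" for x t
  have mx: "(\<lambda>x. K n w x t) \<in> borel_measurable M" if "t \<in> T" for n w t
    using measurable_compose[OF measurable_Pair1' meas[OF that]] by simp
  have mS: "(\<lambda>x. S x t) \<in> borel_measurable M" if "t \<in> T" for t
    unfolding S_def using mx[OF that] by measurable
  have bS: "\<bar>S x t\<bar> \<le> real m * B" if "t \<in> T" for x t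
  proof -
    have "\<bar>S x t\<bar> \<le> (\<Sum>n<m. \<bar>K n (ws n) x t\<bar>)" unfolding S_def by (rule sum_abs)
    also have "\<dots> \<le> real (card {..<m}) * B" using bound[OF that] by (rule sum_bounded_above)
    finally show ?thesis by simp
  qed
  define f where "f t w x = (S x t + K m w x t)\<^sup>2" for t w x
  have i1: "integrable (M \<Otimes>\<^sub>M M) (\<lambda>(w, x). K m w x t * S x t)" if "t \<in> T" for t
  proof (rule P.P.integrable_const_bound[of _ "B * (real m * B)"])
    show "AE p in M \<Otimes>\<^sub>M M. norm (case p of (w, x) \<Rightarrow> K m w x t * S x t) \<le> B * (real m * B)"
      using bound[OF that] bS[OF that] order_trans[OF abs_ge_zero bound[OF that]]
      by (intro AE_I2) (auto simp: abs_mult intro!: mult_mono)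
    show "(\<lambda>(w, x). K m w x t * S x t) \<in> borel_measurable (M \<Otimes>\<^sub>M M)"
      using meas[OF that, of m] mS[OF that] by (simp add: split_beta' )
  qed
  have i2: "integrable (M \<Otimes>\<^sub>M M) (\<lambda>(w, x). (K m w x t)\<^sup>2)" if "t \<in> T" for t
  proof (rule P.P.integrable_const_bound[of _ "B\<^sup>2"])
    show "AE p in M \<Otimes>\<^sub>M M. norm (case p of (w, x) \<Rightarrow> (K m w x t)\<^sup>2) \<le> B\<^sup>2"
      using power_mono[OF bound[OF that] abs_ge_zero, of _ _ _ 2] by (intro AE_I2) (auto simp: abs_le_square_iff)
    show "(\<lambda>(w, x). (K m w x t)\<^sup>2) \<in> borel_measurable (M \<Otimes>\<^sub>M M)"
      using meas[OF that, of m] by (simp add: split_beta')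
  qed
  have i3: "integrable M (\<lambda>x. (S x t)\<^sup>2)" if "t \<in> T" for t
  proof (rule integrable_const_bound[of _ "(real m * B)\<^sup>2"])
    show "AE x in M. norm ((S x t)\<^sup>2) \<le> (real m * B)\<^sup>2"
      using power_mono[OF bS[OF that] abs_ge_zero, of _ 2] by (intro AE_I2) (auto simp: abs_le_square_iff)
  qed (use mS[OF that] in measurable)
  have s1: "integrable M (\<lambda>x. K m w x t * S x t)" if "t \<in> T" for w t
  proof (rule integrable_const_bound[of _ "B * (real m * B)"])
    show "AE x in M. norm (K m w x t * S x t) \<le> B * (real m * B)"
      using bound[OF that] bS[OF that] order_trans[OF abs_ge_zero bound[OF that]]
      by (intro AE_I2) (auto simp: abs_mult intro!: mult_mono)
  qed (use mS[OF that] mx[OF that] in measurable)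
  have s2: "integrable M (\<lambda>x. (K m w x t)\<^sup>2)" if "t \<in> T" for w t
  proof (rule integrable_const_bound[of _ "B\<^sup>2"])
    show "AE x in M. norm ((K m w x t)\<^sup>2) \<le> B\<^sup>2"
      using power_mono[OF bound[OF that] abs_ge_zero, of _ _ _ 2] by (intro AE_I2) (auto simp: abs_le_square_iff)
  qed (use mx[OF that] in measurable)
  have ex: "(\<integral>x. f t w x \<partial>M) = (\<integral>x. (S x t)\<^sup>2 \<partial>M) + 2 * (\<integral>x. K m w x t * S x t \<partial>M) + (\<integral>x. (K m w x t)\<^sup>2 \<partial>M)"
    if "t \<in> T" for t w
  proof -
    have "f t w x = (S x t)\<^sup>2 + 2 * (K m w x t * S x t) + (K m w x t)\<^sup>2" for x
      by (simp add: f_def power2_sum)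
    then show ?thesis using i3[OF that] s1[OF that] s2[OF that] by simp
  qed
  have I1: "integrable M (\<lambda>w. \<integral>x. K m w x t * S x t \<partial>M)" if "t \<in> T" for t
    using P.integrable_fst'[OF i1[OF that]] by simp
  have I2: "integrable M (\<lambda>w. \<integral>x. (K m w x t)\<^sup>2 \<partial>M)" if "t \<in> T" for t
    using P.integrable_fst'[OF i2[OF that]] by simp
  \<comment> \<open>Here the samples act as if independent: for fixed x the sum \<open>S x t\<close>
    does not involve the new sample w, over which K averages to zero.\<close>
  have cross: "(\<integral>w. (\<integral>x. K m w x t * S x t \<partial>M) \<partial>M) = 0" if "t \<in> T" for t
  proof -
    have "(\<integral>w. (\<integral>x. K m w x t * S x t \<partial>M) \<partial>M) = (\<integral>x. (\<integral>w. K m w x t * S x t \<partial>M) \<partial>M)"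
      using P.Fubini_integral[of "\<lambda>w x. K m w x t * S x t"] i1[OF that] by simp
    then show ?thesis using mean[OF that] by simp
  qed
  have If: "integrable M (\<lambda>w. \<integral>x. f t w x \<partial>M)" if "t \<in> T" for t
    unfolding ex[OF that] using I1[OF that] I2[OF that] by simp
  have "integrable M (\<lambda>w. \<Sum>t\<in>T. \<integral>x. f t w x \<partial>M)" using If by (rule Bochner_Integration.integrable_sum)
  \<comment> \<open>Some sample does no worse than the average over all samples.\<close>
  then obtain w where "(\<Sum>t\<in>T. \<integral>x. f t w x \<partial>M) \<le> (\<integral>w. (\<Sum>t\<in>T. \<integral>x. f t w x \<partial>M) \<partial>M)"
    using exists_le_expectation by blast
  also have "\<dots> = (\<Sum>t\<in>T. \<integral>w. (\<integral>x. f t w x \<partial>M) \<partial>M)"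
    using If by (rule Bochner_Integration.integral_sum)
  also have "\<dots> = (\<Sum>t\<in>T. (\<integral>x. (S x t)\<^sup>2 \<partial>M) + (\<integral>w. (\<integral>x. (K m w x t)\<^sup>2 \<partial>M) \<partial>M))"
  proof (rule sum.cong[OF refl])
    fix t assume t: "t \<in> T"
    show "(\<integral>w. (\<integral>x. f t w x \<partial>M) \<partial>M) = (\<integral>x. (S x t)\<^sup>2 \<partial>M) + (\<integral>w. (\<integral>x. (K m w x t)\<^sup>2 \<partial>M) \<partial>M)"
      unfolding ex[OF t] using I1[OF t] I2[OF t] cross[OF t] by simp
  qed
  also have "\<dots> \<le> (\<Sum>n<m. \<Sum>t\<in>T. \<integral>w. \<integral>x. (K n w x t)\<^sup>2 \<partial>M \<partial>M) + (\<Sum>t\<in>T. \<integral>w. \<integral>x. (K m w x t)\<^sup>2 \<partial>M \<partial>M)"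
    using ws by (simp add: sum.distrib S_def)
  finally have fin: "(\<Sum>t\<in>T. \<integral>x. f t w x \<partial>M) \<le> (\<Sum>n<Suc m. \<Sum>t\<in>T. \<integral>w. \<integral>x. (K n w x t)\<^sup>2 \<partial>M \<partial>M)" by simp
  \<comment> \<open>Changing entry m of the sequence leaves the earlier choices intact.\<close>
  have "(\<Sum>n<m. K n ((ws(m := w)) n) x t) = S x t" for x t
    unfolding S_def by (intro sum.cong) auto
  then have "f t w x = (\<Sum>n<Suc m. K n ((ws(m := w)) n) x t)\<^sup>2" for t x by (simp add: f_def)
  then show ?case using fin by (intro exI[of _ "ws(m := w)"]) simp
qed

text \<open>A point x uses the sample numbered \<open>J x\<close>. On a set z invariant under the
  maps \<open>u i s\<close> the deviation of a label may be averaged over s before integrating. By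
  the Cauchy-Schwarz inequality its square is at most the second moment of this average, for which
  the diagonal gives \<open>1 / N\<close> and colliding sample numbers give \<open>\<delta>\<close>.
  A single choice of samples serves all pairs of an index and a label, since the second moments are
  summed; hence the factor \<open>card I * card \<Lambda>\<close>.\<close>

lemma random_labelling:
  fixes f :: "'a \<Rightarrow> 'a \<Rightarrow> 'l" and J :: "'a \<Rightarrow> nat" and u :: "'i \<Rightarrow> nat \<Rightarrow> 'a \<Rightarrow> 'a"
  assumes I: "finite I" and \<Lambda>: "finite \<Lambda>" and N: "0 < N"
    and u: "\<And>i s. i \<in> I \<Longrightarrow> s < N \<Longrightarrow> mp_aut M (u i s)"
    and J: "J \<in> M \<rightarrow>\<^sub>M count_space UNIV" "\<And>x. J x < m"
    and f: "(\<lambda>(x, w). f x w) \<in> M \<Otimes>\<^sub>M M \<rightarrow>\<^sub>M count_space UNIV"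
    and p: "\<And>x a. a \<in> \<Lambda> \<Longrightarrow> measure M {w. f x w = a} = p a"
    and coll: "\<And>i s s'. i \<in> I \<Longrightarrow> s < N \<Longrightarrow> s' < N \<Longrightarrow> s \<noteq> s' \<Longrightarrow>
      measure M {x. J (u i s x) = J (u i s' x)} \<le> \<delta>" and \<delta>: "0 \<le> \<delta>"
  obtains w :: "nat \<Rightarrow> 'a" where "(\<lambda>x. f x (w (J x))) \<in> M \<rightarrow>\<^sub>M count_space UNIV"
    "\<And>a i z. a \<in> \<Lambda> \<Longrightarrow> i \<in> I \<Longrightarrow> z \<in> sets M \<Longrightarrow> (\<And>s. s < N \<Longrightarrow> u i s -` z = z) \<Longrightarrow>
      \<bar>measure M ({x. f x (w (J x)) = a} \<inter> z) - p a * measure M z\<bar> \<le> sqrt (card I * card \<Lambda> * (1 / real N + \<delta>))"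
proof -
  note [measurable] = J(1) f
  have um: "u i s \<in> M \<rightarrow>\<^sub>M M" if "i \<in> I" "s < N" for i s using u[OF that] by (rule mp_aut_measurable)
  have fx [measurable]: "(\<lambda>w. f x w) \<in> M \<rightarrow>\<^sub>M count_space UNIV" for x
    using measurable_compose[OF measurable_Pair1' f] by simp
  have fw [measurable]: "(\<lambda>x. f x w) \<in> M \<rightarrow>\<^sub>M count_space UNIV" for w
    using measurable_compose[OF measurable_Pair2' f] by simp
  \<comment> \<open>The centred indicator of label a at y, charged to the sample that y uses; K is
    its average over the N translates of x. Subtracting \<open>p a\<close> makes the mean over w
    vanish.\<close>
  define k where "k n w y a = of_bool (J y = n) * (of_bool (f y w = a) - p a)" for n w y a
  define K where "K n w x t = (\<Sum>s<N. k n w (u (fst t) s x) (snd t)) / real N" for n w x t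
  have p01: "0 \<le> p a" "p a \<le> 1" if "a \<in> \<Lambda>" for a using p[OF that, symmetric, of undefined] by auto
  have kb: "\<bar>k n w y a\<bar> \<le> of_bool (J y = n)" if "a \<in> \<Lambda>" for n w y a using p01[OF that] by (auto simp: k_def)
  \<comment> \<open>The fraction of the translates of x that use sample n. It bounds K independently
    of w, and its square counts collisions.\<close>
  define q where "q n i x = (\<Sum>s<N. of_bool (J (u i s x) = n)) / real N" for n i x
  have Kb: "\<bar>K n w x (i, a)\<bar> \<le> q n i x" if "a \<in> \<Lambda>" for n w x i a
  proof -
    have "\<bar>\<Sum>s<N. k n w (u i s x) a\<bar> \<le> (\<Sum>s<N. \<bar>k n w (u i s x) a\<bar>)" by (rule sum_abs)
    also have "\<dots> \<le> (\<Sum>s<N. of_bool (J (u i s x) = n))" using kb[OF that] by (rule sum_mono)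
    finally show ?thesis unfolding K_def q_def using N by (simp add: divide_right_mono)
  qed
  have qb: "0 \<le> q n i x" "q n i x \<le> 1" for n i x
  proof -
    have "(\<Sum>s<N. of_bool (J (u i s x) = n)) \<le> real (card {..<N}) * 1" by (rule sum_bounded_above) auto
    then show "q n i x \<le> 1" using N by (simp add: q_def)
    show "0 \<le> q n i x" by (auto simp: q_def intro!: sum_nonneg divide_nonneg_nonneg)
  qed
  have km: "(\<lambda>(w, y). k n w y a) \<in> borel_measurable (M \<Otimes>\<^sub>M M)" for n a
  proof -
    have "(\<lambda>(w, y). f y w) \<in> M \<Otimes>\<^sub>M M \<rightarrow>\<^sub>M count_space UNIV"
      using measurable_compose[OF measurable_pair_swap' f] by (simp add: split_beta')
    then show ?thesis unfolding k_def split_beta' by measurable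
  qed
  have Km: "(\<lambda>(w, x). K n w x t) \<in> borel_measurable (M \<Otimes>\<^sub>M M)" if "t \<in> I \<times> \<Lambda>" for n t
  proof -
    have "(\<lambda>(w, x). k n w (u (fst t) s x) (snd t)) \<in> borel_measurable (M \<Otimes>\<^sub>M M)" if "s < N" for s
    proof -
      have "(\<lambda>p. (fst p, u (fst t) s (snd p))) \<in> M \<Otimes>\<^sub>M M \<rightarrow>\<^sub>M M \<Otimes>\<^sub>M M"
        using um[of "fst t" s] \<open>t \<in> I \<times> \<Lambda>\<close> that by (auto intro!: measurable_Pair measurable_compose[OF measurable_snd])
      from measurable_compose[OF this km] show ?thesis by (simp add: split_beta')
    qed
    then show ?thesis unfolding K_def split_beta' by (intro borel_measurable_divide borel_measurable_sum) auto
  qed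
  have mean: "(\<integral>w. K n w x t \<partial>M) = 0" if "t \<in> I \<times> \<Lambda>" for n x t
  proof -
    have a: "snd t \<in> \<Lambda>" using that by auto
    have "(\<integral>w. of_bool (f y w = snd t) \<partial>M) = p (snd t)" for y
    proof -
      have "(\<lambda>w. of_bool (f y w = snd t) :: real) = indicator {w. f y w = snd t}" by (auto simp: indicator_def)
      moreover have "{w. f y w = snd t} \<in> sets M" using measurable_sets[OF fx, of "{snd t}" y] by (simp add: vimage_def)
      ultimately show ?thesis using p[OF a] by simp
    qed
    moreover have i: "integrable M (\<lambda>w. of_bool (f y w = snd t) :: real)" for y
      by (intro integrable_const_bound[of _ 1]) auto
    ultimately have "(\<integral>w. k n w y (snd t) \<partial>M) = 0" for y unfolding k_def by simp
    moreover have "integrable M (\<lambda>w. k n w y (snd t))" for y unfolding k_def using i by simp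
    ultimately show ?thesis unfolding K_def by simp
  qed
  have Kb1: "\<bar>K n w x t\<bar> \<le> 1" if "t \<in> I \<times> \<Lambda>" for n w x t
    using Kb[of "snd t" n w x "fst t"] qb(2)[of n "fst t" x] that by auto
  obtain w where w: "(\<Sum>t\<in>I \<times> \<Lambda>. \<integral>x. (\<Sum>n<m. K n (w n) x t)\<^sup>2 \<partial>M) \<le>
      (\<Sum>n<m. \<Sum>t\<in>I \<times> \<Lambda>. \<integral>w. \<integral>x. (K n w x t)\<^sup>2 \<partial>M \<partial>M)"
    using sequential_choice[of "I \<times> \<Lambda>" K 1 m, OF _ Km Kb1 mean] I \<Lambda> by auto
  have qm: "q n i \<in> borel_measurable M" if "i \<in> I" for n i
  proof -
    have "(\<lambda>x. J (u i s x)) \<in> M \<rightarrow>\<^sub>M count_space UNIV" if "s < N" for s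
      using measurable_compose[OF um[OF \<open>i \<in> I\<close> that] J(1)] .
    then show ?thesis unfolding q_def by (intro borel_measurable_divide borel_measurable_sum) auto
  qed
  have qi: "integrable M (\<lambda>x. (q n i x)\<^sup>2)" if "i \<in> I" for n i
    using qm[OF that] qb by (intro integrable_const_bound[of _ 1]) (auto simp: power_le_one)
  have e1: "(\<integral>w. \<integral>x. (K n w x t)\<^sup>2 \<partial>M \<partial>M) \<le> (\<integral>x. (q n (fst t) x)\<^sup>2 \<partial>M)" if t: "t \<in> I \<times> \<Lambda>" for n t
  proof -
    have sq: "(K n w x t)\<^sup>2 \<le> (q n (fst t) x)\<^sup>2" for w x
      using Kb[of "snd t" n w x "fst t"] t power_mono[of "\<bar>K n w x t\<bar>" "q n (fst t) x" 2] by auto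
    have le: "(\<integral>x. (K n w x t)\<^sup>2 \<partial>M) \<le> (\<integral>x. (q n (fst t) x)\<^sup>2 \<partial>M)" for w
    proof (rule integral_mono)
      show "integrable M (\<lambda>x. (K n w x t)\<^sup>2)"
      proof (rule integrable_const_bound[of _ 1])
        have "(\<lambda>x. K n w x t) \<in> borel_measurable M"
          using measurable_compose[OF measurable_Pair1' Km[OF t]] by simp
        then show "(\<lambda>x. (K n w x t)\<^sup>2) \<in> borel_measurable M" by measurable
        show "AE x in M. norm ((K n w x t)\<^sup>2) \<le> 1"
          using Kb1[OF t] by (intro AE_I2) (simp add: abs_square_le_1)
      qed
    qed (use sq qi t in auto)
    interpret P: pair_prob_space M M by unfold_locales
    have "integrable (M \<Otimes>\<^sub>M M) (\<lambda>(w, x). (K n w x t)\<^sup>2)"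
    proof (rule P.P.integrable_const_bound[of _ 1])
      show "AE p in M \<Otimes>\<^sub>M M. norm (case p of (w, x) \<Rightarrow> (K n w x t)\<^sup>2) \<le> 1"
        using Kb1[OF t] by (intro AE_I2) (auto simp: abs_square_le_1)
      show "(\<lambda>(w, x). (K n w x t)\<^sup>2) \<in> borel_measurable (M \<Otimes>\<^sub>M M)"
        using Km[OF t, of n] by (simp add: split_beta')
    qed
    from P.integrable_fst'[OF this] have Iw: "integrable M (\<lambda>w. \<integral>x. (K n w x t)\<^sup>2 \<partial>M)" by simp
    have c: "integrable M (\<lambda>w. \<integral>x. (q n (fst t) x)\<^sup>2 \<partial>M)" by simp
    have "(\<integral>w. \<integral>x. (K n w x t)\<^sup>2 \<partial>M \<partial>M) \<le> (\<integral>w. (\<integral>x. (q n (fst t) x)\<^sup>2 \<partial>M) \<partial>M)"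
      using integral_mono[OF Iw c le] .
    then show ?thesis by simp
  qed
  have e2: "(\<Sum>n<m. \<integral>x. (q n i x)\<^sup>2 \<partial>M) \<le> 1 / real N + \<delta>" if i: "i \<in> I" for i
  proof -
    \<comment> \<open>Summed over the samples, the squared fractions give the fraction of pairs of
      translates that use the same sample.\<close>
    have c: "(\<Sum>n<m. (q n i x)\<^sup>2) = (\<Sum>s<N. \<Sum>s'<N. of_bool (J (u i s x) = J (u i s' x))) / (real N)\<^sup>2" for x
    proof -
      have "(q n i x)\<^sup>2 = (\<Sum>s<N. \<Sum>s'<N. of_bool (J (u i s x) = n) * of_bool (J (u i s' x) = n)) / (real N)\<^sup>2" for n
        by (simp only: q_def power_divide) (simp only: power2_eq_square sum_product)
      then have "(\<Sum>n<m. (q n i x)\<^sup>2) = (\<Sum>n<m. \<Sum>s<N. \<Sum>s'<N. of_bool (J (u i s x) = n) * of_bool (J (u i s' x) = n)) / (real N)\<^sup>2"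
        by (simp add: sum_divide_distrib)
      also have "(\<Sum>n<m. \<Sum>s<N. \<Sum>s'<N. of_bool (J (u i s x) = n) * of_bool (J (u i s' x) = n) :: real) =
         (\<Sum>s<N. \<Sum>n<m. \<Sum>s'<N. of_bool (J (u i s x) = n) * of_bool (J (u i s' x) = n))" by (rule sum.swap)
      also have "\<dots> = (\<Sum>s<N. \<Sum>s'<N. \<Sum>n<m. of_bool (J (u i s x) = n) * of_bool (J (u i s' x) = n))"
        by (intro sum.cong refl sum.swap)
      also have "\<dots> = (\<Sum>s<N. \<Sum>s'<N. of_bool (J (u i s x) = J (u i s' x)))"
      proof (intro sum.cong refl)
        fix s s'
        have "(\<Sum>n<m. of_bool (J (u i s x) = n) * of_bool (J (u i s' x) = n) :: real) =
          (\<Sum>n<m. if n = J (u i s x) then of_bool (J (u i s x) = J (u i s' x)) else 0)"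
          by (intro sum.cong) auto
        then show "(\<Sum>n<m. of_bool (J (u i s x) = n) * of_bool (J (u i s' x) = n) :: real) = of_bool (J (u i s x) = J (u i s' x))"
          using J(2) by (simp add: sum.delta)
      qed
      finally show ?thesis .
    qed
    have ms: "{x. J (u i s x) = J (u i s' x)} \<in> sets M" if "s < N" "s' < N" for s s'
    proof -
      have [measurable]: "(\<lambda>x. J (u i s x)) \<in> M \<rightarrow>\<^sub>M count_space UNIV" "(\<lambda>x. J (u i s' x)) \<in> M \<rightarrow>\<^sub>M count_space UNIV"
        using measurable_compose[OF um[OF i] J(1)] that by auto
      have "{x \<in> space M. \<exists>n. J (u i s x) = n \<and> J (u i s' x) = n} \<in> sets M" by measurable
      then show ?thesis by (simp add: eq_commute)
    qed
    have oi: "integrable M (\<lambda>x. of_bool (J (u i s x) = J (u i s' x)) :: real)"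
      and om: "(\<integral>x. of_bool (J (u i s x) = J (u i s' x)) \<partial>M) = measure M {x. J (u i s x) = J (u i s' x)}"
      if "s < N" "s' < N" for s s'
    proof -
      have e: "(\<lambda>x. of_bool (J (u i s x) = J (u i s' x)) :: real) = indicator {x. J (u i s x) = J (u i s' x)}"
        by (auto simp: indicator_def)
      show "integrable M (\<lambda>x. of_bool (J (u i s x) = J (u i s' x)) :: real)"
        "(\<integral>x. of_bool (J (u i s x) = J (u i s' x)) \<partial>M) = measure M {x. J (u i s x) = J (u i s' x)}"
        unfolding e using ms[OF that] by (simp_all add: integrable_real_indicator emeasure_eq_measure)
    qed
    have "(\<Sum>n<m. \<integral>x. (q n i x)\<^sup>2 \<partial>M) = (\<integral>x. (\<Sum>n<m. (q n i x)\<^sup>2) \<partial>M)"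
      using qi[OF i] by (intro Bochner_Integration.integral_sum[symmetric]) auto
    also have "\<dots> = (\<Sum>s<N. \<Sum>s'<N. measure M {x. J (u i s x) = J (u i s' x)}) / (real N)\<^sup>2"
    proof -
      have "(\<integral>x. (\<Sum>s<N. \<Sum>s'<N. of_bool (J (u i s x) = J (u i s' x)) :: real) \<partial>M) =
        (\<Sum>s<N. \<integral>x. (\<Sum>s'<N. of_bool (J (u i s x) = J (u i s' x)) :: real) \<partial>M)"
        by (intro Bochner_Integration.integral_sum Bochner_Integration.integrable_sum oi) auto
      also have "\<dots> = (\<Sum>s<N. \<Sum>s'<N. \<integral>x. of_bool (J (u i s x) = J (u i s' x)) \<partial>M)"
        by (intro sum.cong refl Bochner_Integration.integral_sum oi) auto
      also have "\<dots> = (\<Sum>s<N. \<Sum>s'<N. measure M {x. J (u i s x) = J (u i s' x)})"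
        by (intro sum.cong refl om) auto
      finally show ?thesis unfolding c integral_divide_zero by (rule arg_cong)
    qed
    also have "(\<Sum>s<N. \<Sum>s'<N. measure M {x. J (u i s x) = J (u i s' x)}) \<le> (\<Sum>s<N. \<Sum>s'<N. of_bool (s = s') + \<delta>)"
      using coll[OF i] \<delta> by (intro sum_mono) (auto simp: add_increasing2 split: if_splits)
    also have "\<dots> = real N + (real N)\<^sup>2 * \<delta>"
      by (simp add: sum.distrib power2_eq_square of_bool_def algebra_simps)
    finally have "(\<Sum>n<m. \<integral>x. (q n i x)\<^sup>2 \<partial>M) \<le> (real N + (real N)\<^sup>2 * \<delta>) / (real N)\<^sup>2"
      by (simp add: divide_right_mono)
    also have "\<dots> = 1 / real N + \<delta>" using N by (simp add: field_simps power2_eq_square)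
    finally show ?thesis .
  qed
  define L where "L x = f x (w (J x))" for x
  have Lm: "L \<in> M \<rightarrow>\<^sub>M count_space UNIV"
  proof -
    have "(\<lambda>x. f x (w n)) \<in> M \<rightarrow>\<^sub>M count_space UNIV" for n by measurable
    then show ?thesis unfolding L_def
      by (rule measurable_compose_countable'[OF _ J(1), where f = "\<lambda>n x. f x (w n)", unfolded]) auto
  qed
  \<comment> \<open>The average deviation of label a along the translates of x. The sum of K over
    the chosen samples collapses to it, because every point uses exactly one sample.\<close>
  define A where "A i a x = (\<Sum>s<N. of_bool (L (u i s x) = a) - p a) / real N" for i a x
  have sumK: "(\<Sum>n<m. K n (w n) x (i, a)) = A i a x" for x i a
  proof -
    have ky: "(\<Sum>n<m. k n (w n) y a) = of_bool (L y = a) - p a" for y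
    proof -
      have "(\<Sum>n<m. k n (w n) y a) = (\<Sum>n<m. if n = J y then of_bool (L y = a) - p a else 0)"
        by (intro sum.cong) (auto simp: k_def L_def)
      then show ?thesis using J(2) by simp
    qed
    have "(\<Sum>n<m. K n (w n) x (i, a)) = (\<Sum>n<m. \<Sum>s<N. k n (w n) (u i s x) a) / real N"
      unfolding K_def by (simp add: sum_divide_distrib[symmetric])
    also have "(\<Sum>n<m. \<Sum>s<N. k n (w n) (u i s x) a) = (\<Sum>s<N. \<Sum>n<m. k n (w n) (u i s x) a)"
      by (rule sum.swap)
    finally show ?thesis unfolding ky A_def .
  qed
  have tot: "(\<Sum>t\<in>I \<times> \<Lambda>. \<integral>x. (A (fst t) (snd t) x)\<^sup>2 \<partial>M) \<le> card I * card \<Lambda> * (1 / real N + \<delta>)"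
  proof -
    have "(\<Sum>t\<in>I \<times> \<Lambda>. \<integral>x. (A (fst t) (snd t) x)\<^sup>2 \<partial>M) = (\<Sum>t\<in>I \<times> \<Lambda>. \<integral>x. (\<Sum>n<m. K n (w n) x t)\<^sup>2 \<partial>M)"
      using sumK by (intro sum.cong refl) (auto simp: split_beta)
    also have "\<dots> \<le> (\<Sum>n<m. \<Sum>t\<in>I \<times> \<Lambda>. \<integral>w. \<integral>x. (K n w x t)\<^sup>2 \<partial>M \<partial>M)" by (rule w)
    also have "\<dots> \<le> (\<Sum>n<m. \<Sum>t\<in>I \<times> \<Lambda>. \<integral>x. (q n (fst t) x)\<^sup>2 \<partial>M)" by (intro sum_mono e1)
    also have "\<dots> = (\<Sum>t\<in>I \<times> \<Lambda>. \<Sum>n<m. \<integral>x. (q n (fst t) x)\<^sup>2 \<partial>M)" by (rule sum.swap)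
    also have "\<dots> \<le> (\<Sum>t\<in>I \<times> \<Lambda>. 1 / real N + \<delta>)" by (intro sum_mono e2) auto
    finally show ?thesis by (simp add: card_cartesian_product)
  qed
  show thesis
  proof
    show "(\<lambda>x. f x (w (J x))) \<in> M \<rightarrow>\<^sub>M count_space UNIV" using Lm by (simp add: L_def[abs_def])
    fix a i z assume a: "a \<in> \<Lambda>" and i: "i \<in> I" and z: "z \<in> sets M" and inv: "\<And>s. s < N \<Longrightarrow> u i s -` z = z"
    have La: "{x. L x = a} \<in> sets M" using measurable_sets[OF Lm, of "{a}"] by (simp add: vimage_def)
    have uL: "{x. L (u i s x) = a} \<in> sets M" if "s < N" for s
      using mp_autD(2)[OF u[OF i that] La] by (simp add: vimage_def)
    have Am: "A i a \<in> borel_measurable M"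
    proof -
      have "(\<lambda>x. of_bool (L (u i s x) = a) :: real) \<in> borel_measurable M" if "s < N" for s
      proof -
        have "(\<lambda>x. of_bool (L (u i s x) = a) :: real) = indicator {x. L (u i s x) = a}" by (auto simp: indicator_def)
        then show ?thesis using uL[OF that] by simp
      qed
      then show ?thesis unfolding A_def
        by (intro borel_measurable_divide borel_measurable_sum borel_measurable_diff) auto
    qed
    have Ab: "\<bar>A i a x\<bar> \<le> 1" for x
    proof -
      have "\<bar>\<Sum>s<N. of_bool (L (u i s x) = a) - p a\<bar> \<le> (\<Sum>s<N. \<bar>of_bool (L (u i s x) = a) - p a\<bar>)" by (rule sum_abs)
      also have "\<dots> \<le> real (card {..<N}) * 1" using p01[OF a] by (intro sum_bounded_above) auto
      finally show ?thesis using N by (simp add: A_def)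
    qed
    define g where "g x = indicator z x * A i a x" for x
    have gm: "g \<in> borel_measurable M" unfolding g_def using Am z by measurable
    have gb: "\<bar>g x\<bar> \<le> 1" for x using Ab[of x] by (auto simp: g_def indicator_def)
    have "expectation g = (\<Sum>s<N. measure M ({x. L (u i s x) = a} \<inter> z) - p a * measure M z) / real N"
    proof -
      have e: "g x = (\<Sum>s<N. indicator ({x. L (u i s x) = a} \<inter> z) x - p a * indicator z x) / real N" for x
        unfolding g_def A_def by (auto simp: indicator_def)
      have "integrable M (\<lambda>x. indicator ({x. L (u i s x) = a} \<inter> z) x - p a * indicator z x :: real)" if "s < N" for s
        using uL[OF that] z by (intro Bochner_Integration.integrable_diff integrable_mult_right) (auto simp: emeasure_eq_measure)
      then have "expectation g = (\<Sum>s<N. expectation (\<lambda>x. indicator ({x. L (u i s x) = a} \<inter> z) x - p a * indicator z x)) / real N"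
        unfolding e by (simp add: Bochner_Integration.integral_sum)
      also have "\<dots> = (\<Sum>s<N. measure M ({x. L (u i s x) = a} \<inter> z) - p a * measure M z) / real N"
      proof (intro arg_cong2[of _ _ _ _ "(/)"] sum.cong refl)
        fix s assume "s \<in> {..<N}"
        then have "{x. L (u i s x) = a} \<inter> z \<in> sets M" using uL z by auto
        then show "expectation (\<lambda>x. indicator ({x. L (u i s x) = a} \<inter> z) x - p a * indicator z x) =
            measure M ({x. L (u i s x) = a} \<inter> z) - p a * measure M z"
          using z by (subst Bochner_Integration.integral_diff) (auto simp: emeasure_eq_measure)
      qed
      finally show ?thesis .
    qed
    \<comment> \<open>By invariance of z every translate contributes the same mass, so averaging
      over s does not change the integral.\<close>
    moreover have "measure M ({x. L (u i s x) = a} \<inter> z) = measure M ({x. L x = a} \<inter> z)" if "s < N" for s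
    proof -
      have e: "{x. L (u i s x) = a} \<inter> z = u i s -` ({x. L x = a} \<inter> z)" using inv[OF that] by auto
      show ?thesis unfolding e by (rule mp_autD(4)[OF u[OF i that]]) (use La z in auto)
    qed
    ultimately have Eg: "expectation g = measure M ({x. L x = a} \<inter> z) - p a * measure M z" using N by simp
    have i2: "integrable M (\<lambda>x. (A i a x)\<^sup>2)" using Am Ab
      by (intro integrable_const_bound[of _ 1]) (auto simp: abs_square_le_1)
    have "(expectation g)\<^sup>2 \<le> expectation (\<lambda>x. (g x)\<^sup>2)" by (rule square_expectation_le[OF gm gb])
    also have "\<dots> \<le> expectation (\<lambda>x. (A i a x)\<^sup>2)"
    proof (rule integral_mono[OF _ i2])
      show "integrable M (\<lambda>x. (g x)\<^sup>2)"
        using gm gb by (intro integrable_const_bound[of _ 1]) (auto simp: abs_square_le_1)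
      show "(g x)\<^sup>2 \<le> (A i a x)\<^sup>2" for x by (simp add: g_def indicator_def)
    qed
    also have "\<dots> \<le> (\<Sum>t\<in>I \<times> \<Lambda>. \<integral>x. (A (fst t) (snd t) x)\<^sup>2 \<partial>M)"
      using member_le_sum[of "(i, a)" "I \<times> \<Lambda>" "\<lambda>t. \<integral>x. (A (fst t) (snd t) x)\<^sup>2 \<partial>M"] a i I \<Lambda> by auto
    also note tot
    finally have "sqrt ((expectation g)\<^sup>2) \<le> sqrt (card I * card \<Lambda> * (1 / real N + \<delta>))"
      by (rule real_sqrt_le_mono)
    then show "\<bar>measure M ({x. f x (w (J x)) = a} \<inter> z) - p a * measure M z\<bar> \<le> sqrt (card I * card \<Lambda> * (1 / real N + \<delta>))"
      by (simp add: Eg L_def)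
  qed
qed

text \<open>Points are classified by their membership in the first k sets of a base. For each pair
  of maps, the points where distinct images fall in the same class decrease to the empty set as k
  grows, and one k serves all of the finitely many pairs.\<close>

lemma separating_partition:
  fixes Q :: "(('a \<Rightarrow> 'a) \<times> ('a \<Rightarrow> 'a)) set"
  assumes Q: "finite Q" "\<And>u v. (u, v) \<in> Q \<Longrightarrow> u \<in> M \<rightarrow>\<^sub>M M \<and> v \<in> M \<rightarrow>\<^sub>M M" and \<delta>: "\<delta> > 0"
  obtains J :: "'a \<Rightarrow> nat" and m where "J \<in> M \<rightarrow>\<^sub>M count_space UNIV" "\<And>x. J x < m"
    "\<And>u v. (u, v) \<in> Q \<Longrightarrow> measure M {x. u x \<noteq> v x \<and> J (u x) = J (v x)} \<le> \<delta>"
proof -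
  obtain B :: "nat \<Rightarrow> 'a set" where B: "\<And>n. open (B n)"
    and sep: "\<And>U x. open U \<Longrightarrow> x \<in> U \<Longrightarrow> \<exists>n. x \<in> B n \<and> B n \<subseteq> U"
    using separating_sequence by metis
  have Bm [measurable]: "B n \<in> sets M" for n using B sets_M by auto
  have ne: "x \<noteq> y \<longleftrightarrow> (\<exists>n. (x \<in> B n) \<noteq> (y \<in> B n))" for x y
    using sep[of "- {y}" x] by auto
  define S where "S k x = {n. n < k \<and> x \<in> B n}" for k x
  \<comment> \<open>Coding the subset as a number gives classes in \<open>nat\<close>, with a bound
    because k is fixed in the end.\<close>
  define J where "J k x = set_encode (S k x)" for k x
  have Jeq: "J k x = J k y \<longleftrightarrow> (\<forall>n<k. x \<in> B n \<longleftrightarrow> y \<in> B n)" for k x y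
    unfolding J_def by (subst set_encode_eq) (auto simp: S_def)
  define E where "E u v k = {x. u x \<noteq> v x \<and> J k (u x) = J k (v x)}" for u v :: "'a \<Rightarrow> 'a" and k
  have Em: "E u v k \<in> sets M" if uv: "(u, v) \<in> Q" for u v k
  proof -
    have [measurable]: "u \<in> M \<rightarrow>\<^sub>M M" "v \<in> M \<rightarrow>\<^sub>M M" using Q(2)[OF uv] by auto
    have "{x \<in> space M. (\<exists>n. (u x \<in> B n) \<noteq> (v x \<in> B n)) \<and> (\<forall>n<k. u x \<in> B n \<longleftrightarrow> v x \<in> B n)} \<in> sets M"
      by measurable
    then show ?thesis by (simp add: E_def ne Jeq)
  qed
  have lim: "(\<lambda>k. measure M (E u v k)) \<longlonglongrightarrow> 0" if uv: "(u, v) \<in> Q" for u v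
  proof -
    have "(\<Inter>k. E u v k) = {}"
    proof (rule ccontr)
      assume "(\<Inter>k. E u v k) \<noteq> {}"
      then obtain x where x: "\<And>k. x \<in> E u v k" by auto
      then obtain n where "(u x \<in> B n) \<noteq> (v x \<in> B n)" using x[of 0] unfolding E_def ne by auto
      then show False using x[of "Suc n"] unfolding E_def Jeq by auto
    qed
    moreover have "(\<lambda>k. measure M (E u v k)) \<longlonglongrightarrow> measure M (\<Inter>k. E u v k)"
      using Em[OF uv] by (intro finite_Lim_measure_decseq) (auto simp: decseq_def E_def Jeq)
    ultimately show ?thesis by simp
  qed
  have "eventually (\<lambda>k. \<forall>q\<in>Q. measure M (E (fst q) (snd q) k) < \<delta>) sequentially"
    by (intro eventually_ball_finite Q(1) ballI order_tendstoD(2)[OF lim \<delta>]) simp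
  then obtain k where k: "\<forall>q\<in>Q. measure M (E (fst q) (snd q) k) < \<delta>" by (auto simp: eventually_sequentially)
  show thesis
  proof
    show "J k \<in> M \<rightarrow>\<^sub>M count_space UNIV"
    proof (rule measurable_count_space_eq2_countable[THEN iffD2], intro conjI ballI)
      fix j :: nat
      have "J k x = j \<longleftrightarrow> (\<forall>n. n \<in> set_decode j \<longleftrightarrow> n < k \<and> x \<in> B n)" for x
      proof -
        have "J k x = j \<longleftrightarrow> S k x = set_decode j"
          unfolding J_def by (metis set_decode_inverse set_encode_inverse finite_set_decode S_def finite_Collect_less_nat finite_Collect_conjI)
        then show ?thesis by (auto simp: S_def)
      qed
      then have "J k -` {j} \<inter> space M = {x \<in> space M. \<forall>n. n \<in> set_decode j \<longleftrightarrow> n < k \<and> x \<in> B n}" by auto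
      also have "\<dots> \<in> sets M" by measurable
      finally show "J k -` {j} \<inter> space M \<in> sets M" .
    qed auto
    have "J k x \<in> set_encode ` Pow {..<k}" for x by (auto simp: J_def S_def)
    then show "J k x < Suc (Max (set_encode ` Pow {..<k}))" for x by (simp add: less_Suc_eq_le)
    show "measure M {x. u x \<noteq> v x \<and> J k (u x) = J k (v x)} \<le> \<delta>" if "(u, v) \<in> Q" for u v
      using k that by (auto simp: E_def intro: less_imp_le)
  qed
qed

end

section \<open>Cells of free actions of abelian groups\<close>

text \<open>Products of powers of the listed elements with exponents from 0 to r, taken in the order
  of the list. They play the part of balls of radius r; inverses are covered by putting them into
  the list.\<close>

primrec power_box :: "('g, 'b) monoid_scheme \<Rightarrow> 'g list \<Rightarrow> nat \<Rightarrow> 'g set" where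
  "power_box G [] r = {\<one>\<^bsub>G\<^esub>}"
| "power_box G (f # fs) r = (\<lambda>(k, b). (f [^]\<^bsub>G\<^esub> k) \<otimes>\<^bsub>G\<^esub> b) ` ({..r} \<times> power_box G fs r)"

lemma finite_power_box: "finite (power_box G fs r)"
  by (induction fs) auto

lemma card_power_box: "card (power_box G fs r) \<le> Suc r ^ length fs"
proof (induction fs)
  case (Cons f fs)
  have "card (power_box G (f # fs) r) \<le> card ({..r} \<times> power_box G fs r)"
    unfolding power_box.simps by (rule card_image_le) (simp add: finite_power_box)
  also have "\<dots> \<le> Suc r * Suc r ^ length fs"
    using Cons by (simp add: card_cartesian_product del: mult_Suc)
  finally show ?case by simp
qed simp

context comm_group
begin

lemma power_box_subset: "set fs \<subseteq> carrier G \<Longrightarrow> power_box G fs r \<subseteq> carrier G"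
  by (induction fs) auto

lemma power_box_mono: "power_box G fs r \<subseteq> power_box G fs (Suc r)"
proof (induction fs)
  case (Cons f fs)
  then show ?case unfolding power_box.simps by (intro image_mono Sigma_mono) auto
qed simp

lemma one_in_power_box: "\<one> \<in> power_box G fs r"
proof (induction fs)
  case (Cons f fs)
  have "\<one> = (f [^] (0::nat)) \<otimes> \<one>" by simp
  then show ?case using Cons by (force simp: image_iff)
qed simp

text \<open>Commutativity moves f to its own place in the product, where it raises one exponent by
  one.\<close>

lemma mult_power_box:
  "f \<in> set fs \<Longrightarrow> set fs \<subseteq> carrier G \<Longrightarrow> b \<in> power_box G fs r \<Longrightarrow> f \<otimes> b \<in> power_box G fs (Suc r)"
proof (induction fs arbitrary: b)
  case (Cons g fs)
  then obtain k b' where b: "k \<le> r" "b' \<in> power_box G fs r" "b = (g [^] k) \<otimes> b'" by auto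
  have c: "g \<in> carrier G" "f \<in> carrier G" "b' \<in> carrier G"
    using Cons.prems b(2) power_box_subset[of fs r] by auto
  show ?case
  proof (cases "f = g")
    case True
    have "f \<otimes> b = (g [^] Suc k) \<otimes> b'"
      using c True b(3) by (simp add: m_assoc[symmetric] m_comm[of g])
    then show ?thesis using b power_box_mono[of fs r] by (force simp: image_iff)
  next
    case False
    then have "f \<otimes> b' \<in> power_box G fs (Suc r)" using Cons.IH[OF _ _ b(2)] Cons.prems by auto
    moreover have "f \<otimes> b = (g [^] k) \<otimes> (f \<otimes> b')"
      using c b(3) by (simp add: m_lcomm)
    ultimately show ?thesis using b(1) by (force simp: image_iff)
  qed
qed simp

end

lemma polynomial_less_exponential:
  fixes \<epsilon> :: real assumes "\<epsilon> > 0"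
  obtains r where "0 < r" "real (Suc r ^ k) < (1 + \<epsilon>) ^ r"
proof -
  define c where "c = ln (1 + \<epsilon>)"
  have c: "c > 0" "exp c = 1 + \<epsilon>" using assms by (auto simp: c_def)
  have "filterlim (\<lambda>r. c * real (Suc r)) at_top sequentially"
    by (intro filterlim_tendsto_pos_mult_at_top[OF tendsto_const c(1)]
        filterlim_compose[OF filterlim_real_sequentially filterlim_Suc])
  from filterlim_compose[OF tendsto_power_div_exp_0 this]
  have "(\<lambda>r. (c * real (Suc r)) ^ k / exp (c * real (Suc r))) \<longlonglongrightarrow> 0" .
  \<comment> \<open>With \<open>exp c = 1 + \<epsilon>\<close> the left side is
    \<open>c ^ k / exp c\<close> times the quotient of \<open>Suc r ^ k\<close> by
    \<open>(1 + \<epsilon>) ^ r\<close>, so this threshold says that the quotient is below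
    1.\<close>
  then have "\<forall>\<^sub>F r in sequentially. (c * real (Suc r)) ^ k / exp (c * real (Suc r)) < c ^ k / exp c"
    using c(1) by (intro order_tendstoD(2)) auto
  then have "\<forall>\<^sub>F r in sequentially. 0 < r \<and> (c * real (Suc r)) ^ k / exp (c * real (Suc r)) < c ^ k / exp c"
    using eventually_gt_at_top[of 0] by eventually_elim auto
  then obtain r where r: "0 < r" "(c * real (Suc r)) ^ k / exp (c * real (Suc r)) < c ^ k / exp c"
    by (auto simp: eventually_sequentially)
  have "exp (c * real (Suc r)) = exp c * (1 + \<epsilon>) ^ r"
    using exp_of_nat_mult[of r c] by (simp add: distrib_left exp_add c(2)[symmetric] mult.commute)
  then have "c ^ k * real (Suc r) ^ k / (exp c * (1 + \<epsilon>) ^ r) < c ^ k / exp c"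
    using r(2) by (simp only: power_mult_distrib)
  then have "real (Suc r) ^ k < (1 + \<epsilon>) ^ r"
    using c(1) assms by (simp add: divide_simps del: of_nat_Suc)
  then show thesis using that r(1) by simp
qed

text \<open>Growth by a factor above \<open>1 + \<epsilon>\<close> at each of R radii would make the
  last term exceed \<open>C * a 0\<close>.\<close>

lemma slow_growth_radius:
  fixes a :: "nat \<Rightarrow> real"
  assumes "\<epsilon> > 0" "0 < R" "a R \<le> C * a 0" "C < (1 + \<epsilon>) ^ R" "0 \<le> a 0"
  shows "\<exists>\<rho><R. a (Suc \<rho>) \<le> (1 + \<epsilon>) * a \<rho>"
proof (rule ccontr)
  assume "\<not> ?thesis"
  then have n: "(1 + \<epsilon>) * a \<rho> < a (Suc \<rho>)" if "\<rho> < R" for \<rho> using that by (auto simp: not_le)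
  have g: "(1 + \<epsilon>) ^ \<rho> * a 0 \<le> a \<rho>" if "\<rho> \<le> R" for \<rho>
    using that
  proof (induction \<rho>)
    case (Suc \<rho>)
    have "(1 + \<epsilon>) ^ Suc \<rho> * a 0 = (1 + \<epsilon>) * ((1 + \<epsilon>) ^ \<rho> * a 0)" by simp
    also have "\<dots> \<le> (1 + \<epsilon>) * a \<rho>" using Suc assms(1) by (intro mult_left_mono) auto
    also have "\<dots> \<le> a (Suc \<rho>)" using n[of \<rho>] Suc.prems by simp
    finally show ?case .
  qed simp
  \<comment> \<open>The last step is kept apart because only it is taken with strict inequality,
    which also covers \<open>a 0 = 0\<close>.\<close>
  obtain R' where R': "R = Suc R'" using assms(2) gr0_implies_Suc by blast
  have "(1 + \<epsilon>) ^ R * a 0 = (1 + \<epsilon>) * ((1 + \<epsilon>) ^ R' * a 0)" by (simp add: R')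
  also have "\<dots> \<le> (1 + \<epsilon>) * a R'" using g[of R'] assms(1) by (intro mult_left_mono) (auto simp: R')
  also have "\<dots> < a R" using n[of R'] by (simp add: R')
  also have "\<dots> \<le> C * a 0" by (rule assms(3))
  also have "\<dots> \<le> (1 + \<epsilon>) ^ R * a 0" using assms by (intro mult_right_mono) auto
  finally show False by simp
qed

context std_space
begin

lemma sets_neq:
  assumes "u \<in> M \<rightarrow>\<^sub>M M" "v \<in> M \<rightarrow>\<^sub>M M" shows "{x. u x \<noteq> v x} \<in> sets M"
proof -
  obtain B :: "nat \<Rightarrow> 'a set" where B: "\<And>n. open (B n)"
    and sep: "\<And>U x. open U \<Longrightarrow> x \<in> U \<Longrightarrow> \<exists>n. x \<in> B n \<and> B n \<subseteq> U"
    using separating_sequence by metis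
  have [measurable]: "B n \<in> sets M" for n using B sets_M by auto
  have ne: "x \<noteq> y \<longleftrightarrow> (\<exists>n. (x \<in> B n) \<noteq> (y \<in> B n))" for x y
    using sep[of "- {y}" x] by auto
  note [measurable] = assms
  have "{x \<in> space M. \<exists>n. (u x \<in> B n) \<noteq> (v x \<in> B n)} \<in> sets M" by measurable
  then show ?thesis by (simp add: ne)
qed

end

locale free_haction = haction M G \<alpha> for M :: "'a::polish_space measure"
    and G :: "('g, 'b) monoid_scheme" and \<alpha> :: "'g \<Rightarrow> 'a \<Rightarrow> 'a" +
  assumes countable_carrier: "countable (carrier G)"
    and free_AE: "AE x in M. \<forall>g\<in>carrier G. g \<noteq> \<one>\<^bsub>G\<^esub> \<longrightarrow> \<alpha> g x \<noteq> x"
begin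

definition free_part :: "'a set" where
  "free_part = {x. \<forall>g\<in>carrier G. g \<noteq> \<one>\<^bsub>G\<^esub> \<longrightarrow> \<alpha> g x \<noteq> x}"

lemma free_part: "free_part \<in> sets M" "measure M (- free_part) = 0"
  "g \<in> carrier G \<Longrightarrow> x \<in> free_part \<Longrightarrow> \<alpha> g x \<in> free_part"
proof -
  have s: "{x. \<alpha> g x \<noteq> x} \<in> sets M" if "g \<in> carrier G" for g
    using sets_neq[OF mp_aut_measurable[OF mp[OF that]], of "\<lambda>x. x"] by simp
  have "free_part = - (\<Union>g\<in>carrier G - {\<one>\<^bsub>G\<^esub>}. - {x. \<alpha> g x \<noteq> x})" by (auto simp: free_part_def)
  also have "\<dots> \<in> sets M"
    using s countable_carrier by (intro Compl_in_M sets.countable_UN') auto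
  finally show 1: "free_part \<in> sets M" .
  have "AE x in M. x \<in> free_part" using free_AE by (simp add: free_part_def)
  then show "measure M (- free_part) = 0" using AE_iff_measure_compl[OF 1] by simp
  assume g: "g \<in> carrier G" and x: "x \<in> free_part"
  show "\<alpha> g x \<in> free_part" unfolding free_part_def
  proof (intro CollectI ballI impI notI)
    fix h assume h: "h \<in> carrier G" "h \<noteq> \<one>\<^bsub>G\<^esub>" "\<alpha> h (\<alpha> g x) = \<alpha> g x"
    \<comment> \<open>A stabiliser of \<open>\<alpha> g x\<close> is conjugated by g to one of
      x.\<close>
    define k where "k = m_inv G g \<otimes>\<^bsub>G\<^esub> (h \<otimes>\<^bsub>G\<^esub> g)"
    have "\<alpha> k x = x" using g h by (simp add: k_def hom)
    moreover have "k \<in> carrier G" using g h by (simp add: k_def)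
    ultimately have "k = \<one>\<^bsub>G\<^esub>" using x unfolding free_part_def by blast
    then have "g \<otimes>\<^bsub>G\<^esub> k = g" using g by simp
    moreover have "g \<otimes>\<^bsub>G\<^esub> k = h \<otimes>\<^bsub>G\<^esub> g"
      using g h(1) m_assoc[of g "m_inv G g" "h \<otimes>\<^bsub>G\<^esub> g"] by (simp add: k_def)
    ultimately have "h = \<one>\<^bsub>G\<^esub>" using g h(1) by (simp add: r_cancel_one)
    then show False using h by simp
  qed
qed

lemma act_eq_iff:
  assumes "x \<in> free_part" "g \<in> carrier G" "h \<in> carrier G"
  shows "\<alpha> g x = \<alpha> h x \<longleftrightarrow> g = h"
proof
  assume "\<alpha> g x = \<alpha> h x"
  then have "\<alpha> (m_inv G h \<otimes>\<^bsub>G\<^esub> g) x = x" using assms by (simp add: hom)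
  moreover have "m_inv G h \<otimes>\<^bsub>G\<^esub> g \<in> carrier G" using assms by simp
  ultimately have "m_inv G h \<otimes>\<^bsub>G\<^esub> g = \<one>\<^bsub>G\<^esub>" using assms(1) by (auto simp: free_part_def)
  then show "g = h" using assms by (metis inv_closed inv_equality inv_inv)
qed simp

text \<open>A point of the free part differs from its finitely many D-translates, so some basic set
  contains it and misses them all. \<open>Y n\<close> collects the points for which the basic set
  \<open>B n\<close> does this.\<close>

lemma independent_cover:
  assumes D: "finite D" "D \<subseteq> carrier G" "\<one>\<^bsub>G\<^esub> \<notin> D"
  obtains Y :: "nat \<Rightarrow> 'a set" where "\<And>n. Y n \<in> sets M" "(\<Union>n. Y n) = free_part"
    "\<And>n d y. d \<in> D \<Longrightarrow> y \<in> Y n \<Longrightarrow> \<alpha> d y \<notin> Y n"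
proof -
  obtain B :: "nat \<Rightarrow> 'a set" where B: "\<And>n. open (B n)"
    and sep: "\<And>U x. open U \<Longrightarrow> x \<in> U \<Longrightarrow> \<exists>n. x \<in> B n \<and> B n \<subseteq> U"
    using separating_sequence by metis
  have Bm: "B n \<in> sets M" for n using B sets_M by auto
  define Y where "Y n = (free_part \<inter> B n) - (\<Union>d\<in>D. \<alpha> d -` B n)" for n
  show thesis
  proof
    show "Y n \<in> sets M" for n unfolding Y_def
      using D free_part(1) Bm mp_autD(2)[OF mp Bm] by (intro sets.Diff sets.Int sets.finite_UN) auto
    show "\<alpha> d y \<notin> Y n" if "d \<in> D" "y \<in> Y n" for n d y using that by (auto simp: Y_def)
    have "x \<in> (\<Union>n. Y n)" if x: "x \<in> free_part" for x
    proof -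
      define U where "U = - ((\<lambda>d. \<alpha> d x) ` D)"
      have "open U" unfolding U_def using D(1) by (intro open_Compl finite_imp_closed) auto
      moreover have "x \<in> U"
      proof -
        have "\<alpha> d x \<noteq> x" if "d \<in> D" for d
        proof -
          have "d \<in> carrier G" "d \<noteq> \<one>\<^bsub>G\<^esub>" using that D by auto
          then show ?thesis using x by (simp add: free_part_def)
        qed
        then show ?thesis by (force simp: U_def)
      qed
      ultimately obtain n where "x \<in> B n" "B n \<subseteq> U" using sep by blast
      then have "x \<in> Y n" using x by (auto simp: Y_def U_def)
      then show ?thesis by blast
    qed
    then show "(\<Union>n. Y n) = free_part" by (auto simp: Y_def)
  qed
qed

text \<open>Ball growing: the centres are treated one independent family \<open>Y n\<close> at a time, each with a
  radius at which the part of its balls not yet covered gains little mass.\<close>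

lemma cells:
  fixes B :: "nat \<Rightarrow> 'g set" and F :: "'g set"
  assumes B: "\<And>r. finite (B r)" "\<And>r. B r \<subseteq> carrier G" "\<And>r. B r \<subseteq> B (Suc r)" "\<one>\<^bsub>G\<^esub> \<in> B 0"
    and FB: "\<And>f b r. f \<in> F \<Longrightarrow> b \<in> B r \<Longrightarrow> f \<otimes>\<^bsub>G\<^esub> b \<in> B (Suc r)"
    and F: "F \<subseteq> carrier G" "\<And>f. f \<in> F \<Longrightarrow> m_inv G f \<in> F"
    and R: "0 < R" "real (card (B R)) < (1 + \<epsilon>) ^ R" and \<epsilon>: "\<epsilon> > 0"
  obtains q where "q \<in> M \<rightarrow>\<^sub>M count_space (carrier G)"
    "\<And>g. g \<in> F \<Longrightarrow> measure M {x. q (\<alpha> g x) \<noteq> g \<otimes>\<^bsub>G\<^esub> q x} \<le> 2 * \<epsilon>"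
proof -
  have Bm: "B r \<subseteq> B r'" if "r \<le> r'" for r r' using lift_Suc_mono_le[of B] B(3) that by blast
  have Bc: "b \<in> carrier G" if "b \<in> B r" for b r using that B(2) by blast
  \<comment> \<open>Quotients of two elements of the largest ball: for centres in a set that meets
    none of its own D-translates, the balls are disjoint and positions in them are unique, which is
    \<open>uniq\<close>.\<close>
  define D where "D = (\<lambda>(b, b'). m_inv G b' \<otimes>\<^bsub>G\<^esub> b) ` (B R \<times> B R) - {\<one>\<^bsub>G\<^esub>}"
  have D: "finite D" "D \<subseteq> carrier G" "\<one>\<^bsub>G\<^esub> \<notin> D" using B(1) Bc by (auto simp: D_def)
  have "\<exists>Y :: nat \<Rightarrow> 'a set. (\<forall>n. Y n \<in> sets M) \<and> (\<Union>n. Y n) = free_part \<and>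
      (\<forall>n. \<forall>d\<in>D. \<forall>y\<in>Y n. \<alpha> d y \<notin> Y n)"
    by (rule independent_cover[OF D]) blast
  then obtain Y :: "nat \<Rightarrow> 'a set" where Y0: "(\<forall>n. Y n \<in> sets M) \<and> (\<Union>n. Y n) = free_part \<and>
      (\<forall>n. \<forall>d\<in>D. \<forall>y\<in>Y n. \<alpha> d y \<notin> Y n)" ..
  have Y: "Y n \<in> sets M" "(\<Union>n. Y n) = free_part" "d \<in> D \<Longrightarrow> y \<in> Y n \<Longrightarrow> \<alpha> d y \<notin> Y n" for n d y
    using conjunct1[OF Y0] conjunct1[OF conjunct2[OF Y0]] conjunct2[OF conjunct2[OF Y0]] by simp_all
  have uniq: "b = b'" if b: "b \<in> B R" "b' \<in> B R" and y: "y \<in> Y n" "y' \<in> Y n" "\<alpha> b y = \<alpha> b' y'" for b b' n y y'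
  proof -
    have "\<alpha> (m_inv G b' \<otimes>\<^bsub>G\<^esub> b) y = y'" using b y(3) Bc by (simp add: hom)
    then have "m_inv G b' \<otimes>\<^bsub>G\<^esub> b = \<one>\<^bsub>G\<^esub>" using Y(3)[of "m_inv G b' \<otimes>\<^bsub>G\<^esub> b" y n] y b by (force simp: D_def)
    then show ?thesis using b Bc by (metis inv_closed inv_equality inv_inv)
  qed
  \<comment> \<open>The part of the uncovered set X within distance \<rho> of the centres
    \<open>Y n\<close> that are themselves uncovered.\<close>
  define V where "V n X \<rho> = X \<inter> (\<Union>b\<in>B \<rho>. \<alpha> b ` (Y n \<inter> X))" for n X \<rho>
  have Vs: "V n X \<rho> \<in> sets M" if "X \<in> sets M" for n X \<rho>
    unfolding V_def using that Y(1) B(1) mp_autD(3)[OF mp[OF Bc]] by (intro sets.Int sets.finite_UN) auto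
  have Vm: "V n X \<rho> \<subseteq> V n X \<rho>'" if "\<rho> \<le> \<rho>'" for n X \<rho> \<rho>' using Bm[OF that] by (auto simp: V_def)
  have YV: "Y n \<inter> X \<subseteq> V n X \<rho>" for n X \<rho>
  proof
    fix x assume x: "x \<in> Y n \<inter> X"
    have "\<one>\<^bsub>G\<^esub> \<in> B \<rho>" using Bm[of 0 \<rho>] B(4) by auto
    moreover have "x \<in> \<alpha> \<one>\<^bsub>G\<^esub> ` (Y n \<inter> X)" using x by simp
    ultimately show "x \<in> V n X \<rho>" using x unfolding V_def by blast
  qed
  define r where "r n X = (SOME \<rho>. \<rho> < R \<and> measure M (V n X (Suc \<rho>)) \<le> (1 + \<epsilon>) * measure M (V n X \<rho>))" for n X
  have r: "r n X < R" "measure M (V n X (Suc (r n X))) \<le> (1 + \<epsilon>) * measure M (V n X (r n X))"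
    if X: "X \<in> sets M" for n X
  proof -
    have s: "Y n \<inter> X \<in> sets M" using X Y(1) by auto
    \<comment> \<open>The largest ball has at most \<open>card (B R)\<close> times the mass of the
      centres, which lie in the ball of radius 0. This is the growth bound that forces a radius of
      slow growth.\<close>
    have "measure M (V n X R) \<le> measure M (\<Union>b\<in>B R. \<alpha> b ` (Y n \<inter> X))"
      using B(1) mp_autD(3)[OF mp[OF Bc] s] by (intro measure_mono_M) (auto simp: V_def)
    also have "\<dots> \<le> (\<Sum>b\<in>B R. measure M (\<alpha> b ` (Y n \<inter> X)))"
      using B(1) mp_autD(3)[OF mp[OF Bc] s] by (intro finite_measure_subadditive_finite) auto
    also have "\<dots> = (\<Sum>b\<in>B R. measure M (Y n \<inter> X))"
      using mp_autD(5)[OF mp[OF Bc] s] by (intro sum.cong) auto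
    also have "\<dots> \<le> real (card (B R)) * measure M (V n X 0)"
      using measure_mono_M[OF YV Vs[OF X]] by (simp add: mult_left_mono)
    finally have "\<exists>\<rho><R. measure M (V n X (Suc \<rho>)) \<le> (1 + \<epsilon>) * measure M (V n X \<rho>)"
      by (intro slow_growth_radius[OF \<epsilon> R(1) _ R(2)]) auto
    then have "r n X < R \<and> measure M (V n X (Suc (r n X))) \<le> (1 + \<epsilon>) * measure M (V n X (r n X))"
      unfolding r_def by (rule someI_ex)
    then show "r n X < R" "measure M (V n X (Suc (r n X))) \<le> (1 + \<epsilon>) * measure M (V n X (r n X))" by auto
  qed
  \<comment> \<open>What is still uncovered before stage n. A centre is covered by its own ball, so
    after all stages the whole free part is covered.\<close>
  define X where "X = rec_nat free_part (\<lambda>n X. X - V n X (r n X))"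
  have X0: "X 0 = free_part" and XS: "X (Suc n) = X n - V n (X n) (r n (X n))" for n by (simp_all add: X_def)
  have Xs: "X n \<in> sets M" for n by (induction n) (auto simp: X0 XS free_part(1) Vs)
  have Xm: "X m \<subseteq> X n" if "n \<le> m" for n m
    by (rule lift_Suc_antimono_le[OF _ that]) (auto simp: XS)
  define \<rho> where "\<rho> n = r n (X n)" for n
  have \<rho>: "\<rho> n < R" for n unfolding \<rho>_def by (rule r[OF Xs])
  define W where "W n = V n (X n) (\<rho> n)" for n
  have WX: "W n \<subseteq> X n" "X (Suc n) = X n - W n" for n by (auto simp: W_def \<rho>_def V_def XS)
  have Ws: "W n \<in> sets M" for n unfolding W_def by (rule Vs[OF Xs])
  have Wn: "x \<notin> W m" if "x \<in> W n" "n < m" for x n m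
  proof -
    have "x \<notin> X (Suc n)" using that(1) by (simp add: WX(2))
    then have "x \<notin> X m" using Xm[of "Suc n" m] that(2) by auto
    then show ?thesis using WX(1)[of m] by auto
  qed
  have Wd: "n = m" if "x \<in> W n" "x \<in> W m" for x n m
    using Wn[of x n m] Wn[of x m n] that by (cases n m rule: linorder_cases) auto
  have cover: "\<exists>n. x \<in> W n" if x: "x \<in> free_part" for x
  proof (rule ccontr)
    assume no: "\<nexists>n. x \<in> W n"
    have "x \<in> X n" for n using no x by (induction n) (auto simp: X0 WX(2))
    moreover obtain n where "x \<in> Y n" using x Y(2) by blast
    ultimately show False using no YV[of n "X n" "\<rho> n"] by (auto simp: W_def)
  qed
  have WF: "W n \<subseteq> free_part" for n using WX(1)[of n] Xm[of 0 n] X0 by auto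
  \<comment> \<open>x is covered at stage n and has position b relative to the centre of its
    cell.\<close>
  define Q where "Q n x b \<longleftrightarrow> x \<in> W n \<and> b \<in> B (\<rho> n) \<and> \<alpha> (m_inv G b) x \<in> Y n \<inter> X n" for n x b
  have Qu: "b = b' \<and> n = n'" if "Q n x b" "Q n' x b'" for n x b n' b'
  proof -
    have n: "n = n'" using that Wd by (auto simp: Q_def)
    have b: "b \<in> B R" "b' \<in> B R" using that Bm[OF less_imp_le[OF \<rho>[of n]]] n by (auto simp: Q_def)
    have "b = b'"
      by (rule uniq[OF b, of "\<alpha> (m_inv G b) x" n "\<alpha> (m_inv G b') x"]) (use that n b Bc in \<open>auto simp: Q_def\<close>)
    then show ?thesis using n by simp
  qed
  have Qe: "\<exists>b. Q n x b" if x: "x \<in> W n" for n x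
  proof -
    obtain b y where "b \<in> B (\<rho> n)" "y \<in> Y n \<inter> X n" "x = \<alpha> b y" using x by (auto simp: W_def V_def)
    then show ?thesis using x Bc by (intro exI[of _ b]) (auto simp: Q_def)
  qed
  \<comment> \<open>The position of x in its cell. The default on the null complement of the free
    part keeps q total with values in the group.\<close>
  define q where "q x = (if x \<in> free_part then THE b. \<exists>n. Q n x b else \<one>\<^bsub>G\<^esub>)" for x
  have qQ: "q x = b" if Q: "Q n x b" for n x b
  proof -
    have "x \<in> free_part" using Q WF by (auto simp: Q_def)
    moreover have "(THE b. \<exists>n. Q n x b) = b" using Q Qu by (intro the_equality) blast+
    ultimately show ?thesis by (simp add: q_def)
  qed
  have qc: "q x \<in> carrier G" for x
  proof (cases "x \<in> free_part")
    case True
    then obtain n b where "Q n x b" using cover Qe by blast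
    then show ?thesis using qQ Bc by (metis Q_def)
  qed (simp add: q_def)
  have qm: "q \<in> M \<rightarrow>\<^sub>M count_space (carrier G)"
  proof (subst measurable_count_space_eq_countable[OF countable_carrier], intro conjI ballI)
    show "q \<in> space M \<rightarrow> carrier G" using qc by simp
    fix g assume g: "g \<in> carrier G"
    have Qs: "{x. Q n x g} \<in> sets M" for n
    proof -
      have "{x. Q n x g} = (if g \<in> B (\<rho> n) then W n \<inter> \<alpha> (m_inv G g) -` (Y n \<inter> X n) else {})"
        by (auto simp: Q_def)
      moreover have "\<alpha> (m_inv G g) -` (Y n \<inter> X n) \<in> sets M" using g Y(1) Xs by (intro mp_autD(2)[OF mp]) auto
      ultimately show ?thesis using Ws by auto
    qed
    have "q -` {g} \<inter> space M = (\<Union>n. {x. Q n x g}) \<union> (if g = \<one>\<^bsub>G\<^esub> then - free_part else {})"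
    proof (intro equalityI subsetI)
      fix x assume x: "x \<in> q -` {g} \<inter> space M"
      show "x \<in> (\<Union>n. {x. Q n x g}) \<union> (if g = \<one>\<^bsub>G\<^esub> then - free_part else {})"
      proof (cases "x \<in> free_part")
        case True
        then obtain n b where "Q n x b" using cover Qe by blast
        then show ?thesis using x qQ by auto
      next
        case False then show ?thesis using x by (simp add: q_def)
      qed
    next
      fix x assume "x \<in> (\<Union>n. {x. Q n x g}) \<union> (if g = \<one>\<^bsub>G\<^esub> then - free_part else {})"
      then have "(\<exists>n. Q n x g) \<or> (g = \<one>\<^bsub>G\<^esub> \<and> x \<notin> free_part)" by (auto split: if_splits)
      then have "q x = g" using qQ q_def by metis
      then show "x \<in> q -` {g} \<inter> space M" by simp
    qed
    also have "\<dots> \<in> sets M" using Qs free_part(1) by auto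
    finally show "q -` {g} \<inter> space M \<in> sets M" .
  qed
  \<comment> \<open>The shell that the next radius would have added at stage n. By the choice of
    radius it has at most \<epsilon> times the mass of \<open>W n\<close>, and the sets
    \<open>W n\<close> are disjoint.\<close>
  define E where "E n = V n (X n) (Suc (\<rho> n)) - W n" for n
  have Es: "E n \<in> sets M" for n unfolding E_def using Ws Vs[OF Xs] by auto
  have mE: "measure M (E n) \<le> \<epsilon> * measure M (W n)" for n
  proof -
    have "measure M (E n) = measure M (V n (X n) (Suc (\<rho> n))) - measure M (W n)"
      unfolding E_def using Vm[of "\<rho> n" "Suc (\<rho> n)" n "X n"] Ws Vs[OF Xs] by (intro finite_measure_Diff) (auto simp: W_def)
    then show ?thesis using r(2)[OF Xs, of n n] by (simp add: W_def \<rho>_def algebra_simps)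
  qed
  have sW: "(\<lambda>n. measure M (W n)) sums measure M (\<Union>n. W n)"
    using Ws Wd by (intro finite_measure_UNION) (auto simp: disjoint_family_on_def)
  have sE: "summable (\<lambda>n. measure M (E n))"
    by (rule summable_comparison_test'[OF summable_mult[OF sums_summable[OF sW], of \<epsilon>], of 0]) (use mE in auto)
  have "measure M (\<Union>n. E n) \<le> (\<Sum>n. measure M (E n))"
    using Es sE by (intro finite_measure_subadditive_countably) auto
  also have "\<dots> \<le> (\<Sum>n. \<epsilon> * measure M (W n))"
    by (rule suminf_le[OF mE sE summable_mult[OF sums_summable[OF sW]]])
  also have "\<dots> = \<epsilon> * measure M (\<Union>n. W n)" using sW by (metis sums_mult sums_unique)
  also have "\<dots> \<le> \<epsilon> * 1" using \<epsilon> by (intro mult_left_mono prob_le_1) auto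
  finally have mEU: "measure M (\<Union>n. E n) \<le> \<epsilon>" by simp
  have EUs: "(\<Union>n. E n) \<in> sets M" using Es by auto
  \<comment> \<open>If the cell of x is formed no later than that of its image, the image is still
    uncovered at stage n and is reached from the centre of x by the product of g and b, within the
    next radius. Were it in \<open>W n\<close>, uniqueness would give it that very position; so it
    is in the shell. In the other order the roles are exchanged and the inverse of g is
    used.\<close>
  have bad: "\<alpha> g x \<in> (\<Union>n. E n) \<or> x \<in> (\<Union>n. E n)"
    if g: "g \<in> F" and x: "x \<in> free_part" and ne: "q (\<alpha> g x) \<noteq> g \<otimes>\<^bsub>G\<^esub> q x" for g x
  proof -
    have gc: "g \<in> carrier G" using g F by auto
    obtain n where n: "x \<in> W n" using cover[OF x] by auto
    obtain m where m: "\<alpha> g x \<in> W m" using cover[OF free_part(3)[OF gc x]] by auto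
    obtain b where b: "Q n x b" using Qe[OF n] by auto
    obtain b' where b': "Q m (\<alpha> g x) b'" using Qe[OF m] by auto
    have bB: "b \<in> B (\<rho> n)" "b' \<in> B (\<rho> m)" using b b' by (auto simp: Q_def)
    have bc: "b \<in> carrier G" "b' \<in> carrier G" using bB Bc by auto
    define y where "y = \<alpha> (m_inv G b) x"
    define y' where "y' = \<alpha> (m_inv G b') (\<alpha> g x)"
    have y: "y \<in> Y n \<inter> X n" "\<alpha> b y = x" and y': "y' \<in> Y m \<inter> X m" "\<alpha> b' y' = \<alpha> g x"
      using b b' bc by (auto simp: y_def y'_def Q_def)
    show ?thesis
    proof (cases "n \<le> m")
      case True
      have gb: "g \<otimes>\<^bsub>G\<^esub> b \<in> B (Suc (\<rho> n))" by (rule FB[OF g bB(1)])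
      have e: "\<alpha> (g \<otimes>\<^bsub>G\<^esub> b) y = \<alpha> g x" using gc bc y(2) by (simp add: hom)
      have "\<alpha> g x \<in> X n" using m WX(1)[of m] Xm[OF True] by auto
      moreover have "\<alpha> g x \<in> \<alpha> (g \<otimes>\<^bsub>G\<^esub> b) ` (Y n \<inter> X n)" using y(1) unfolding e[symmetric] by (rule imageI)
      ultimately have V: "\<alpha> g x \<in> V n (X n) (Suc (\<rho> n))" unfolding V_def using gb by blast
      have "\<alpha> g x \<notin> W n"
      proof
        assume "\<alpha> g x \<in> W n"
        then have nm: "n = m" using m Wd by auto
        have "g \<otimes>\<^bsub>G\<^esub> b = b'"
        proof (rule uniq[of _ _ y n y'])
          show "g \<otimes>\<^bsub>G\<^esub> b \<in> B R" "b' \<in> B R"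
            using gb bB(2) Bm[of "Suc (\<rho> n)" R] Bm[of "\<rho> m" R] \<rho>[of n] \<rho>[of m] by auto
        qed (use e y y' nm in auto)
        then show False using ne qQ[OF b] qQ[OF b'] by simp
      qed
      then show ?thesis using V by (auto simp: E_def)
    next
      case False
      then have mn: "m < n" by simp
      have gi: "m_inv G g \<otimes>\<^bsub>G\<^esub> b' \<in> B (Suc (\<rho> m))" by (rule FB[OF F(2)[OF g] bB(2)])
      have e: "\<alpha> (m_inv G g \<otimes>\<^bsub>G\<^esub> b') y' = x" using gc bc y'(2) by (simp add: hom)
      have "x \<in> X m" using n WX(1)[of n] Xm[of m n] mn by auto
      moreover have "x \<in> \<alpha> (m_inv G g \<otimes>\<^bsub>G\<^esub> b') ` (Y m \<inter> X m)" using e y'(1) by (metis imageI)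
      ultimately have "x \<in> V m (X m) (Suc (\<rho> m))" unfolding V_def using gi by blast
      moreover have "x \<notin> W m" using n Wd mn by auto
      ultimately show ?thesis by (auto simp: E_def)
    qed
  qed
  show thesis
  proof (rule that[OF qm])
    fix g assume g: "g \<in> F"
    then have gc: "g \<in> carrier G" using F by auto
    note s = mp_autD(2)[OF mp[OF gc] EUs] EUs
    have "{x. q (\<alpha> g x) \<noteq> g \<otimes>\<^bsub>G\<^esub> q x} \<subseteq> (\<alpha> g -` (\<Union>n. E n) \<union> (\<Union>n. E n)) \<union> - free_part"
      using bad[OF g] by blast
    then have "measure M {x. q (\<alpha> g x) \<noteq> g \<otimes>\<^bsub>G\<^esub> q x} \<le> measure M ((\<alpha> g -` (\<Union>n. E n) \<union> (\<Union>n. E n)) \<union> - free_part)"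
      using s free_part(1) by (intro measure_mono_M sets.Un Compl_in_M)
    also have "\<dots> \<le> measure M (\<alpha> g -` (\<Union>n. E n)) + measure M (\<Union>n. E n) + measure M (- free_part)"
      using s free_part(1) measure_Un_le[of "\<alpha> g -` (\<Union>n. E n)" M "\<Union>n. E n"]
        measure_Un_le[of "\<alpha> g -` (\<Union>n. E n) \<union> (\<Union>n. E n)" M "- free_part"] by (auto simp: Compl_in_M)
    also have "\<dots> \<le> 2 * \<epsilon>" using mEU free_part(2) mp_autD(4)[OF mp[OF gc] EUs] by simp
    finally show "measure M {x. q (\<alpha> g x) \<noteq> g \<otimes>\<^bsub>G\<^esub> q x} \<le> 2 * \<epsilon>" .
  qed
qed

text \<open>The list of generators is closed under inverses because cells are compared in both
  directions, and \<open>\<epsilon> / 2\<close> makes up for the two shells, at x and at its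
  image.\<close>

lemma cells_abelian:
  assumes "comm_group G" and F: "finite F" "F \<subseteq> carrier G" and \<epsilon>: "\<epsilon> > 0"
  obtains q where "q \<in> M \<rightarrow>\<^sub>M count_space (carrier G)"
    "\<And>g. g \<in> F \<Longrightarrow> measure M {x. q (\<alpha> g x) \<noteq> g \<otimes>\<^bsub>G\<^esub> q x} \<le> \<epsilon>"
proof -
  interpret C: comm_group G by fact
  obtain fs where fs: "set fs = F \<union> m_inv G ` F" using finite_list[of "F \<union> m_inv G ` F"] F(1) by auto
  have c: "set fs \<subseteq> carrier G" using F(2) by (auto simp: fs)
  obtain R where R: "0 < R" "real (Suc R ^ length fs) < (1 + \<epsilon> / 2) ^ R"
    using polynomial_less_exponential[of "\<epsilon> / 2" "length fs"] \<epsilon> by auto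
  have "real (card (power_box G fs R)) < (1 + \<epsilon> / 2) ^ R"
    using card_power_box[of G fs R] R(2) by (meson le_less_trans of_nat_le_iff)
  then have R2: "real (card (power_box G fs R)) < (1 + \<epsilon> / 2) ^ R" .
  have inv: "m_inv G f \<in> set fs" if f: "f \<in> set fs" for f
  proof (cases "f \<in> F")
    case False
    then obtain g where "g \<in> F" "f = m_inv G g" using f fs by auto
    then show ?thesis using F(2) fs by auto
  qed (simp add: fs)
  have e: "\<epsilon> / 2 > 0" using \<epsilon> by simp
  have mb: "f \<otimes>\<^bsub>G\<^esub> b \<in> power_box G fs (Suc r)" if "f \<in> set fs" "b \<in> power_box G fs r" for f b r
    using C.mult_power_box[OF _ c] that by blast
  show thesis
  proof (rule cells[where B = "power_box G fs" and F = "set fs" and R = R and \<epsilon> = "\<epsilon> / 2", OF finite_power_box C.power_box_subset[OF c] C.power_box_mono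
          C.one_in_power_box mb c inv R(1) R2 e])
    fix q assume q: "q \<in> M \<rightarrow>\<^sub>M count_space (carrier G)"
      "\<And>g. g \<in> set fs \<Longrightarrow> measure M {x. q (\<alpha> g x) \<noteq> g \<otimes>\<^bsub>G\<^esub> q x} \<le> 2 * (\<epsilon> / 2)"
    show thesis
    proof (rule that[OF q(1)])
      show "measure M {x. q (\<alpha> g x) \<noteq> g \<otimes>\<^bsub>G\<^esub> q x} \<le> \<epsilon>" if "g \<in> F" for g
        using q(2)[of g] that fs by simp
    qed
  qed
qed

end

context std_space
begin

section \<open>Simulation of an action\<close>

lemma sets_label_eq: "f \<in> M \<rightarrow>\<^sub>M count_space UNIV \<Longrightarrow> {x. f x = a} \<in> sets M"
  using measurable_sets[of f M "count_space UNIV" "{a}"] by (simp add: vimage_def)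

lemma sets_label_neq:
  assumes "f \<in> M \<rightarrow>\<^sub>M count_space UNIV" "g \<in> M \<rightarrow>\<^sub>M count_space UNIV" "finite \<Lambda>" "\<And>x. f x \<in> \<Lambda>"
  shows "{x. f x \<noteq> g x} \<in> sets M"
proof -
  have "{x. f x \<noteq> g x} = (\<Union>a\<in>\<Lambda>. {x. f x = a} - {x. g x = a})" using assms(4) by auto
  also have "\<dots> \<in> sets M" using assms(3) sets_label_eq[OF assms(1)] sets_label_eq[OF assms(2)]
    by (intro sets.finite_UN sets.Diff) auto
  finally show ?thesis .
qed

text \<open>Restricting positions to a finite set leaves only finitely many coincidences to avoid
  when translates are chosen.\<close>

lemma finite_range_approx:
  assumes q: "q \<in> M \<rightarrow>\<^sub>M count_space C" and C: "countable C" and \<delta>: "\<delta> > (0::real)"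
  obtains Q where "finite Q" "Q \<subseteq> C" "measure M {x. q x \<notin> Q} \<le> \<delta>" "{x. q x \<notin> Q} \<in> sets M"
proof -
  have qC: "q x \<in> C" for x using measurable_space[OF q, of x] by simp
  then have ne: "C \<noteq> {}" by auto
  define Q where "Q n = from_nat_into C ` {..<n}" for n
  have QC: "Q n \<subseteq> C" for n using from_nat_into[OF ne] by (auto simp: Q_def)
  have s: "{x. q x \<notin> Q n} \<in> sets M" for n
  proof -
    have "{x. q x \<notin> Q n} = q -` (C - Q n) \<inter> space M" using qC by auto
    then show ?thesis using measurable_sets[OF q, of "C - Q n"] by simp
  qed
  have "(\<lambda>n. measure M {x. q x \<notin> Q n}) \<longlonglongrightarrow> measure M (\<Inter>n. {x. q x \<notin> Q n})"
    using s by (intro finite_Lim_measure_decseq) (auto simp: decseq_def Q_def)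
  moreover have "(\<Inter>n. {x. q x \<notin> Q n}) = {}"
  proof -
    have "\<exists>n. q x \<in> Q n" for x
    proof -
      obtain n where "from_nat_into C n = q x" using from_nat_into_surj[OF C qC] by auto
      then have "q x \<in> Q (Suc n)" unfolding Q_def by (metis imageI lessThan_iff lessI)
      then show ?thesis ..
    qed
    then show ?thesis by auto
  qed
  ultimately have "\<forall>\<^sub>F n in sequentially. measure M {x. q x \<notin> Q n} < \<delta>"
    using \<delta> by (intro order_tendstoD(2)[of _ 0]) auto
  then obtain n where "measure M {x. q x \<notin> Q n} < \<delta>" by (auto simp: eventually_sequentially)
  then show thesis using that[of "Q n"] QC s by (auto simp: Q_def)
qed

end

text \<open>The centre of the cell of the translate \<open>\<alpha> (u s) x\<close> is the image of
  x under \<open>inv b \<otimes> u s\<close>, where b is a position. The conclusion keeps these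
  elements, hence the centres, apart for different s; each new term only has to avoid a finite
  set.\<close>

lemma (in group) separated_sequence:
  fixes N :: nat
  assumes inf: "infinite (carrier G)" and Q: "finite Q" "Q \<subseteq> carrier G"
  shows "\<exists>u. (\<forall>s<N. u s \<in> carrier G) \<and>
    (\<forall>s<N. \<forall>s'<N. s \<noteq> s' \<longrightarrow> (\<forall>b\<in>Q. \<forall>b'\<in>Q. inv b \<otimes> u s \<noteq> inv b' \<otimes> u s'))"
proof (induction N)
  case (Suc N)
  then obtain u where u: "\<forall>s<N. u s \<in> carrier G"
    "\<forall>s<N. \<forall>s'<N. s \<noteq> s' \<longrightarrow> (\<forall>b\<in>Q. \<forall>b'\<in>Q. inv b \<otimes> u s \<noteq> inv b' \<otimes> u s')" by auto
  have "finite ((\<lambda>(s, b, b'). b \<otimes> (inv b' \<otimes> u s)) ` ({..<N} \<times> Q \<times> Q))" using Q by auto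
  then obtain g where g: "g \<in> carrier G" "g \<notin> (\<lambda>(s, b, b'). b \<otimes> (inv b' \<otimes> u s)) ` ({..<N} \<times> Q \<times> Q)"
    using inf by (meson finite_subset subsetI)
  have n: "inv b \<otimes> g \<noteq> inv b' \<otimes> u s" if "s < N" "b \<in> Q" "b' \<in> Q" for s b b'
  proof
    assume "inv b \<otimes> g = inv b' \<otimes> u s"
    then have "b \<otimes> (inv b' \<otimes> u s) = b \<otimes> (inv b \<otimes> g)" by simp
    also have "\<dots> = g" using that Q g(1) by (simp add: m_assoc[symmetric] subset_iff)
    finally have "g = b \<otimes> (inv b' \<otimes> u s)" by simp
    then show False using g(2) that by force
  qed
  show ?case
  proof (intro exI[of _ "u(N := g)"] conjI allI impI ballI)
    fix s assume "s < Suc N" then show "(u(N := g)) s \<in> carrier G" using u(1) g(1) by auto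
  next
    fix s s' b b' assume a: "s < Suc N" "s' < Suc N" "s \<noteq> s'" "b \<in> Q" "b' \<in> Q"
    show "inv b \<otimes> (u(N := g)) s \<noteq> inv b' \<otimes> (u(N := g)) s'"
    proof (cases "s = N")
      case True
      then show ?thesis using n[of s' b b'] a by auto
    next
      case sN: False
      show ?thesis
      proof (cases "s' = N")
        case True
        then show ?thesis using n[of s b' b] a sN by (auto dest: sym)
      next
        case False
        then show ?thesis using u(2) a sN by auto
      qed
    qed
  qed
qed simp

context free_haction
begin

text \<open>The centre \<open>\<alpha> (q x)\<inverse> x\<close> of the cell of \<open>x\<close> selects a sample point \<open>w\<close>, and the cell is
  labelled as the corresponding piece of the \<open>\<beta>\<close>-orbit of \<open>w\<close>.\<close>

lemma equidistributed_simulation: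
  fixes P :: "'a \<Rightarrow> 'l" and \<Lambda> :: "'l set"
  assumes comm: "comm_group G" and inf: "infinite (carrier G)" and \<beta>: "haction M G \<beta>"
    and \<Lambda>: "finite \<Lambda>" "\<And>x. P x \<in> \<Lambda>" and P: "P \<in> M \<rightarrow>\<^sub>M count_space UNIV"
    and F: "finite F" "F \<subseteq> carrier G" and d: "d > 0" and \<eta>: "\<eta> > 0"
  obtains L where "L \<in> M \<rightarrow>\<^sub>M count_space UNIV" "\<And>x. L x \<in> \<Lambda>"
    "\<And>a z. a \<in> \<Lambda> \<Longrightarrow> z \<in> invariant_sets \<Longrightarrow>
       \<bar>measure M ({x. L x = a} \<inter> z) - measure M {x. P x = a} * measure M z\<bar> \<le> d"
    "\<And>g. g \<in> F \<Longrightarrow> \<exists>E\<in>sets M. measure M E \<le> \<eta> \<and> (\<forall>x. x \<notin> E \<longrightarrow> (\<exists>y. L x = P y \<and> L (\<alpha> g x) = P (\<beta> g y)))"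
proof -
  interpret \<beta>: haction M G \<beta> by (rule \<beta>)
  obtain q where q: "q \<in> M \<rightarrow>\<^sub>M count_space (carrier G)"
    and qF: "\<And>g. g \<in> F \<Longrightarrow> measure M {x. q (\<alpha> g x) \<noteq> g \<otimes>\<^bsub>G\<^esub> q x} \<le> \<eta>"
    using cells_abelian[OF comm F \<eta>] by blast
  have qc: "q x \<in> carrier G" for x using measurable_space[OF q, of x] by simp
  define c where "c x = \<alpha> (m_inv G (q x)) x" for x
  have cm: "c \<in> M \<rightarrow>\<^sub>M M" unfolding c_def
    by (rule measurable_compose_countable'[OF _ q countable_carrier, where f = "\<lambda>g x. \<alpha> (m_inv G g) x"])
      (rule mp_aut_measurable[OF mp], simp)
  have \<Lambda>0: "card \<Lambda> > 0" using \<Lambda> card_gt_0_iff by blast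
  \<comment> \<open>Sample numbers collide for three reasons, each of probability at most
    \<open>\<delta>\<close>: distinct centres get the same number, or one of the two positions falls
    outside Q. The choice makes \<open>card \<Lambda> * (3 * \<delta>)\<close> equal to
    \<open>d\<^sup>2 / 2\<close>.\<close>
  define \<delta> where "\<delta> = d\<^sup>2 / (6 * card \<Lambda>)"
  have \<delta>: "\<delta> > 0" using d \<Lambda>0 by (simp add: \<delta>_def)
  obtain N :: nat where N: "2 * card \<Lambda> / d\<^sup>2 < real N" using reals_Archimedean2 by blast
  have "0 \<le> 2 * card \<Lambda> / d\<^sup>2" by simp
  then have "0 < real N" using N by linarith
  then have N0: "N > 0" by simp
  \<comment> \<open>A one-point index set, since a single group acts here. The other half of
    \<open>d\<^sup>2\<close> bounds the term with \<open>1 / N\<close>.\<close>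
  have small: "sqrt (real (card (UNIV :: unit set)) * card \<Lambda> * (1 / real N + 3 * \<delta>)) \<le> d"
  proof -
    have "card \<Lambda> * (1 / real N) \<le> d\<^sup>2 / 2" using N N0 d by (simp add: field_simps)
    moreover have "card \<Lambda> * (3 * \<delta>) = d\<^sup>2 / 2" using \<Lambda>0 by (simp add: \<delta>_def field_simps)
    ultimately have "card \<Lambda> * (1 / real N + 3 * \<delta>) \<le> d\<^sup>2"
      unfolding distrib_left by linarith
    then have "real (card (UNIV :: unit set)) * card \<Lambda> * (1 / real N + 3 * \<delta>) \<le> d\<^sup>2" by simp
    then have "sqrt (real (card (UNIV :: unit set)) * card \<Lambda> * (1 / real N + 3 * \<delta>)) \<le> sqrt (d\<^sup>2)"
      by (rule real_sqrt_le_mono)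
    then show ?thesis using d by simp
  qed
  obtain Q where Q: "finite Q" "Q \<subseteq> carrier G" "measure M {x. q x \<notin> Q} \<le> \<delta>" "{x. q x \<notin> Q} \<in> sets M"
    by (rule finite_range_approx[OF q countable_carrier \<delta> that])
  obtain u where u0: "(\<forall>s<N. u s \<in> carrier G) \<and>
    (\<forall>s<N. \<forall>s'<N. s \<noteq> s' \<longrightarrow> (\<forall>b\<in>Q. \<forall>b'\<in>Q. m_inv G b \<otimes>\<^bsub>G\<^esub> u s \<noteq> m_inv G b' \<otimes>\<^bsub>G\<^esub> u s'))"
    using separated_sequence[OF inf Q(1,2), of N] ..
  have u: "s < N \<Longrightarrow> u s \<in> carrier G"
    "s < N \<Longrightarrow> s' < N \<Longrightarrow> s \<noteq> s' \<Longrightarrow> b \<in> Q \<Longrightarrow> b' \<in> Q \<Longrightarrow> m_inv G b \<otimes>\<^bsub>G\<^esub> u s \<noteq> m_inv G b' \<otimes>\<^bsub>G\<^esub> u s'"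
    for s s' b b' using conjunct1[OF u0] conjunct2[OF u0] by simp_all
  define C where "C s x = c (\<alpha> (u s) x)" for s x
  have Cm: "C s \<in> M \<rightarrow>\<^sub>M M" if "s < N" for s
    unfolding C_def using measurable_compose[OF mp_aut_measurable[OF mp[OF u(1)[OF that]]] cm] .
  have fin: "finite ((\<lambda>(s, s'). (C s, C s')) ` ({..<N} \<times> {..<N}))" by simp
  have meas: "f \<in> M \<rightarrow>\<^sub>M M \<and> f' \<in> M \<rightarrow>\<^sub>M M" if "(f, f') \<in> (\<lambda>(s, s'). (C s, C s')) ` ({..<N} \<times> {..<N})" for f f'
    using that Cm by auto
  obtain J :: "'a \<Rightarrow> nat" and m where J: "J \<in> M \<rightarrow>\<^sub>M count_space UNIV" "\<And>x. J x < m"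
    and JC0: "\<And>f f'. (f, f') \<in> (\<lambda>(s, s'). (C s, C s')) ` ({..<N} \<times> {..<N}) \<Longrightarrow>
        measure M {x. f x \<noteq> f' x \<and> J (f x) = J (f' x)} \<le> \<delta>"
    by (rule separating_partition[OF fin meas \<delta>], assumption, rule that, assumption, blast+)
  have JC: "measure M {x. C s x \<noteq> C s' x \<and> J (C s x) = J (C s' x)} \<le> \<delta>" if "s < N" "s' < N" for s s'
    using that by (intro JC0) auto
  have coll: "measure M {x. J (c (\<alpha> (u s) x)) = J (c (\<alpha> (u s') x))} \<le> 3 * \<delta>"
    if s: "s < N" "s' < N" "s \<noteq> s'" for s s'
  proof -
    define A1 where "A1 = {x. C s x \<noteq> C s' x \<and> J (C s x) = J (C s' x)}"
    define A2 where "A2 = \<alpha> (u s) -` {x. q x \<notin> Q}"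
    define A3 where "A3 = \<alpha> (u s') -` {x. q x \<notin> Q}"
    have "{x. C s x \<noteq> C s' x} \<inter> {x. J (C s x) = J (C s' x)} \<in> sets M"
    proof (intro sets.Int)
      show "{x. C s x \<noteq> C s' x} \<in> sets M" by (rule sets_neq[OF Cm[OF s(1)] Cm[OF s(2)]])
      have "{x. J (C s x) \<noteq> J (C s' x)} \<in> sets M"
        using J(2) by (intro sets_label_neq[of _ _ "{..<m}"] measurable_compose[OF Cm J(1)] s) auto
      then have "- {x. J (C s x) \<noteq> J (C s' x)} \<in> sets M" by (rule Compl_in_M)
      moreover have "- {x. J (C s x) \<noteq> J (C s' x)} = {x. J (C s x) = J (C s' x)}" by auto
      ultimately show "{x. J (C s x) = J (C s' x)} \<in> sets M" by simp
    qed
    moreover have "A1 = {x. C s x \<noteq> C s' x} \<inter> {x. J (C s x) = J (C s' x)}" by (auto simp: A1_def)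
    ultimately have s1: "A1 \<in> sets M" by simp
    have s2: "A2 \<in> sets M" "measure M A2 \<le> \<delta>" "A3 \<in> sets M" "measure M A3 \<le> \<delta>"
      unfolding A2_def A3_def using mp_autD(2,4)[OF mp[OF u(1)] Q(4)] s Q(3) by auto
    have sub: "{x. J (c (\<alpha> (u s) x)) = J (c (\<alpha> (u s') x))} \<subseteq> ((A1 \<union> A2) \<union> A3) \<union> - free_part"
    proof
      fix x assume x: "x \<in> {x. J (c (\<alpha> (u s) x)) = J (c (\<alpha> (u s') x))}"
      show "x \<in> ((A1 \<union> A2) \<union> A3) \<union> - free_part"
      proof (rule ccontr)
        assume "\<not> ?thesis"
        then have n: "x \<notin> A1" "x \<notin> A2" "x \<notin> A3" "x \<in> free_part" by auto
        define b where "b = q (\<alpha> (u s) x)"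
        define b' where "b' = q (\<alpha> (u s') x)"
        have b: "b \<in> Q" "b' \<in> Q" using n by (auto simp: A2_def A3_def b_def b'_def)
        then have bc: "b \<in> carrier G" "b' \<in> carrier G" using Q(2) by auto
        have us: "u s \<in> carrier G" "u s' \<in> carrier G" using u(1) s by auto
        have "C s x = \<alpha> (m_inv G b \<otimes>\<^bsub>G\<^esub> u s) x" "C s' x = \<alpha> (m_inv G b' \<otimes>\<^bsub>G\<^esub> u s') x"
          using bc us by (simp_all add: C_def c_def b_def b'_def hom)
        moreover have "\<alpha> (m_inv G b \<otimes>\<^bsub>G\<^esub> u s) x \<noteq> \<alpha> (m_inv G b' \<otimes>\<^bsub>G\<^esub> u s') x"
          using u(2)[OF s b] bc us by (subst act_eq_iff[OF n(4)]) auto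
        ultimately show False using n(1) x by (auto simp: A1_def C_def)
      qed
    qed
    have "measure M {x. J (c (\<alpha> (u s) x)) = J (c (\<alpha> (u s') x))} \<le> measure M (((A1 \<union> A2) \<union> A3) \<union> - free_part)"
      using sub s1 s2 free_part(1) by (intro measure_mono_M sets.Un Compl_in_M)
    also have "\<dots> \<le> measure M ((A1 \<union> A2) \<union> A3) + measure M (- free_part)"
      using s1 s2 free_part(1) by (intro measure_Un_le sets.Un Compl_in_M)
    also have "measure M ((A1 \<union> A2) \<union> A3) \<le> measure M (A1 \<union> A2) + measure M A3"
      using s1 s2 by (intro measure_Un_le sets.Un)
    also have "measure M (A1 \<union> A2) \<le> measure M A1 + measure M A2"
      using s1 s2 by (intro measure_Un_le)
    finally show ?thesis using free_part(2) s2 JC[OF s(1,2)] by (simp add: A1_def)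
  qed
  \<comment> \<open>The label of x for sample w is read at the point of the \<beta>-orbit of w that
    has the same position as x in its cell. It has the distribution of P because \<beta> preserves
    the measure.\<close>
  define f where "f x w = P (\<beta> (q x) w)" for x w
  have fm: "(\<lambda>(x, w). f x w) \<in> M \<Otimes>\<^sub>M M \<rightarrow>\<^sub>M count_space UNIV"
  proof -
    have "(\<lambda>p. P (\<beta> g (snd p))) \<in> M \<Otimes>\<^sub>M M \<rightarrow>\<^sub>M count_space UNIV" if "g \<in> carrier G" for g
      using measurable_compose[OF measurable_compose[OF measurable_snd mp_aut_measurable[OF \<beta>.mp[OF that]]] P] .
    from measurable_compose_countable'[where f = "\<lambda>g p. P (\<beta> g (snd p))", OF this
        measurable_compose[OF measurable_fst q] countable_carrier]
    show ?thesis by (simp add: f_def split_beta')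
  qed
  have fp: "measure M {w. f x w = a} = measure M {x. P x = a}" for x a
  proof -
    have "{w. f x w = a} = \<beta> (q x) -` {x. P x = a}" by (auto simp: f_def)
    then show ?thesis using mp_autD(4)[OF \<beta>.mp[OF qc] sets_label_eq[OF P]] by simp
  qed
  have Jc: "(\<lambda>x. J (c x)) \<in> M \<rightarrow>\<^sub>M count_space UNIV" by (rule measurable_compose[OF cm J(1)])
  obtain w where w: "(\<lambda>x. f x (w (J (c x)))) \<in> M \<rightarrow>\<^sub>M count_space UNIV"
    "\<And>a z. a \<in> \<Lambda> \<Longrightarrow> z \<in> sets M \<Longrightarrow> (\<And>s. s < N \<Longrightarrow> \<alpha> (u s) -` z = z) \<Longrightarrow>
      \<bar>measure M ({x. f x (w (J (c x))) = a} \<inter> z) - measure M {x. P x = a} * measure M z\<bar> \<le>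
        sqrt (real (card (UNIV :: unit set)) * card \<Lambda> * (1 / real N + 3 * \<delta>))"
  proof (rule random_labelling[where I = "UNIV :: unit set" and \<Lambda> = \<Lambda> and N = N and u = "\<lambda>_ s. \<alpha> (u s)"
        and J = "\<lambda>x. J (c x)" and m = m and f = f and p = "\<lambda>a. measure M {x. P x = a}" and \<delta> = "3 * \<delta>"])
    show "finite \<Lambda>" "0 < N" "\<And>x. J (c x) < m" by (fact \<Lambda>(1) N0 J(2))+
    show "mp_aut M (\<alpha> (u s))" if "s < N" for s using mp u(1) that by blast
    show "0 \<le> 3 * \<delta>" using \<delta> by simp
  qed (use Jc fm fp coll that in auto)
  define L where "L x = f x (w (J (c x)))" for x
  show thesis
  proof
    show "L \<in> M \<rightarrow>\<^sub>M count_space UNIV" using w(1) by (simp add: L_def[abs_def])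
    show "L x \<in> \<Lambda>" for x using \<Lambda>(2) by (simp add: L_def f_def)
    fix a z assume a: "a \<in> \<Lambda>" and z: "z \<in> invariant_sets"
    have "z \<in> sets M" using z by (simp add: invariant_sets_def)
    moreover have "\<alpha> (u s) -` z = z" if "s < N" for s
      using z u(1)[OF that] by (auto simp: invariant_sets_def)
    ultimately show "\<bar>measure M ({x. L x = a} \<inter> z) - measure M {x. P x = a} * measure M z\<bar> \<le> d"
      using w(2)[OF a] small unfolding L_def by (meson order_trans)
  next
    fix g assume g: "g \<in> F"
    then have gc: "g \<in> carrier G" using F by auto
    define E where "E = {x. q (\<alpha> g x) \<noteq> g \<otimes>\<^bsub>G\<^esub> q x}"
    have "E \<in> sets M"
    proof -
      have s: "{x. q x = h} \<in> sets M" if "h \<in> carrier G" for h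
        using measurable_sets[OF q, of "{h}"] that by (simp add: vimage_def)
      have "- E = (\<Union>h\<in>carrier G. \<alpha> g -` {x. q x = g \<otimes>\<^bsub>G\<^esub> h} \<inter> {x. q x = h})"
        using qc by (auto simp: E_def)
      also have "\<dots> \<in> sets M"
      proof -
        have "\<alpha> g -` {x. q x = g \<otimes>\<^bsub>G\<^esub> h} \<inter> {x. q x = h} \<in> sets M" if "h \<in> carrier G" for h
          using gc that by (intro sets.Int s mp_autD(2)[OF mp[OF gc]]) simp_all
        then show ?thesis by (intro sets.countable_UN'[OF countable_carrier]) blast
      qed
      finally show ?thesis using Compl_in_M[of "- E"] by simp
    qed
    moreover have "measure M E \<le> \<eta>" using qF[OF g] by (simp add: E_def)
    moreover have "\<exists>y. L x = P y \<and> L (\<alpha> g x) = P (\<beta> g y)" if "x \<notin> E" for x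
    proof -
      \<comment> \<open>Where positions are equivariant, x and its image have the same centre and
        hence the same sample, so the two labels are read at points joined by
        \<open>\<beta> g\<close>.\<close>
      have e: "q (\<alpha> g x) = g \<otimes>\<^bsub>G\<^esub> q x" using that by (simp add: E_def)
      have "c (\<alpha> g x) = \<alpha> (m_inv G (g \<otimes>\<^bsub>G\<^esub> q x) \<otimes>\<^bsub>G\<^esub> g) x"
        using gc qc[of x] by (simp add: c_def e hom)
      also have "m_inv G (g \<otimes>\<^bsub>G\<^esub> q x) \<otimes>\<^bsub>G\<^esub> g = m_inv G (q x)"
        using gc qc[of x] by (simp add: inv_mult_group m_assoc)
      finally have "c (\<alpha> g x) = c x" by (simp add: c_def)
      then have "L (\<alpha> g x) = P (\<beta> g (\<beta> (q x) (w (J (c x)))))"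
        using gc qc[of x] by (simp add: L_def f_def e \<beta>.hom)
      then show ?thesis by (auto simp: L_def f_def)
    qed
    ultimately show "\<exists>E\<in>sets M. measure M E \<le> \<eta> \<and> (\<forall>x. x \<notin> E \<longrightarrow> (\<exists>y. L x = P y \<and> L (\<alpha> g x) = P (\<beta> g y)))"
      by blast
  qed
qed

text \<open>Here a point simply takes the P-label of its sample, with no cells and no orbit to
  follow. This leaves the labelling independent of any factor, so it can be tested along N distinct
  elements of each \<open>H i\<close> at once.\<close>

lemma common_labelling:
  fixes P :: "'a \<Rightarrow> 'l" and \<Lambda> :: "'l set" and H :: "'i \<Rightarrow> 'g set"
  assumes I: "finite I" "I \<noteq> {}" and H: "\<And>i. i \<in> I \<Longrightarrow> infinite (H i)" "\<And>i. i \<in> I \<Longrightarrow> H i \<subseteq> carrier G"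
    and \<Lambda>: "finite \<Lambda>" "\<And>x. P x \<in> \<Lambda>" and P: "P \<in> M \<rightarrow>\<^sub>M count_space UNIV" and d: "d > 0"
  obtains L where "L \<in> M \<rightarrow>\<^sub>M count_space UNIV" "\<And>x. L x \<in> \<Lambda>"
    "\<And>a i z. a \<in> \<Lambda> \<Longrightarrow> i \<in> I \<Longrightarrow> z \<in> sets M \<Longrightarrow> (\<And>g. g \<in> H i \<Longrightarrow> \<alpha> g -` z = z) \<Longrightarrow>
       \<bar>measure M ({x. L x = a} \<inter> z) - measure M {x. P x = a} * measure M z\<bar> \<le> d"
proof -
  have "\<forall>i\<in>I. \<exists>u :: nat \<Rightarrow> 'g. inj u \<and> range u \<subseteq> H i" using H(1) infinite_countable_subset by blast
  then obtain u :: "'i \<Rightarrow> nat \<Rightarrow> 'g" where u: "\<And>i. i \<in> I \<Longrightarrow> inj (u i)" "\<And>i s. i \<in> I \<Longrightarrow> u i s \<in> H i"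
    by (metis range_subsetD)
  have uc: "u i s \<in> carrier G" if "i \<in> I" for i s using u(2)[OF that] H(2)[OF that] by auto
  have \<Lambda>0: "card \<Lambda> > 0" using \<Lambda> card_gt_0_iff by blast
  have I0: "card I > 0" using I card_gt_0_iff by blast
  define K where "K = real (card I) * card \<Lambda>"
  have K: "K > 0" using \<Lambda>0 I0 by (simp add: K_def)
  \<comment> \<open>The translates of a free point are distinct, so collisions come only from the
    classes of J; \<open>K * \<delta>\<close> takes one half of \<open>d\<^sup>2\<close> and the
    choice of N the other.\<close>
  define \<delta> where "\<delta> = d\<^sup>2 / (2 * K)"
  have \<delta>: "\<delta> > 0" using d K by (simp add: \<delta>_def)
  obtain N :: nat where N: "2 * K / d\<^sup>2 < real N" using reals_Archimedean2 by blast
  have "0 \<le> 2 * K / d\<^sup>2" using K by simp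
  then have N0: "N > 0" using N by (cases N) auto
  have small: "sqrt (real (card I) * card \<Lambda> * (1 / real N + \<delta>)) \<le> d"
  proof -
    have "K * (1 / real N) \<le> d\<^sup>2 / 2" using N N0 d by (simp add: field_simps)
    moreover have "K * \<delta> = d\<^sup>2 / 2" using K by (simp add: \<delta>_def field_simps)
    ultimately have "K * (1 / real N + \<delta>) \<le> d\<^sup>2" unfolding distrib_left by linarith
    then have "sqrt (K * (1 / real N + \<delta>)) \<le> sqrt (d\<^sup>2)" by (rule real_sqrt_le_mono)
    then show ?thesis using d by (simp add: K_def)
  qed
  define Q where "Q = (\<lambda>(i, s, s'). (\<alpha> (u i s), \<alpha> (u i s'))) ` (I \<times> {..<N} \<times> {..<N})"
  have fin: "finite Q" using I by (simp add: Q_def)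
  have meas: "f \<in> M \<rightarrow>\<^sub>M M \<and> f' \<in> M \<rightarrow>\<^sub>M M" if "(f, f') \<in> Q" for f f'
    using that mp_aut_measurable[OF mp[OF uc]] by (auto simp: Q_def)
  obtain J :: "'a \<Rightarrow> nat" and m where J: "J \<in> M \<rightarrow>\<^sub>M count_space UNIV" "\<And>x. J x < m"
    and JQ: "\<And>f f'. (f, f') \<in> Q \<Longrightarrow> measure M {x. f x \<noteq> f' x \<and> J (f x) = J (f' x)} \<le> \<delta>"
    by (rule separating_partition[OF fin meas \<delta>], assumption, rule that, assumption, blast+)
  have coll: "measure M {x. J (\<alpha> (u i s) x) = J (\<alpha> (u i s') x)} \<le> \<delta>"
    if i: "i \<in> I" and s: "s < N" "s' < N" "s \<noteq> s'" for i s s'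
  proof -
    define A where "A = {x. \<alpha> (u i s) x \<noteq> \<alpha> (u i s') x \<and> J (\<alpha> (u i s) x) = J (\<alpha> (u i s') x)}"
    have A: "measure M A \<le> \<delta>" unfolding A_def by (rule JQ) (use i s in \<open>force simp: Q_def\<close>)
    have am: "\<alpha> (u i s) \<in> M \<rightarrow>\<^sub>M M" for s using mp_aut_measurable[OF mp[OF uc[OF i]]] .
    have "{x. J (\<alpha> (u i s) x) \<noteq> J (\<alpha> (u i s') x)} \<in> sets M"
      using J(2) by (intro sets_label_neq[of _ _ "{..<m}"] measurable_compose[OF am J(1)]) auto
    then have "{x. \<alpha> (u i s) x \<noteq> \<alpha> (u i s') x} - {x. J (\<alpha> (u i s) x) \<noteq> J (\<alpha> (u i s') x)} \<in> sets M"
      using sets_neq[OF am am] by (rule sets.Diff[rotated])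
    moreover have "A = {x. \<alpha> (u i s) x \<noteq> \<alpha> (u i s') x} - {x. J (\<alpha> (u i s) x) \<noteq> J (\<alpha> (u i s') x)}"
      by (auto simp: A_def)
    ultimately have As: "A \<in> sets M" by simp
    have "u i s \<noteq> u i s'" using u(1)[OF i] s by (auto dest: injD)
    then have "{x. J (\<alpha> (u i s) x) = J (\<alpha> (u i s') x)} \<subseteq> A \<union> - free_part"
      using act_eq_iff[OF _ uc[OF i] uc[OF i]] by (auto simp: A_def)
    then have "measure M {x. J (\<alpha> (u i s) x) = J (\<alpha> (u i s') x)} \<le> measure M (A \<union> - free_part)"
      using As free_part(1) by (intro measure_mono_M sets.Un Compl_in_M)
    also have "\<dots> = measure M A" using As free_part by (intro measure_zero_union) auto
    finally show ?thesis using A by simp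
  qed
  have fm: "(\<lambda>(x, w). P w) \<in> M \<Otimes>\<^sub>M M \<rightarrow>\<^sub>M count_space UNIV"
    using measurable_compose[OF measurable_snd P] by (simp add: split_beta')
  obtain w where w: "(\<lambda>x. P (w (J x))) \<in> M \<rightarrow>\<^sub>M count_space UNIV"
    "\<And>a i z. a \<in> \<Lambda> \<Longrightarrow> i \<in> I \<Longrightarrow> z \<in> sets M \<Longrightarrow> (\<And>s. s < N \<Longrightarrow> \<alpha> (u i s) -` z = z) \<Longrightarrow>
      \<bar>measure M ({x. P (w (J x)) = a} \<inter> z) - measure M {x. P x = a} * measure M z\<bar> \<le>
        sqrt (real (card I) * card \<Lambda> * (1 / real N + \<delta>))"
  proof (rule random_labelling[where I = I and \<Lambda> = \<Lambda> and N = N and u = "\<lambda>i s. \<alpha> (u i s)"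
        and J = J and m = m and f = "\<lambda>x w. P w" and p = "\<lambda>a. measure M {x. P x = a}" and \<delta> = \<delta>])
    show "mp_aut M (\<alpha> (u i s))" if "i \<in> I" for i s using mp uc that by blast
    show "0 \<le> \<delta>" using \<delta> by simp
  qed (use I \<Lambda> N0 J fm coll that in auto)
  show thesis
  proof
    show "(\<lambda>x. P (w (J x))) \<in> M \<rightarrow>\<^sub>M count_space UNIV" by (rule w(1))
    show "P (w (J x)) \<in> \<Lambda>" for x by (rule \<Lambda>(2))
    fix a i z assume a: "a \<in> \<Lambda>" "i \<in> I" "z \<in> sets M" "\<And>g. g \<in> H i \<Longrightarrow> \<alpha> g -` z = z"
    show "\<bar>measure M ({x. P (w (J x)) = a} \<inter> z) - measure M {x. P x = a} * measure M z\<bar> \<le> d"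
      using w(2)[OF a(1-3)] a(4) u(2)[OF a(2)] small by (meson order_trans)
  qed
qed

end

section \<open>Conjugates of a free action that approximate another action\<close>

lemma sym_diff_image: "inj f \<Longrightarrow> sym_diff (f ` A) (f ` B) = f ` sym_diff A B"
  by (simp add: sym_diff_def image_Un image_set_diff)

context std_space
begin

lemma sets_sym_diff: "A \<in> sets M \<Longrightarrow> B \<in> sets M \<Longrightarrow> sym_diff A B \<in> sets M"
  by (auto simp: sym_diff_def)

lemma measure_sym_diff_triangle:
  assumes "A \<in> sets M" "B \<in> sets M" "C \<in> sets M"
  shows "measure M (sym_diff A C) \<le> measure M (sym_diff A B) + measure M (sym_diff B C)"
proof -
  have "measure M (sym_diff A C) \<le> measure M (sym_diff A B \<union> sym_diff B C)"
    using assms by (intro measure_mono_M sets.Un sets_sym_diff) (auto simp: sym_diff_def)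
  also have "\<dots> \<le> measure M (sym_diff A B) + measure M (sym_diff B C)"
    using assms by (intro measure_Un_le sets_sym_diff)
  finally show ?thesis .
qed

lemma measure_sym_diff_image:
  assumes "mp_aut M f" "A \<in> sets M" "B \<in> sets M"
  shows "measure M (sym_diff (f ` A) (f ` B)) = measure M (sym_diff A B)"
  using mp_autD(1,5)[OF assms(1)] sets_sym_diff[OF assms(2,3)] by (simp add: sym_diff_image bij_is_inj)

lemma measure_sym_diff_AE:
  assumes f: "mp_aut M f" "mp_aut M f'" and AE: "AE x in M. f x = f' x" and A: "A \<in> sets M"
  shows "measure M (sym_diff (f ` A) (f' ` A)) = 0"
proof -
  define N where "N = {x. f x \<noteq> f' x}"
  have N: "N \<in> sets M" unfolding N_def by (rule sets_neq[OF mp_aut_measurable[OF f(1)] mp_aut_measurable[OF f(2)]])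
  have "AE x in M. x \<in> - N" using AE by (simp add: N_def)
  then have mN: "measure M N = 0" using AE_iff_measure_compl[OF Compl_in_M[OF N]] by simp
  have "sym_diff (f ` A) (f' ` A) \<subseteq> f ` N \<union> f' ` N" by (force simp: sym_diff_def N_def image_iff)
  then have "measure M (sym_diff (f ` A) (f' ` A)) \<le> measure M (f ` N \<union> f' ` N)"
    using mp_autD(3)[OF f(1) N] mp_autD(3)[OF f(2) N] by (intro measure_mono_M) auto
  also have "\<dots> \<le> measure M (f ` N) + measure M (f' ` N)"
    using mp_autD(3)[OF f(1) N] mp_autD(3)[OF f(2) N] by (intro measure_Un_le)
  finally show ?thesis using mp_autD(5)[OF f(1) N] mp_autD(5)[OF f(2) N] mN by (simp add: measure_le_0_iff)
qed

end

context free_haction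
begin

lemma subgroup_action:
  assumes "subgroup K G" shows "free_haction M (G\<lparr>carrier := K\<rparr>) \<alpha>"
proof -
  interpret K: group "G\<lparr>carrier := K\<rparr>" using assms by (rule subgroup.subgroup_is_group) (rule is_group)
  have KG: "K \<subseteq> carrier G" using assms by (rule subgroup.subset)
  show ?thesis
  proof unfold_locales
    show "countable (carrier (G\<lparr>carrier := K\<rparr>))" using countable_carrier KG by (auto intro: countable_subset)
    show "AE x in M. \<forall>g\<in>carrier (G\<lparr>carrier := K\<rparr>). g \<noteq> \<one>\<^bsub>G\<lparr>carrier := K\<rparr>\<^esub> \<longrightarrow> \<alpha> g x \<noteq> x"
      using free_AE by eventually_elim (use KG in auto)
  qed (use mp hom subsetD[OF KG] in simp_all)
qed

text \<open>Off a small set P composed with R and S is \<open>L'\<close>, and \<open>L'\<close>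
  reads P along \<beta>-orbits. Hence the conjugate of \<open>\<alpha> h\<close> moves P-names as
  \<open>\<beta> h\<close> does, and the names decide membership in both A and its image under
  \<open>\<beta> h\<close>.\<close>

lemma conjugate_approximation:
  fixes H :: "'i \<Rightarrow> 'g set"
  assumes atomless: "atomless M" and \<beta>: "haction M G \<beta>" and I: "finite I" "I \<noteq> {}"
    and H: "\<And>i. i \<in> I \<Longrightarrow> subgroup (H i) G" "\<And>i. i \<in> I \<Longrightarrow> comm_group (G\<lparr>carrier := H i\<rparr>)"
      "\<And>i. i \<in> I \<Longrightarrow> infinite (H i)"
    and \<A>: "finite \<A>" "\<A> \<subseteq> sets M" and F: "finite F" "F \<subseteq> carrier G" and \<eta>: "\<eta> > 0"
  obtains R S where "mp_aut M R" "\<And>i. i \<in> I \<Longrightarrow> mp_aut M (S i)" "\<And>i x. i \<in> I \<Longrightarrow> \<exists>g\<in>H i. S i x = \<alpha> g x"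
    "\<And>i h A. i \<in> I \<Longrightarrow> h \<in> F \<Longrightarrow> h \<in> H i \<Longrightarrow> A \<in> \<A> \<Longrightarrow>
      measure M (sym_diff ((\<lambda>x. R (S i (\<alpha> h (inv_into UNIV (\<lambda>x. R (S i x)) x)))) ` A) (\<beta> h ` A)) < \<eta>"
proof -
  interpret \<beta>: haction M G \<beta> by (rule \<beta>)
  \<comment> \<open>The images under F are included because the comparison asks at one point about A
    and at the next about its \<beta>-image.\<close>
  define \<Q> where "\<Q> = \<A> \<union> (\<lambda>(h, A). \<beta> h ` A) ` (F \<times> \<A>)"
  have \<Q>: "finite \<Q>" using \<A> F by (simp add: \<Q>_def)
  have \<Q>s: "B \<in> sets M" if "B \<in> \<Q>" for B
    using that \<A> F mp_autD(3)[OF \<beta>.mp] by (auto simp: \<Q>_def)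
  \<comment> \<open>The name of x in the partition generated by these sets.\<close>
  define P where "P x = {B \<in> \<Q>. x \<in> B}" for x
  define \<Lambda> where "\<Lambda> = Pow \<Q>"
  have \<Lambda>: "finite \<Lambda>" "P x \<in> \<Lambda>" for x using \<Q> by (auto simp: \<Lambda>_def P_def)
  have Pm: "P \<in> M \<rightarrow>\<^sub>M count_space UNIV"
  proof -
    have "P \<in> M \<rightarrow>\<^sub>M count_space \<Lambda>"
    proof (subst measurable_count_space_eq2[OF \<Lambda>(1)], intro conjI ballI)
      fix a assume a: "a \<in> \<Lambda>"
      have "P -` {a} \<inter> space M = (\<Inter>B\<in>\<Q>. {x. x \<in> B \<longleftrightarrow> B \<in> a})"
      proof -
        have "P x = a \<longleftrightarrow> (\<forall>B\<in>\<Q>. x \<in> B \<longleftrightarrow> B \<in> a)" for x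
          using a unfolding P_def \<Lambda>_def by blast
        then show ?thesis by simp blast
      qed
      also have "\<dots> \<in> sets M"
      proof -
        have "{x. x \<in> B \<longleftrightarrow> B \<in> a} \<in> sets M" if "B \<in> \<Q>" for B
          using \<Q>s[OF that] Compl_in_M[OF \<Q>s[OF that]] by (cases "B \<in> a") (auto simp: Compl_eq)
        then have "(\<Union>B\<in>\<Q>. - {x. x \<in> B \<longleftrightarrow> B \<in> a}) \<in> sets M"
          using \<Q> by (intro sets.finite_UN Compl_in_M)
        then have "- (\<Union>B\<in>\<Q>. - {x. x \<in> B \<longleftrightarrow> B \<in> a}) \<in> sets M" by (rule Compl_in_M)
        then show ?thesis by (simp add: Compl_UN)
      qed
      finally show "P -` {a} \<inter> space M \<in> sets M" .
    qed (use \<Lambda>(2) in auto)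
    from measurable_compose[OF this, of "\<lambda>x. x" "count_space UNIV"] show ?thesis by simp
  qed
  have \<Lambda>0: "card \<Lambda> > 0" using \<Lambda> card_gt_0_iff by blast
  \<comment> \<open>Matching P with L costs \<open>card \<Lambda> * d\<close> and matching L with
    \<open>L'\<close> twice that; 12 makes the sum \<eta>/4.\<close>
  define d where "d = \<eta> / (12 * card \<Lambda>)"
  have d: "d > 0" using \<eta> \<Lambda>0 by (simp add: d_def)
  have HG: "H i \<subseteq> carrier G" if "i \<in> I" for i using subgroup.subset[OF H(1)[OF that]] .
  obtain L where L: "L \<in> M \<rightarrow>\<^sub>M count_space UNIV" "\<And>x. L x \<in> \<Lambda>"
    "\<And>a i z. a \<in> \<Lambda> \<Longrightarrow> i \<in> I \<Longrightarrow> z \<in> sets M \<Longrightarrow> (\<And>g. g \<in> H i \<Longrightarrow> \<alpha> g -` z = z) \<Longrightarrow>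
       \<bar>measure M ({x. L x = a} \<inter> z) - measure M {x. P x = a} * measure M z\<bar> \<le> d"
  proof (rule common_labelling[where I = I and H = H and \<Lambda> = \<Lambda> and P = P and d = d, OF I H(3) HG \<Lambda> Pm d])
    fix L assume L: "L \<in> M \<rightarrow>\<^sub>M count_space UNIV" "\<And>x. L x \<in> \<Lambda>"
      "\<And>a i z. a \<in> \<Lambda> \<Longrightarrow> i \<in> I \<Longrightarrow> z \<in> sets M \<Longrightarrow> (\<And>g. g \<in> H i \<Longrightarrow> \<alpha> g -` z = z) \<Longrightarrow>
         \<bar>measure M ({x. L x = a} \<inter> z) - measure M {x. P x = a} * measure M z\<bar> \<le> d"
    show thesis by (rule that[of L]; fact L)
  qed
  obtain i0 where i0: "i0 \<in> I" using I by auto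
  have Us: "UNIV \<in> sets M" using sets.top[of M] by simp
  \<comment> \<open>The whole space is an invariant set, which gives the unconditional
    distribution.\<close>
  have close0: "\<bar>measure M {x. P x = a} - measure M {x. L x = a}\<bar> \<le> d" if "a \<in> \<Lambda>" for a
    using L(3)[OF that i0 Us] by (simp add: abs_minus_commute)
  obtain R where R: "mp_aut M R" "measure M {x. P (R x) \<noteq> L x} \<le> card \<Lambda> * d"
    by (rule label_matching_global[where L = P and L' = L and \<Lambda> = \<Lambda> and d = d, OF atomless \<Lambda> L(2)
          sets_label_eq[OF Pm] sets_label_eq[OF L(1)] close0 that])
  have "\<exists>S. mp_aut M S \<and> (\<forall>x. \<exists>g\<in>H i. S x = \<alpha> g x) \<and> (\<forall>h\<in>F. h \<in> H i \<longrightarrow> (\<forall>A\<in>\<A>.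
      measure M (sym_diff ((\<lambda>x. R (S (\<alpha> h (inv_into UNIV (\<lambda>x. R (S x)) x)))) ` A) (\<beta> h ` A)) < \<eta>))"
    if i: "i \<in> I" for i
  proof -
    interpret K: free_haction M "G\<lparr>carrier := H i\<rparr>" \<alpha> by (rule subgroup_action[OF H(1)[OF i]])
    have K\<beta>: "haction M (G\<lparr>carrier := H i\<rparr>) \<beta>"
      by unfold_locales (use \<beta>.mp \<beta>.hom subsetD[OF HG[OF i]] in simp_all)
    obtain L' where L': "L' \<in> M \<rightarrow>\<^sub>M count_space UNIV" "\<And>x. L' x \<in> \<Lambda>"
      "\<And>a z. a \<in> \<Lambda> \<Longrightarrow> z \<in> K.invariant_sets \<Longrightarrow>
         \<bar>measure M ({x. L' x = a} \<inter> z) - measure M {x. P x = a} * measure M z\<bar> \<le> d"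
      "\<And>g. g \<in> F \<inter> H i \<Longrightarrow> \<exists>E\<in>sets M. measure M E \<le> \<eta> / 4 \<and>
         (\<forall>x. x \<notin> E \<longrightarrow> (\<exists>y. L' x = P y \<and> L' (\<alpha> g x) = P (\<beta> g y)))"
    proof (rule K.equidistributed_simulation[where F = "F \<inter> H i" and \<eta> = "\<eta> / 4", OF H(2)[OF i] _ K\<beta> \<Lambda> Pm _ _ d])
      show "infinite (carrier (G\<lparr>carrier := H i\<rparr>))" using H(3)[OF i] by simp
    qed (use F \<eta> that in auto)
    \<comment> \<open>Both labellings are within d of the same product of measures on each invariant
      set, so the exact distribution on z cancels.\<close>
    have close: "\<bar>measure M ({x. L x = a} \<inter> z) - measure M ({x. L' x = a} \<inter> z)\<bar> \<le> 2 * d"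
      if a: "a \<in> \<Lambda>" and z: "z \<in> K.invariant_sets" for a z
    proof -
      have "z \<in> sets M" "\<And>g. g \<in> H i \<Longrightarrow> \<alpha> g -` z = z" using z by (auto simp: K.invariant_sets_def)
      then have "\<bar>measure M ({x. L x = a} \<inter> z) - measure M {x. P x = a} * measure M z\<bar> \<le> d"
        using L(3)[OF a i] by blast
      then show ?thesis using L'(3)[OF a z] by linarith
    qed
    obtain S where S: "mp_aut M S" "\<And>x. \<exists>g\<in>H i. S x = \<alpha> g x" "measure M {x. L (S x) \<noteq> L' x} \<le> card \<Lambda> * (2 * d)"
    proof (rule K.label_matching_orbit[where L = L and L' = L' and \<Lambda> = \<Lambda> and d = "2 * d", OF K.countable_carrier \<Lambda>(1) L(2) L'(2)
          sets_label_eq[OF L(1)] sets_label_eq[OF L'(1)] close])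
      fix S assume "mp_aut M S" "\<And>x. \<exists>g\<in>carrier (G\<lparr>carrier := H i\<rparr>). S x = \<alpha> g x"
        "measure M {x. L (S x) \<noteq> L' x} \<le> card \<Lambda> * (2 * d)"
      then show thesis using that[of S] by simp
    qed
    define T where "T x = R (S x)" for x
    have T: "mp_aut M T" unfolding T_def by (rule mp_aut_comp[OF R(1) S(1)])
    note bT = mp_autD(1)[OF T]
    define B1 where "B1 = {x. P (T x) \<noteq> L' x}"
    have B1: "B1 \<in> sets M" unfolding B1_def
      by (rule sets_label_neq[OF measurable_compose[OF mp_aut_measurable[OF T] Pm] L'(1) \<Lambda>])
    have mB1: "measure M B1 \<le> \<eta> / 4"
    proof -
      have s1: "{x. P (R x) \<noteq> L x} \<in> sets M"
        by (rule sets_label_neq[OF measurable_compose[OF mp_aut_measurable[OF R(1)] Pm] L(1) \<Lambda>])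
      have s2: "{x. L (S x) \<noteq> L' x} \<in> sets M"
        by (rule sets_label_neq[OF measurable_compose[OF mp_aut_measurable[OF S(1)] L(1)] L'(1) \<Lambda>(1) L(2)])
      have "measure M B1 \<le> measure M (S -` {x. P (R x) \<noteq> L x} \<union> {x. L (S x) \<noteq> L' x})"
        using s2 mp_autD(2)[OF S(1) s1] by (intro measure_mono_M) (auto simp: B1_def T_def)
      also have "\<dots> \<le> measure M (S -` {x. P (R x) \<noteq> L x}) + measure M {x. L (S x) \<noteq> L' x}"
        using s2 mp_autD(2)[OF S(1) s1] by (intro measure_Un_le)
      also have "\<dots> \<le> card \<Lambda> * d + card \<Lambda> * (2 * d)" unfolding mp_autD(4)[OF S(1) s1] by (intro add_mono R(2) S(3))
      also have "\<dots> = \<eta> / 4" using \<Lambda>0 by (simp add: d_def field_simps)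
      finally show ?thesis .
    qed
    have "measure M (sym_diff ((\<lambda>x. T (\<alpha> h (inv_into UNIV T x))) ` A) (\<beta> h ` A)) < \<eta>"
      if h: "h \<in> F" "h \<in> H i" and A: "A \<in> \<A>" for h A
    proof -
      have hc: "h \<in> carrier G" using h F by auto
      obtain E where E: "E \<in> sets M" "measure M E \<le> \<eta> / 4"
        "\<And>x. x \<notin> E \<Longrightarrow> \<exists>y. L' x = P y \<and> L' (\<alpha> h x) = P (\<beta> h y)"
        using L'(4)[of h] h by blast
      have AQ: "A \<in> \<Q>" "\<beta> h ` A \<in> \<Q>" using A h by (auto simp: \<Q>_def)
      have PA: "x \<in> B \<longleftrightarrow> y \<in> B" if "P x = P y" "B \<in> \<Q>" for x y B using that by (auto simp: P_def)
      \<comment> \<open>The labels must be right at x and at \<open>\<alpha> h x\<close>, and the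
        simulation at x. Each failure costs at most \<eta>/4, three quarters of \<eta> in
        all.\<close>
      define W where "W = (B1 \<union> E) \<union> \<alpha> h -` B1"
      have Ws: "W \<in> sets M" unfolding W_def using B1 E(1) mp_autD(2)[OF mp[OF hc] B1] by auto
      have good: "T x \<in> A \<longleftrightarrow> T (\<alpha> h x) \<in> \<beta> h ` A" if "x \<notin> W" for x
      proof -
        obtain y where y: "L' x = P y" "L' (\<alpha> h x) = P (\<beta> h y)" using E(3)[of x] \<open>x \<notin> W\<close> by (auto simp: W_def)
        have "P (T x) = P y" "P (T (\<alpha> h x)) = P (\<beta> h y)" using \<open>x \<notin> W\<close> y by (auto simp: W_def B1_def)
        then have "T x \<in> A \<longleftrightarrow> y \<in> A" "T (\<alpha> h x) \<in> \<beta> h ` A \<longleftrightarrow> \<beta> h y \<in> \<beta> h ` A"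
          using PA AQ by blast+
        then show ?thesis using mp_autD(1)[OF \<beta>.mp[OF hc]] by (simp add: bij_is_inj inj_image_mem_iff)
      qed
      define T' where "T' x = T (\<alpha> h x)" for x
      have T': "mp_aut M T'" unfolding T'_def by (rule mp_aut_comp[OF T mp[OF hc]])
      have "sym_diff ((\<lambda>x. T (\<alpha> h (inv_into UNIV T x))) ` A) (\<beta> h ` A) \<subseteq> T' ` W"
      proof
        fix z assume z: "z \<in> sym_diff ((\<lambda>x. T (\<alpha> h (inv_into UNIV T x))) ` A) (\<beta> h ` A)"
        \<comment> \<open>Parametrising by \<open>T'\<close> puts the question at x: z lies in the
          conjugated image of A exactly when \<open>T x\<close> lies in A.\<close>
        obtain x where x: "z = T' x" using mp_autD(1)[OF T'] by (metis bij_is_surj surjD)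
        have "z \<in> (\<lambda>x. T (\<alpha> h (inv_into UNIV T x))) ` A \<longleftrightarrow> T x \<in> A"
        proof
          assume "z \<in> (\<lambda>x. T (\<alpha> h (inv_into UNIV T x))) ` A"
          then obtain a where a: "a \<in> A" "T' x = T' (inv_into UNIV T a)" by (auto simp: x T'_def)
          then have "x = inv_into UNIV T a" using mp_autD(1)[OF T'] by (simp add: bij_is_inj inj_eq)
          then show "T x \<in> A" using a bT by (simp add: bij_is_surj surj_f_inv_f)
        next
          assume "T x \<in> A"
          moreover have "z = T (\<alpha> h (inv_into UNIV T (T x)))" using bT by (simp add: x T'_def bij_is_inj)
          ultimately show "z \<in> (\<lambda>x. T (\<alpha> h (inv_into UNIV T x))) ` A" by blast
        qed
        then have "x \<in> W" using z good[of x] by (auto simp: sym_diff_def x T'_def)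
        then show "z \<in> T' ` W" using x by blast
      qed
      then have "measure M (sym_diff ((\<lambda>x. T (\<alpha> h (inv_into UNIV T x))) ` A) (\<beta> h ` A)) \<le> measure M (T' ` W)"
        using mp_autD(3)[OF T' Ws] by (rule measure_mono_M)
      also have "\<dots> = measure M W" by (rule mp_autD(5)[OF T' Ws])
      also have "\<dots> \<le> measure M (B1 \<union> E) + measure M (\<alpha> h -` B1)"
        unfolding W_def using B1 E(1) mp_autD(2)[OF mp[OF hc] B1] by (intro measure_Un_le) auto
      also have "\<dots> \<le> measure M B1 + measure M E + measure M (\<alpha> h -` B1)"
        using measure_Un_le[OF B1 E(1)] by simp
      also have "\<dots> < \<eta>" using mp_autD(4)[OF mp[OF hc] B1] mB1 E(2) \<eta> by simp
      finally show ?thesis .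
    qed
    then show ?thesis unfolding T_def using S by blast
  qed
  then obtain S where S: "\<And>i. i \<in> I \<Longrightarrow> mp_aut M (S i)" "\<And>i x. i \<in> I \<Longrightarrow> \<exists>g\<in>H i. S i x = \<alpha> g x"
    "\<And>i h A. i \<in> I \<Longrightarrow> h \<in> F \<Longrightarrow> h \<in> H i \<Longrightarrow> A \<in> \<A> \<Longrightarrow>
      measure M (sym_diff ((\<lambda>x. R (S i (\<alpha> h (inv_into UNIV (\<lambda>x. R (S i x)) x)))) ` A) (\<beta> h ` A)) < \<eta>"
    by metis
  show thesis using that[OF R(1) S] by blast
qed

end

section \<open>Free products and the weak topology\<close>

lemma free_product_word:
  assumes "is_free_product G I H" "g \<in> carrier G"
  obtains ws where "\<forall>(i, h)\<in>set ws. i \<in> I \<and> h \<in> H i" "g = word_prod G ws"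
proof -
  obtain ws where "ws \<in> {ws. reduced_word G I H ws}" "word_prod G ws = g"
    using assms unfolding is_free_product_def bij_betw_def by (metis imageE)
  then show thesis by (intro that[of ws]) (auto simp: reduced_word_def)
qed

lemma free_product_countable:
  assumes fp: "is_free_product G I H" and c: "countable I" "\<And>i. i \<in> I \<Longrightarrow> countable (H i)"
  shows "countable (carrier G)"
proof -
  have "countable (SIGMA i:I. H i)" using c by (rule countable_SIGMA)
  then have "countable (word_prod G ` lists (SIGMA i:I. H i))" by (intro countable_image countable_lists)
  moreover have "carrier G \<subseteq> word_prod G ` lists (SIGMA i:I. H i)"
  proof
    fix g assume "g \<in> carrier G"
    then obtain ws where "\<forall>(i, h)\<in>set ws. i \<in> I \<and> h \<in> H i" "g = word_prod G ws"
      using free_product_word[OF fp] by blast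
    then show "g \<in> word_prod G ` lists (SIGMA i:I. H i)" by (intro image_eqI[of _ _ ws]) auto
  qed
  ultimately show ?thesis by (rule countable_subset[rotated])
qed

text \<open>The universal property of the free product by van der Waerden's argument: let a group
  element act by its reduced word, and verify that left multiplication by a letter acts as that
  letter.\<close>

lemma free_product_extension:
  fixes \<gamma> :: "nat \<Rightarrow> 'g \<Rightarrow> 'a \<Rightarrow> 'a"
  assumes fp: "is_free_product G I H"
    and one: "\<And>i x. i \<in> I \<Longrightarrow> \<gamma> i \<one>\<^bsub>G\<^esub> x = x"
    and mult: "\<And>i h h' x. i \<in> I \<Longrightarrow> h \<in> H i \<Longrightarrow> h' \<in> H i \<Longrightarrow> \<gamma> i (h \<otimes>\<^bsub>G\<^esub> h') x = \<gamma> i h (\<gamma> i h' x)"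
  obtains \<Gamma> where "\<And>g g' x. g \<in> carrier G \<Longrightarrow> g' \<in> carrier G \<Longrightarrow> \<Gamma> (g \<otimes>\<^bsub>G\<^esub> g') x = \<Gamma> g (\<Gamma> g' x)"
    "\<And>i h x. i \<in> I \<Longrightarrow> h \<in> H i \<Longrightarrow> \<Gamma> h x = \<gamma> i h x"
proof -
  have G: "group G" and sub: "\<And>i. i \<in> I \<Longrightarrow> subgroup (H i) G"
    and bij: "bij_betw (word_prod G) {ws. reduced_word G I H ws} (carrier G)"
    using fp by (auto simp: is_free_product_def)
  interpret group G by (rule G)
  have HG: "h \<in> carrier G" if "i \<in> I" "h \<in> H i" for i h using subgroup.subset[OF sub[OF that(1)]] that(2) by auto
  have wp: "word_prod G [] = \<one>\<^bsub>G\<^esub>" "word_prod G ((i, h) # ws) = h \<otimes>\<^bsub>G\<^esub> word_prod G ws" for i h ws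
    by (simp_all add: word_prod_def)
  have closed: "word_prod G ws \<in> carrier G" if "\<forall>(i, h)\<in>set ws. i \<in> I \<and> h \<in> H i" for ws
    using that by (induction ws) (auto simp: wp HG)
  define nf where "nf = inv_into {ws. reduced_word G I H ws} (word_prod G)"
  have nf1: "nf (word_prod G ws) = ws" if "reduced_word G I H ws" for ws
    unfolding nf_def using bij that by (intro inv_into_f_f) (auto simp: bij_betw_def)
  have nf2: "reduced_word G I H (nf g)" "word_prod G (nf g) = g" if "g \<in> carrier G" for g
  proof -
    have m: "g \<in> word_prod G ` {ws. reduced_word G I H ws}" using bij that by (simp add: bij_betw_def)
    show "reduced_word G I H (nf g)" "word_prod G (nf g) = g"
      unfolding nf_def using inv_into_into[OF m] f_inv_into_f[OF m] by simp_all
  qed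
  define act where "act ws x = foldr (\<lambda>(i, h) y. \<gamma> i h y) ws x" for ws x
  have act: "act [] x = x" "act ((i, h) # ws) x = \<gamma> i h (act ws x)" for i h ws x by (simp_all add: act_def)
  have redI: "reduced_word G I H ((i, h) # ws)"
    if "i \<in> I" "h \<in> H i" "h \<noteq> \<one>\<^bsub>G\<^esub>" "reduced_word G I H ws" "ws = [] \<or> fst (hd ws) \<noteq> i" for i h ws
    using that by (cases ws) (auto simp: reduced_word_def)
  have redT: "reduced_word G I H ws" "i \<in> I" "h \<in> H i" "ws = [] \<or> fst (hd ws) \<noteq> i"
    if "reduced_word G I H ((i, h) # ws)" for i h ws
    using that by (cases ws; auto simp: reduced_word_def)+
  define \<Gamma> where "\<Gamma> g = act (nf g)" for g
  \<comment> \<open>A letter h of factor i changes a reduced word in one of three ways: it is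
    prepended, it merges with a first letter of the same factor, or it cancels that letter. The last
    two are governed by \<open>mult\<close> and \<open>one\<close>.\<close>
  have step: "\<Gamma> (h \<otimes>\<^bsub>G\<^esub> g) x = \<gamma> i h (\<Gamma> g x)" if i: "i \<in> I" and h: "h \<in> H i" and g: "g \<in> carrier G" for i h g x
  proof (cases "h = \<one>\<^bsub>G\<^esub>")
    case True
    then show ?thesis using one[OF i] g by simp
  next
    case h1: False
    define ws where "ws = nf g"
    have ws: "reduced_word G I H ws" "word_prod G ws = g" using nf2[OF g] by (simp_all add: ws_def)
    show ?thesis
    proof (cases "ws = [] \<or> fst (hd ws) \<noteq> i")
      case True
      then have "reduced_word G I H ((i, h) # ws)" using redI i h h1 ws by blast
      then have "nf (h \<otimes>\<^bsub>G\<^esub> g) = (i, h) # ws" using nf1[of "(i, h) # ws"] ws by (simp add: wp)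
      then show ?thesis by (simp add: \<Gamma>_def act ws_def[symmetric])
    next
      case False
      then obtain h' ws' where w: "ws = (i, h') # ws'" by (cases ws) auto
      note r = redT[OF ws(1)[unfolded w]]
      have cl: "word_prod G ws' \<in> carrier G" using r(1) by (intro closed) (auto simp: reduced_word_def)
      have e: "h \<otimes>\<^bsub>G\<^esub> g = (h \<otimes>\<^bsub>G\<^esub> h') \<otimes>\<^bsub>G\<^esub> word_prod G ws'"
        using ws(2) m_assoc[OF HG[OF i h] HG[OF i r(3)] cl] by (simp add: w wp)
      have a: "\<gamma> i h (\<Gamma> g x) = \<gamma> i (h \<otimes>\<^bsub>G\<^esub> h') (act ws' x)"
        using mult[OF i h r(3)] by (simp add: \<Gamma>_def ws_def[symmetric] w act)
      show ?thesis
      proof (cases "h \<otimes>\<^bsub>G\<^esub> h' = \<one>\<^bsub>G\<^esub>")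
        case True
        then have "nf (h \<otimes>\<^bsub>G\<^esub> g) = ws'" using e cl nf1[OF r(1)] by simp
        then show ?thesis using a True one[OF i] by (simp add: \<Gamma>_def)
      next
        case False
        have "h \<otimes>\<^bsub>G\<^esub> h' \<in> H i" using subgroup.m_closed[OF sub[OF i] h r(3)] .
        then have "reduced_word G I H ((i, h \<otimes>\<^bsub>G\<^esub> h') # ws')" using redI[OF i _ False r(1) r(4)] by blast
        from nf1[OF this] have "nf (h \<otimes>\<^bsub>G\<^esub> g) = (i, h \<otimes>\<^bsub>G\<^esub> h') # ws'" by (simp add: wp e)
        then show ?thesis using a by (simp add: \<Gamma>_def act)
      qed
    qed
  qed
  have word: "\<Gamma> (word_prod G ws \<otimes>\<^bsub>G\<^esub> g) x = act ws (\<Gamma> g x)"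
    if "\<forall>(i, h)\<in>set ws. i \<in> I \<and> h \<in> H i" "g \<in> carrier G" for ws g x
    using that
  proof (induction ws)
    case (Cons p ws)
    obtain i h where p: "p = (i, h)" by (cases p)
    have i: "i \<in> I" "h \<in> H i" using Cons.prems by (auto simp: p)
    have cl: "word_prod G ws \<in> carrier G" using Cons.prems by (intro closed) auto
    have "word_prod G (p # ws) \<otimes>\<^bsub>G\<^esub> g = h \<otimes>\<^bsub>G\<^esub> (word_prod G ws \<otimes>\<^bsub>G\<^esub> g)"
      using cl HG[OF i] Cons.prems(2) by (simp add: p wp m_assoc)
    then show ?case using step[OF i, of "word_prod G ws \<otimes>\<^bsub>G\<^esub> g"] cl Cons by (simp add: p act)
  qed (simp add: wp act)
  have "reduced_word G I H []" by (simp add: reduced_word_def)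
  then have "nf \<one>\<^bsub>G\<^esub> = []" using nf1[of "[]"] by (simp add: wp)
  then have \<Gamma>1: "\<Gamma> \<one>\<^bsub>G\<^esub> x = x" for x by (simp add: \<Gamma>_def act)
  show thesis
  proof
    fix g g' x assume g: "g \<in> carrier G" "g' \<in> carrier G"
    have "\<forall>(i, h)\<in>set (nf g). i \<in> I \<and> h \<in> H i" using nf2(1)[OF g(1)] by (auto simp: reduced_word_def)
    from word[OF this g(2)] show "\<Gamma> (g \<otimes>\<^bsub>G\<^esub> g') x = \<Gamma> g (\<Gamma> g' x)"
      using nf2(2)[OF g(1)] by (simp add: \<Gamma>_def)
  next
    fix i h x assume "i \<in> I" "h \<in> H i"
    then show "\<Gamma> h x = \<gamma> i h x" using step[of i h "\<one>\<^bsub>G\<^esub>" x] HG \<Gamma>1 by simp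
  qed
qed

section \<open>Actions at every point, approximation along words, density and orbits\<close>

context std_space
begin

text \<open>On the conull invariant set \<open>Y\<close> the action identities hold at every point of the orbit.\<close>

lemma actions_everywhere:
  fixes G :: "('g, 'b) monoid_scheme"
  assumes G: "group G" and c: "countable (carrier G)" and \<alpha>: "\<alpha> \<in> actions G M"
  obtains \<alpha>' where "haction M G \<alpha>'" "AE x in M. \<forall>g\<in>carrier G. \<alpha>' g x = \<alpha> g x"
proof -
  interpret group G by (rule G)
  have mp: "mp_aut M (\<alpha> g)" if "g \<in> carrier G" for g using \<alpha> that by (simp add: actions_def)
  have ae: "AE x in M. \<alpha> (g \<otimes>\<^bsub>G\<^esub> h) x = \<alpha> g (\<alpha> h x)" if "g \<in> carrier G" "h \<in> carrier G" for g h
    using \<alpha> that by (simp add: actions_def)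
  define X where "X = {x. \<forall>g\<in>carrier G. \<forall>h\<in>carrier G. \<alpha> (g \<otimes>\<^bsub>G\<^esub> h) x = \<alpha> g (\<alpha> h x)}"
  define Y where "Y = {x \<in> X. \<forall>g\<in>carrier G. \<alpha> g x \<in> X}"
  have Xs: "X \<in> sets M"
  proof -
    have "{x. \<alpha> (g \<otimes>\<^bsub>G\<^esub> h) x \<noteq> \<alpha> g (\<alpha> h x)} \<in> sets M" if "g \<in> carrier G" "h \<in> carrier G" for g h
      by (rule sets_neq[OF mp_aut_measurable[OF mp] mp_aut_measurable[OF mp_aut_comp[OF mp mp]]])
        (use that in simp_all)
    then have "- (\<Union>g\<in>carrier G. \<Union>h\<in>carrier G. {x. \<alpha> (g \<otimes>\<^bsub>G\<^esub> h) x \<noteq> \<alpha> g (\<alpha> h x)}) \<in> sets M"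
      by (intro Compl_in_M sets.countable_UN'[OF c] image_subsetI)
    moreover have "X = - (\<Union>g\<in>carrier G. \<Union>h\<in>carrier G. {x. \<alpha> (g \<otimes>\<^bsub>G\<^esub> h) x \<noteq> \<alpha> g (\<alpha> h x)})"
      by (auto simp: X_def)
    ultimately show ?thesis by simp
  qed
  have Ys: "Y \<in> sets M"
  proof -
    have "- \<alpha> g -` X \<in> sets M" if "g \<in> carrier G" for g using mp_autD(2)[OF mp[OF that] Xs] by auto
    then have "X - (\<Union>g\<in>carrier G. - \<alpha> g -` X) \<in> sets M"
      by (intro sets.Diff Xs sets.countable_UN'[OF c] image_subsetI)
    moreover have "Y = X - (\<Union>g\<in>carrier G. - \<alpha> g -` X)" by (auto simp: Y_def)
    ultimately show ?thesis by simp
  qed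
  have aX: "AE x in M. x \<in> X" unfolding X_def using ae by (simp add: AE_ball_countable[OF c])
  then have "AE x in M. \<forall>g\<in>carrier G. \<alpha> g x \<in> X"
    unfolding AE_ball_countable[OF c] using AE_mp_aut[OF mp] by blast
  with aX have aY: "AE x in M. x \<in> Y" unfolding Y_def by eventually_elim simp
  have YY: "\<alpha> h x \<in> Y" if x: "x \<in> Y" and h: "h \<in> carrier G" for h x
  proof -
    have "\<alpha> g (\<alpha> h x) \<in> X" if "g \<in> carrier G" for g
    proof -
      have "\<alpha> (g \<otimes>\<^bsub>G\<^esub> h) x = \<alpha> g (\<alpha> h x)" using x h that by (auto simp: Y_def X_def)
      moreover have "\<alpha> (g \<otimes>\<^bsub>G\<^esub> h) x \<in> X" using x h that by (auto simp: Y_def)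
      ultimately show ?thesis by simp
    qed
    then show ?thesis using x h by (auto simp: Y_def)
  qed
  \<comment> \<open>Off Y every element acts as the identity map, so the homomorphism identity holds
    there too and the two parts do not mix.\<close>
  define \<alpha>' where "\<alpha>' g x = (if x \<in> Y then \<alpha> g x else x)" for g x
  have hom: "\<alpha>' (g \<otimes>\<^bsub>G\<^esub> h) x = \<alpha>' g (\<alpha>' h x)" if "g \<in> carrier G" "h \<in> carrier G" for g h x
  proof (cases "x \<in> Y")
    case True
    then have "\<alpha> (g \<otimes>\<^bsub>G\<^esub> h) x = \<alpha> g (\<alpha> h x)" using that by (auto simp: Y_def X_def)
    then show ?thesis using True YY[OF True that(2)] by (simp add: \<alpha>'_def)
  qed (simp add: \<alpha>'_def)
  have one: "\<alpha>' \<one>\<^bsub>G\<^esub> x = x" for x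
  proof (cases "x \<in> Y")
    case True
    then have "\<alpha> (\<one>\<^bsub>G\<^esub> \<otimes>\<^bsub>G\<^esub> \<one>\<^bsub>G\<^esub>) x = \<alpha> \<one>\<^bsub>G\<^esub> (\<alpha> \<one>\<^bsub>G\<^esub> x)"
      using one_closed unfolding Y_def X_def by blast
    \<comment> \<open>An injective map that is idempotent at x fixes x.\<close>
    then have "\<alpha> \<one>\<^bsub>G\<^esub> (\<alpha> \<one>\<^bsub>G\<^esub> x) = \<alpha> \<one>\<^bsub>G\<^esub> x" by simp
    then show ?thesis using mp_autD(1)[OF mp[OF one_closed]] True by (simp add: \<alpha>'_def bij_is_inj inj_eq)
  qed (simp add: \<alpha>'_def)
  have inv1: "\<alpha>' (m_inv G g) (\<alpha>' g x) = x" "\<alpha>' g (\<alpha>' (m_inv G g) x) = x" if "g \<in> carrier G" for g x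
    using hom[of "m_inv G g" g x] hom[of g "m_inv G g" x] that one by simp_all
  have vim: "\<alpha>' g -` C \<in> sets M \<and> measure M (\<alpha>' g -` C) = measure M C" if g: "g \<in> carrier G" and C: "C \<in> sets M" for g C
  proof -
    have "\<alpha>' g -` C = (Y \<inter> \<alpha> g -` C) \<union> (C - Y)" by (auto simp: \<alpha>'_def split: if_splits)
    then have s: "\<alpha>' g -` C \<in> sets M" using Ys C mp_autD(2)[OF mp[OF g] C] by auto
    have "AE x in M. x \<in> \<alpha>' g -` C \<longleftrightarrow> x \<in> \<alpha> g -` C" using aY by eventually_elim (simp add: \<alpha>'_def)
    then have "measure M (\<alpha>' g -` C) = measure M (\<alpha> g -` C)"
      using s mp_autD(2)[OF mp[OF g] C] by (rule finite_measure_eq_AE)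
    then show ?thesis using s mp_autD(4)[OF mp[OF g] C] by simp
  qed
  have im: "\<alpha>' g ` C = \<alpha>' (m_inv G g) -` C" if "g \<in> carrier G" for g C
  proof (intro equalityI subsetI)
    fix y assume "y \<in> \<alpha>' g ` C" then show "y \<in> \<alpha>' (m_inv G g) -` C" using inv1(1)[OF that] by auto
  next
    fix y assume "y \<in> \<alpha>' (m_inv G g) -` C"
    then show "y \<in> \<alpha>' g ` C" using inv1(2)[OF that, of y] by (intro image_eqI[of _ _ "\<alpha>' (m_inv G g) y"]) simp_all
  qed
  have mp': "mp_aut M (\<alpha>' g)" if g: "g \<in> carrier G" for g
  proof (rule mp_autI)
    show "bij (\<alpha>' g)" by (rule o_bij[of "\<alpha>' (m_inv G g)"]) (auto simp: fun_eq_iff inv1[OF g])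
  qed (use vim[OF g] vim[of "m_inv G g"] g in \<open>auto simp: im\<close>)
  have "haction M G \<alpha>'" using mp' hom by unfold_locales
  moreover have "AE x in M. \<forall>g\<in>carrier G. \<alpha>' g x = \<alpha> g x" using aY by eventually_elim (simp add: \<alpha>'_def)
  ultimately show thesis using that by blast
qed

text \<open>Peel off the first letter: \<open>\<Gamma> h\<close> preserves the distance already
  incurred, and exchanging \<open>\<Gamma> h\<close> for \<open>\<beta> h\<close> costs one more
  \<eta>. The exchange is made on the image of A under \<beta> of the remaining suffix, so these
  images are the sets to be controlled.\<close>

lemma word_approximation:
  fixes G :: "('g, 'b) monoid_scheme" and H :: "nat \<Rightarrow> 'g set" and \<eta> :: real
  assumes \<Gamma>: "haction M G \<Gamma>" and \<beta>: "haction M G \<beta>" and H: "\<And>i. i \<in> I \<Longrightarrow> H i \<subseteq> carrier G" and A: "A \<in> sets M"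
    and ws: "\<forall>(i, h)\<in>set ws. i \<in> I \<and> h \<in> H i"
    and letter: "\<And>us i h vs. ws = us @ (i, h) # vs \<Longrightarrow>
      measure M (sym_diff (\<Gamma> h ` (\<beta> (word_prod G vs) ` A)) (\<beta> h ` (\<beta> (word_prod G vs) ` A))) \<le> \<eta>"
  shows "measure M (sym_diff (\<Gamma> (word_prod G ws) ` A) (\<beta> (word_prod G ws) ` A)) \<le> length ws * \<eta>"
  using ws letter
proof (induction ws)
  case Nil
  interpret \<Gamma>: haction M G \<Gamma> by (rule \<Gamma>)
  interpret \<beta>: haction M G \<beta> by (rule \<beta>)
  show ?case by (simp add: word_prod_def sym_diff_def)
next
  case (Cons p ws)
  interpret \<Gamma>: haction M G \<Gamma> by (rule \<Gamma>)
  interpret \<beta>: haction M G \<beta> by (rule \<beta>)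
  obtain i h where p: "p = (i, h)" by (cases p)
  have ih: "i \<in> I" "h \<in> H i" and h: "h \<in> carrier G" using Cons.prems(1) H by (auto simp: p)
  have "word_prod G us \<in> carrier G" if "\<forall>(i, h)\<in>set us. i \<in> I \<and> h \<in> H i" for us
    using that by (induction us) (use H in \<open>auto simp: word_prod_def\<close>)
  then have v: "word_prod G ws \<in> carrier G" using Cons.prems(1) by auto
  define v where "v = word_prod G ws"
  have e: "word_prod G (p # ws) = h \<otimes>\<^bsub>G\<^esub> v" by (simp add: word_prod_def p v_def)
  have im: "\<Gamma> (h \<otimes>\<^bsub>G\<^esub> v) ` A = \<Gamma> h ` (\<Gamma> v ` A)" "\<beta> (h \<otimes>\<^bsub>G\<^esub> v) ` A = \<beta> h ` (\<beta> v ` A)"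
    using \<Gamma>.hom[OF h v] \<beta>.hom[OF h v] by (simp_all add: image_image v_def)
  have sA: "\<Gamma> v ` A \<in> sets M" "\<beta> v ` A \<in> sets M"
    using mp_autD(3)[OF \<Gamma>.mp[OF v] A] mp_autD(3)[OF \<beta>.mp[OF v] A] by (simp_all add: v_def)
  note s = sA mp_autD(3)[OF \<Gamma>.mp[OF h]] mp_autD(3)[OF \<beta>.mp[OF h]]
  have "measure M (sym_diff (\<Gamma> h ` (\<Gamma> v ` A)) (\<beta> h ` (\<beta> v ` A))) \<le>
      measure M (sym_diff (\<Gamma> h ` (\<Gamma> v ` A)) (\<Gamma> h ` (\<beta> v ` A))) + measure M (sym_diff (\<Gamma> h ` (\<beta> v ` A)) (\<beta> h ` (\<beta> v ` A)))"
    using s by (intro measure_sym_diff_triangle) auto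
  also have "measure M (sym_diff (\<Gamma> h ` (\<Gamma> v ` A)) (\<Gamma> h ` (\<beta> v ` A))) = measure M (sym_diff (\<Gamma> v ` A) (\<beta> v ` A))"
    using s by (intro measure_sym_diff_image \<Gamma>.mp[OF h]) auto
  also have "measure M (sym_diff (\<Gamma> v ` A) (\<beta> v ` A)) \<le> length ws * \<eta>"
    unfolding v_def
  proof (rule Cons.IH)
    show "\<forall>(i, h)\<in>set ws. i \<in> I \<and> h \<in> H i" using Cons.prems(1) by auto
    show "measure M (sym_diff (\<Gamma> h ` (\<beta> (word_prod G vs) ` A)) (\<beta> h ` (\<beta> (word_prod G vs) ` A))) \<le> \<eta>"
      if "ws = us @ (i, h) # vs" for us i h vs using Cons.prems(2)[of "p # us" i h vs] that by simp
  qed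
  also have "measure M (sym_diff (\<Gamma> h ` (\<beta> v ` A)) (\<beta> h ` (\<beta> v ` A))) \<le> \<eta>"
    using Cons.prems(2)[of "[]" i h ws] by (simp add: p v_def)
  finally show ?case unfolding e im by (simp add: algebra_simps)
qed

text \<open>The subbasic sets are centred at arbitrary automorphisms T, whereas the approximation is
  centred at \<beta>; the triangle inequality turns one kind of neighbourhood into the
  other.\<close>

lemma weak_dense:
  fixes G :: "('g, 'b) monoid_scheme"
  assumes C: "C \<subseteq> actions G M"
    and dense: "\<And>\<beta> F \<A> \<epsilon>. \<beta> \<in> actions G M \<Longrightarrow> F \<subseteq> carrier G \<Longrightarrow> finite F \<Longrightarrow> finite \<A> \<Longrightarrow> \<A> \<subseteq> sets M \<Longrightarrow> \<epsilon> > 0 \<Longrightarrow>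
      \<exists>\<gamma>\<in>C. \<forall>A\<in>\<A>. \<forall>g\<in>F. measure M (sym_diff (\<gamma> g ` A) (\<beta> g ` A)) < \<epsilon>"
  shows "weak_topology G M closure_of C = actions G M"
proof -
  define \<S> where "\<S> = {actions G M} \<union> {{\<gamma> \<in> actions G M. measure M (sym_diff (\<gamma> g ` A) (T ` A)) < e} | g T A e.
            g \<in> carrier G \<and> mp_aut M T \<and> A \<in> sets M \<and> 0 < e}"
  have W: "weak_topology G M = subtopology (topology_generated_by \<S>) (actions G M)"
    by (simp add: weak_topology_def \<S>_def)
  have top: "topspace (weak_topology G M) = actions G M" by (auto simp: W \<S>_def)
  have mp: "mp_aut M (\<gamma> g)" if "\<gamma> \<in> actions G M" "g \<in> carrier G" for \<gamma> g using that by (simp add: actions_def)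
  \<comment> \<open>By induction on the generation of open sets: finite intersections unite the data
    and take the smaller error.\<close>
  have nbhd: "\<exists>F \<A> e. F \<subseteq> carrier G \<and> finite F \<and> finite \<A> \<and> \<A> \<subseteq> sets M \<and> e > 0 \<and>
      (\<forall>\<gamma>\<in>actions G M. (\<forall>A\<in>\<A>. \<forall>g\<in>F. measure M (sym_diff (\<gamma> g ` A) (\<beta> g ` A)) < e) \<longrightarrow> \<gamma> \<in> U)"
    if "generate_topology_on \<S> U" "\<beta> \<in> U" "\<beta> \<in> actions G M" for U \<beta>
    using that
  proof (induction U rule: generate_topology_on.induct)
    case (Int U V)
    then have b: "\<beta> \<in> U" "\<beta> \<in> V" by auto
    from Int.IH(1)[OF b(1) Int.prems(2)] obtain F \<A> e where
      1: "F \<subseteq> carrier G" "finite F" "finite \<A>" "\<A> \<subseteq> sets M" "e > 0"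
        "\<forall>\<gamma>\<in>actions G M. (\<forall>A\<in>\<A>. \<forall>g\<in>F. measure M (sym_diff (\<gamma> g ` A) (\<beta> g ` A)) < e) \<longrightarrow> \<gamma> \<in> U"
      by (elim exE conjE) (rule that)
    from Int.IH(2)[OF b(2) Int.prems(2)] obtain F' \<A>' e' where
      2: "F' \<subseteq> carrier G" "finite F'" "finite \<A>'" "\<A>' \<subseteq> sets M" "e' > 0"
        "\<forall>\<gamma>\<in>actions G M. (\<forall>A\<in>\<A>'. \<forall>g\<in>F'. measure M (sym_diff (\<gamma> g ` A) (\<beta> g ` A)) < e') \<longrightarrow> \<gamma> \<in> V"
      by (elim exE conjE) (rule that)
    show ?case
    proof (intro exI[of _ "F \<union> F'"] exI[of _ "\<A> \<union> \<A>'"] exI[of _ "min e e'"] conjI ballI impI)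
      fix \<gamma> assume g: "\<gamma> \<in> actions G M"
        and a: "\<forall>A\<in>\<A> \<union> \<A>'. \<forall>g\<in>F \<union> F'. measure M (sym_diff (\<gamma> g ` A) (\<beta> g ` A)) < min e e'"
      have "\<gamma> \<in> U" using 1(6) g a by simp
      moreover have "\<gamma> \<in> V" using 2(6) g a by simp
      ultimately show "\<gamma> \<in> U \<inter> V" by simp
    qed (use 1 2 in auto)
  next
    case (UN K)
    then obtain U where U: "U \<in> K" "\<beta> \<in> U" by auto
    from UN.IH[OF U UN.prems(2)] obtain F \<A> e where
      1: "F \<subseteq> carrier G" "finite F" "finite \<A>" "\<A> \<subseteq> sets M" "e > 0"
        "\<forall>\<gamma>\<in>actions G M. (\<forall>A\<in>\<A>. \<forall>g\<in>F. measure M (sym_diff (\<gamma> g ` A) (\<beta> g ` A)) < e) \<longrightarrow> \<gamma> \<in> U"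
      by (elim exE conjE) (rule that)
    show ?case
    proof (intro exI[of _ F] exI[of _ \<A>] exI[of _ e] conjI 1 ballI impI)
      fix \<gamma> assume "\<gamma> \<in> actions G M" "\<forall>A\<in>\<A>. \<forall>g\<in>F. measure M (sym_diff (\<gamma> g ` A) (\<beta> g ` A)) < e"
      then have "\<gamma> \<in> U" using 1(6) by blast
      then show "\<gamma> \<in> \<Union> K" using U(1) by blast
    qed
  next
    case (Basis U)
    then consider "U = actions G M" | g T A e where "U = {\<gamma> \<in> actions G M. measure M (sym_diff (\<gamma> g ` A) (T ` A)) < e}"
        "g \<in> carrier G" "mp_aut M T" "A \<in> sets M" "0 < e"
      unfolding \<S>_def by blast
    then show ?case
    proof cases
      case 1
      then show ?thesis by (intro exI[of _ "{}"] exI[of _ "1::real"]) auto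
    next
      case 2
      \<comment> \<open>The slack that \<beta> leaves in the subbasic condition, available for the
        distance from \<gamma> to \<beta>.\<close>
      define e' where "e' = e - measure M (sym_diff (\<beta> g ` A) (T ` A))"
      have e': "e' > 0" using Basis.prems(1) by (simp add: e'_def 2(1))
      have "\<gamma> \<in> U" if \<gamma>: "\<gamma> \<in> actions G M" "measure M (sym_diff (\<gamma> g ` A) (\<beta> g ` A)) < e'" for \<gamma>
      proof -
        have "measure M (sym_diff (\<gamma> g ` A) (T ` A)) \<le> measure M (sym_diff (\<gamma> g ` A) (\<beta> g ` A)) + measure M (sym_diff (\<beta> g ` A) (T ` A))"
          by (intro measure_sym_diff_triangle mp_autD(3)[OF mp[OF \<gamma>(1) 2(2)] 2(4)]
              mp_autD(3)[OF mp[OF Basis.prems(2) 2(2)] 2(4)] mp_autD(3)[OF 2(3,4)])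
        then show ?thesis using \<gamma> by (simp add: 2(1) e'_def)
      qed
      then show ?thesis using e' 2(2,4)
        by (intro exI[of _ "{g}"] exI[of _ "{A}"] exI[of _ e']) auto
    qed
  qed simp
  show ?thesis
  proof
    show "weak_topology G M closure_of C \<subseteq> actions G M" using closure_of_subset_topspace[of "weak_topology G M" C] top by simp
    show "actions G M \<subseteq> weak_topology G M closure_of C"
    proof
      fix \<beta> assume \<beta>: "\<beta> \<in> actions G M"
      show "\<beta> \<in> weak_topology G M closure_of C"
        unfolding in_closure_of top
      proof (intro conjI \<beta> allI impI)
        fix V assume V: "\<beta> \<in> V \<and> openin (weak_topology G M) V"
        then obtain U where U: "openin (topology_generated_by \<S>) U" "V = U \<inter> actions G M"
          unfolding W openin_subtopology by blast
        then have "generate_topology_on \<S> U" by (simp add: openin_topology_generated_by_iff)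
        moreover have "\<beta> \<in> U" using V U by simp
        ultimately have "\<exists>F \<A> e. F \<subseteq> carrier G \<and> finite F \<and> finite \<A> \<and> \<A> \<subseteq> sets M \<and> e > 0 \<and>
          (\<forall>\<gamma>\<in>actions G M. (\<forall>A\<in>\<A>. \<forall>g\<in>F. measure M (sym_diff (\<gamma> g ` A) (\<beta> g ` A)) < e) \<longrightarrow> \<gamma> \<in> U)"
          using \<beta> by (rule nbhd)
        then obtain F \<A> e where
          1: "F \<subseteq> carrier G" "finite F" "finite \<A>" "\<A> \<subseteq> sets M" "e > 0"
            "\<forall>\<gamma>\<in>actions G M. (\<forall>A\<in>\<A>. \<forall>g\<in>F. measure M (sym_diff (\<gamma> g ` A) (\<beta> g ` A)) < e) \<longrightarrow> \<gamma> \<in> U"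
          by (elim exE conjE) (rule that)
        from dense[OF \<beta> 1(1-5)] obtain \<gamma> where \<gamma>: "\<gamma> \<in> C"
          "\<forall>A\<in>\<A>. \<forall>g\<in>F. measure M (sym_diff (\<gamma> g ` A) (\<beta> g ` A)) < e" by blast
        then have "\<gamma> \<in> V" using 1(6) C U(2) by blast
        then show "\<exists>y. y \<in> C \<and> y \<in> V" using \<gamma>(1) by blast
      qed
    qed
  qed
qed

text \<open>As \<open>S i\<close> moves points inside their \<open>H i\<close>-orbits, a letter of
  \<Gamma> takes \<open>R p\<close> to R of a point in the \<alpha>-orbit of p. Conversely each step
  of \<alpha> by a letter is a step of \<Gamma> by a letter of the same factor, chosen according to
  the point. Words reduce the comparison of orbits to these steps.\<close>

lemma orbit_conjugate:
  fixes G :: "('g, 'b) monoid_scheme"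
  assumes \<alpha>: "haction M G \<alpha>" and \<Gamma>: "haction M G \<Gamma>" and fp: "is_free_product G I H" and R: "mp_aut M R"
    and S: "\<And>i. i \<in> I \<Longrightarrow> mp_aut M (S i)" "\<And>i x. i \<in> I \<Longrightarrow> \<exists>g\<in>H i. S i x = \<alpha> g x"
    and conj: "\<And>i h x. i \<in> I \<Longrightarrow> h \<in> H i \<Longrightarrow> \<Gamma> h x = R (S i (\<alpha> h (inv_into UNIV (\<lambda>x. R (S i x)) x)))"
  shows "orbit G \<Gamma> y = R ` orbit G \<alpha> (inv_into UNIV R y)"
proof -
  interpret \<alpha>: haction M G \<alpha> by (rule \<alpha>)
  interpret \<Gamma>: haction M G \<Gamma> by (rule \<Gamma>)
  have sub: "subgroup (H i) G" if "i \<in> I" for i using fp that by (simp add: is_free_product_def)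
  have HG: "h \<in> carrier G" if "i \<in> I" "h \<in> H i" for i h using subgroup.subset[OF sub[OF that(1)]] that(2) by auto
  note bR = mp_autD(1)[OF R]
  have Ri: "R (inv_into UNIV R x) = x" "inv_into UNIV R (R x) = x" for x
    using bR by (simp_all add: bij_is_surj surj_f_inv_f bij_is_inj)
  have Si: "\<exists>k\<in>H i. inv_into UNIV (S i) x = \<alpha> k x" if i: "i \<in> I" for i x
  proof -
    define x' where "x' = inv_into UNIV (S i) x"
    have x: "S i x' = x" using mp_autD(1)[OF S(1)[OF i]] by (simp add: x'_def bij_is_surj surj_f_inv_f)
    obtain g where g: "g \<in> H i" "S i x' = \<alpha> g x'" using S(2)[OF i] by blast
    have "x' = \<alpha> (m_inv G g) x" using g x \<alpha>.act_inv(1)[OF HG[OF i g(1)], of x'] by simp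
    then show ?thesis using subgroup.m_inv_closed[OF sub[OF i] g(1)] by (auto simp: x'_def)
  qed
  have conj': "\<Gamma> h (R p) = R (S i (\<alpha> h (inv_into UNIV (S i) p)))" if i: "i \<in> I" and h: "h \<in> H i" for i h p
  proof -
    have "inv_into UNIV (\<lambda>x. R (S i x)) (R p) = inv_into UNIV (S i) p"
    proof (rule inv_f_eq)
      show "inj (\<lambda>x. R (S i x))" using mp_autD(1)[OF mp_aut_comp[OF R S(1)[OF i]]] by (rule bij_is_inj)
      show "R (S i (inv_into UNIV (S i) p)) = R p"
        using mp_autD(1)[OF S(1)[OF i]] by (simp add: bij_is_surj surj_f_inv_f)
    qed
    then show ?thesis using conj[OF i h] by simp
  qed
  have wp: "word_prod G [] = \<one>\<^bsub>G\<^esub>" "word_prod G ((i, h) # ws) = h \<otimes>\<^bsub>G\<^esub> word_prod G ws" for i h ws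
    by (simp_all add: word_prod_def)
  have closed: "word_prod G ws \<in> carrier G" if "\<forall>(i, h)\<in>set ws. i \<in> I \<and> h \<in> H i" for ws
    using that by (induction ws) (auto simp: wp HG)
  define u where "u = inv_into UNIV R y"
  have y: "y = R u" by (simp add: u_def Ri)
  have 1: "\<exists>g\<in>carrier G. \<Gamma> (word_prod G ws) y = R (\<alpha> g u)"
    if "\<forall>(i, h)\<in>set ws. i \<in> I \<and> h \<in> H i" for ws
    using that
  proof (induction ws)
    case Nil
    show ?case by (intro bexI[of _ "\<one>\<^bsub>G\<^esub>"]) (simp_all add: wp y)
  next
    case (Cons p ws)
    obtain i h where p: "p = (i, h)" by (cases p)
    have i: "i \<in> I" "h \<in> H i" and ws: "\<forall>(i, h)\<in>set ws. i \<in> I \<and> h \<in> H i" using Cons.prems by (auto simp: p)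
    obtain g where g: "g \<in> carrier G" "\<Gamma> (word_prod G ws) y = R (\<alpha> g u)" using Cons.IH[OF ws] by blast
    obtain k where k: "k \<in> H i" "inv_into UNIV (S i) (\<alpha> g u) = \<alpha> k (\<alpha> g u)" using Si[OF i(1)] by blast
    obtain l where l: "l \<in> H i" "S i (\<alpha> h (\<alpha> k (\<alpha> g u))) = \<alpha> l (\<alpha> h (\<alpha> k (\<alpha> g u)))" using S(2)[OF i(1)] by blast
    note c = HG[OF i] HG[OF i(1) k(1)] HG[OF i(1) l(1)] g(1)
    have "\<Gamma> (word_prod G (p # ws)) y = \<Gamma> h (R (\<alpha> g u))"
      using \<Gamma>.hom[OF c(1) closed[OF ws]] g(2) by (simp add: p wp)
    also have "\<dots> = R (\<alpha> (l \<otimes>\<^bsub>G\<^esub> (h \<otimes>\<^bsub>G\<^esub> (k \<otimes>\<^bsub>G\<^esub> g))) u)"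
      using c by (simp add: conj'[OF i] k(2) l(2) \<alpha>.hom)
    finally show ?case using c by (intro bexI[of _ "l \<otimes>\<^bsub>G\<^esub> (h \<otimes>\<^bsub>G\<^esub> (k \<otimes>\<^bsub>G\<^esub> g))"]) simp_all
  qed
  have 2: "\<exists>g\<in>carrier G. R (\<alpha> (word_prod G ws) u) = \<Gamma> g y"
    if "\<forall>(i, h)\<in>set ws. i \<in> I \<and> h \<in> H i" for ws
    using that
  proof (induction ws)
    case Nil
    show ?case by (intro bexI[of _ "\<one>\<^bsub>G\<^esub>"]) (simp_all add: wp y)
  next
    case (Cons p ws)
    obtain i h where p: "p = (i, h)" by (cases p)
    have i: "i \<in> I" "h \<in> H i" and ws: "\<forall>(i, h)\<in>set ws. i \<in> I \<and> h \<in> H i" using Cons.prems by (auto simp: p)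
    obtain g where g: "g \<in> carrier G" "R (\<alpha> (word_prod G ws) u) = \<Gamma> g y" using Cons.IH[OF ws] by blast
    define q where "q = \<alpha> (word_prod G ws) u"
    obtain k where k: "k \<in> H i" "inv_into UNIV (S i) q = \<alpha> k q" using Si[OF i(1)] by blast
    obtain l where l: "l \<in> H i" "inv_into UNIV (S i) (\<alpha> h q) = \<alpha> l (\<alpha> h q)" using Si[OF i(1)] by blast
    note c = HG[OF i] HG[OF i(1) k(1)] HG[OF i(1) l(1)] g(1)
    \<comment> \<open>k and l express the inverse of \<open>S i\<close> at q and at
      \<open>\<alpha> h q\<close>. This letter joins the two inverse images, so its conjugate by
      \<open>S i\<close> takes q to \<open>\<alpha> h q\<close>.\<close>
    define h' where "h' = l \<otimes>\<^bsub>G\<^esub> (h \<otimes>\<^bsub>G\<^esub> m_inv G k)"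
    have h': "h' \<in> H i" unfolding h'_def
      by (intro subgroup.m_closed[OF sub[OF i(1)]] subgroup.m_inv_closed[OF sub[OF i(1)]] k l i)
    have "\<alpha> h' (\<alpha> k q) = \<alpha> l (\<alpha> h q)" using c by (simp add: h'_def \<alpha>.hom)
    then have "S i (\<alpha> h' (\<alpha> k q)) = S i (inv_into UNIV (S i) (\<alpha> h q))" by (simp add: l(2))
    also have "\<dots> = \<alpha> h q" using mp_autD(1)[OF S(1)[OF i(1)]] by (simp add: bij_is_surj surj_f_inv_f)
    finally have "\<Gamma> h' (R q) = R (\<alpha> h q)" by (simp add: conj'[OF i(1) h'] k(2))
    moreover have "\<alpha> (word_prod G (p # ws)) u = \<alpha> h q"
      using \<alpha>.hom[OF c(1) closed[OF ws]] by (simp add: p wp q_def)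
    ultimately have "R (\<alpha> (word_prod G (p # ws)) u) = \<Gamma> (h' \<otimes>\<^bsub>G\<^esub> g) y"
      using \<Gamma>.hom[OF HG[OF i(1) h'] g(1)] g(2) by (simp add: q_def)
    then show ?case using HG[OF i(1) h'] g(1) by blast
  qed
  show ?thesis
  proof (intro equalityI subsetI)
    fix z assume "z \<in> orbit G \<Gamma> y"
    then obtain g where g: "g \<in> carrier G" "z = \<Gamma> g y" by (auto simp: orbit_def)
    obtain ws where "\<forall>(i, h)\<in>set ws. i \<in> I \<and> h \<in> H i" "g = word_prod G ws" by (rule free_product_word[OF fp g(1)])
    then show "z \<in> R ` orbit G \<alpha> (inv_into UNIV R y)" using 1[of ws] g(2) by (auto simp: orbit_def u_def)
  next
    fix z assume "z \<in> R ` orbit G \<alpha> (inv_into UNIV R y)"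
    then obtain g where g: "g \<in> carrier G" "z = R (\<alpha> g u)" by (auto simp: orbit_def u_def)
    obtain ws where "\<forall>(i, h)\<in>set ws. i \<in> I \<and> h \<in> H i" "g = word_prod G ws" by (rule free_product_word[OF fp g(1)])
    then show "z \<in> orbit G \<Gamma> y" using 2[of ws] g(2) by (auto simp: orbit_def)
  qed
qed

text \<open>Each element of F is spelled as a word, the letters are approximated factor by factor,
  and the conjugated factors are reassembled by the universal property. Both given actions are first
  replaced by versions valid at every point.\<close>

lemma OE_class_approximation:
  fixes G :: "('g, 'b) monoid_scheme" and H :: "nat \<Rightarrow> 'g set"
  assumes k: "k \<ge> 1" and fp: "is_free_product G {1..k} H"
    and H: "\<forall>i\<in>{1..k}. comm_group (G\<lparr>carrier := H i\<rparr>) \<and> countable (H i) \<and> infinite (H i)"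
    and atomless: "atomless M" and \<alpha>: "\<alpha> \<in> free_actions G M" and \<beta>: "\<beta> \<in> actions G M"
    and F: "F \<subseteq> carrier G" "finite F" and \<A>: "finite \<A>" "\<A> \<subseteq> sets M" and \<epsilon>: "\<epsilon> > 0"
  shows "\<exists>\<gamma>\<in>OE_class G M \<alpha>. \<forall>A\<in>\<A>. \<forall>g\<in>F. measure M (sym_diff (\<gamma> g ` A) (\<beta> g ` A)) < \<epsilon>"
proof -
  have G: "group G" and sub: "\<And>i. i \<in> {1..k} \<Longrightarrow> subgroup (H i) G"
    using fp by (simp_all add: is_free_product_def)
  have c: "countable (carrier G)" by (rule free_product_countable[OF fp]) (use H in blast)+
  have HG: "H i \<subseteq> carrier G" if "i \<in> {1..k}" for i using subgroup.subset[OF sub[OF that]] .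
  have \<alpha>a: "\<alpha> \<in> actions G M" using \<alpha> by (simp add: free_actions_def)
  obtain \<alpha>' where \<alpha>': "haction M G \<alpha>'" "AE x in M. \<forall>g\<in>carrier G. \<alpha>' g x = \<alpha> g x"
    by (rule actions_everywhere[OF G c \<alpha>a])
  obtain \<beta>' where \<beta>': "haction M G \<beta>'" "AE x in M. \<forall>g\<in>carrier G. \<beta>' g x = \<beta> g x"
    by (rule actions_everywhere[OF G c \<beta>])
  interpret \<beta>': haction M G \<beta>' by (rule \<beta>'(1))
  have "AE x in M. \<forall>g\<in>carrier G. g \<noteq> \<one>\<^bsub>G\<^esub> \<longrightarrow> \<alpha> g x \<noteq> x" using \<alpha> by (simp add: free_actions_def)
  with \<alpha>'(2) have "AE x in M. \<forall>g\<in>carrier G. g \<noteq> \<one>\<^bsub>G\<^esub> \<longrightarrow> \<alpha>' g x \<noteq> x" by eventually_elim simp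
  then interpret \<alpha>': free_haction M G \<alpha>'
    using \<alpha>'(1) c by (simp add: free_haction_def free_haction_axioms_def)
  have "\<forall>g\<in>F. \<exists>ws. (\<forall>(i, h)\<in>set ws. i \<in> {1..k} \<and> h \<in> H i) \<and> g = word_prod G ws"
  proof
    fix g assume "g \<in> F"
    then have g: "g \<in> carrier G" using F(1) by auto
    show "\<exists>ws. (\<forall>(i, h)\<in>set ws. i \<in> {1..k} \<and> h \<in> H i) \<and> g = word_prod G ws"
      by (rule free_product_word[OF fp g]) (intro exI conjI)
  qed
  from bchoice[OF this] obtain w where
    w0: "\<forall>g\<in>F. (\<forall>(i, h)\<in>set (w g). i \<in> {1..k} \<and> h \<in> H i) \<and> g = word_prod G (w g)" ..
  have w: "\<forall>(i, h)\<in>set (w g). i \<in> {1..k} \<and> h \<in> H i" "g = word_prod G (w g)" if "g \<in> F" for g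
    using conjunct1[OF bspec[OF w0 that]] conjunct2[OF bspec[OF w0 that]] by this
  define L where "L = (\<Union>g\<in>F. snd ` set (w g))"
  have L: "finite L" "L \<subseteq> carrier G" using F w(1) HG by (fastforce simp: L_def)+
  \<comment> \<open>All \<beta>'-images of the given sets under suffixes of the words, as
    \<open>word_approximation\<close> requires.\<close>
  define \<B> where "\<B> = (\<Union>g\<in>F. \<Union>A\<in>\<A>. (\<lambda>l. \<beta>' (word_prod G (drop l (w g))) ` A) ` {..length (w g)})"
  have closed: "word_prod G ws \<in> carrier G" if "\<forall>(i, h)\<in>set ws. i \<in> {1..k} \<and> h \<in> H i" for ws
    using that by (induction ws) (use HG in \<open>auto simp: word_prod_def\<close>)
  have \<B>: "finite \<B>" "\<B> \<subseteq> sets M"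
  proof -
    show "finite \<B>" using F \<A> by (simp add: \<B>_def)
    have "\<beta>' (word_prod G (drop l (w g))) ` A \<in> sets M" if "g \<in> F" "A \<in> \<A>" for g A l
    proof -
      have "word_prod G (drop l (w g)) \<in> carrier G"
        using w(1)[OF that(1)] by (intro closed) (auto dest: in_set_dropD)
      then show ?thesis using mp_autD(3)[OF \<beta>'.mp] \<A> that by auto
    qed
    then show "\<B> \<subseteq> sets M" by (auto simp: \<B>_def)
  qed
  \<comment> \<open>The total length bounds every single word length; dividing \<epsilon> by
    \<open>m + 1\<close> makes the accumulated error strictly smaller than \<epsilon> even when all
    words are empty.\<close>
  define m where "m = (\<Sum>g\<in>F. length (w g))"
  have m: "length (w g) \<le> m" if "g \<in> F" for g unfolding m_def using F that by (intro member_le_sum) auto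
  define \<eta> where "\<eta> = \<epsilon> / (real m + 1)"
  have \<eta>: "\<eta> > 0" using \<epsilon> by (simp add: \<eta>_def)
  have ne: "{1..k} \<noteq> {}" using k by simp
  obtain R S where R: "mp_aut M R" and S: "\<And>i. i \<in> {1..k} \<Longrightarrow> mp_aut M (S i)"
      "\<And>i x. i \<in> {1..k} \<Longrightarrow> \<exists>g\<in>H i. S i x = \<alpha>' g x"
    and ap: "\<And>i h A. i \<in> {1..k} \<Longrightarrow> h \<in> L \<Longrightarrow> h \<in> H i \<Longrightarrow> A \<in> \<B> \<Longrightarrow>
      measure M (sym_diff ((\<lambda>x. R (S i (\<alpha>' h (inv_into UNIV (\<lambda>x. R (S i x)) x)))) ` A) (\<beta>' h ` A)) < \<eta>"
  proof (rule \<alpha>'.conjugate_approximation[OF atomless \<beta>'(1) finite_atLeastAtMost ne _ _ _ \<B> L \<eta>])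
    show "subgroup (H i) G" "comm_group (G\<lparr>carrier := H i\<rparr>)" "infinite (H i)" if "i \<in> {1..k}" for i
      using sub H that by auto
    fix R S assume RS: "mp_aut M R" "\<And>i. i \<in> {1..k} \<Longrightarrow> mp_aut M (S i)"
      "\<And>i x. i \<in> {1..k} \<Longrightarrow> \<exists>g\<in>H i. S i x = \<alpha>' g x"
      "\<And>i h A. i \<in> {1..k} \<Longrightarrow> h \<in> L \<Longrightarrow> h \<in> H i \<Longrightarrow> A \<in> \<B> \<Longrightarrow>
        measure M (sym_diff ((\<lambda>x. R (S i (\<alpha>' h (inv_into UNIV (\<lambda>x. R (S i x)) x)))) ` A) (\<beta>' h ` A)) < \<eta>"
    show thesis by (rule that[of R S]; fact RS)
  qed
  define T where "T i x = R (S i x)" for i x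
  have T: "bij (T i)" if "i \<in> {1..k}" for i
    unfolding T_def by (rule mp_autD(1)[OF mp_aut_comp[OF R S(1)[OF that]]])
  define \<gamma> where "\<gamma> i h x = T i (\<alpha>' h (inv_into UNIV (T i) x))" for i h x
  have \<gamma>1: "\<gamma> i \<one>\<^bsub>G\<^esub> x = x" if "i \<in> {1..k}" for i x
    using T[OF that] by (simp add: \<gamma>_def bij_is_surj surj_f_inv_f)
  have \<gamma>2: "\<gamma> i (h \<otimes>\<^bsub>G\<^esub> h') x = \<gamma> i h (\<gamma> i h' x)" if "i \<in> {1..k}" "h \<in> H i" "h' \<in> H i" for i h h' x
    using T[OF that(1)] HG[OF that(1)] that by (simp add: \<gamma>_def \<alpha>'.hom subset_iff bij_is_inj)
  obtain \<Gamma> where \<Gamma>: "\<And>g g' x. g \<in> carrier G \<Longrightarrow> g' \<in> carrier G \<Longrightarrow> \<Gamma> (g \<otimes>\<^bsub>G\<^esub> g') x = \<Gamma> g (\<Gamma> g' x)"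
    "\<And>i h x. i \<in> {1..k} \<Longrightarrow> h \<in> H i \<Longrightarrow> \<Gamma> h x = \<gamma> i h x"
    using free_product_extension[OF fp, of \<gamma>] \<gamma>1 \<gamma>2 by blast
  have \<Gamma>h: "\<Gamma> h x = R (S i (\<alpha>' h (inv_into UNIV (\<lambda>x. R (S i x)) x)))" if "i \<in> {1..k}" "h \<in> H i" for i h x
    using \<Gamma>(2)[OF that] by (simp add: \<gamma>_def T_def[abs_def])
  \<comment> \<open>The extension is purely algebraic; measure preservation is transferred from the
    letters to words.\<close>
  have mpw: "mp_aut M (\<Gamma> (word_prod G ws))" if "\<forall>(i, h)\<in>set ws. i \<in> {1..k} \<and> h \<in> H i" for ws
    using that
  proof (induction ws)
    case Nil
    have "1 \<in> {1..k}" using k by simp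
    then have "\<Gamma> \<one>\<^bsub>G\<^esub> = (\<lambda>x. x)" using \<Gamma>(2)[of 1 "\<one>\<^bsub>G\<^esub>"] \<gamma>1 subgroup.one_closed[OF sub] by auto
    then show ?case using mp_aut_id by (simp add: word_prod_def)
  next
    case (Cons p ws)
    obtain i h where p: "p = (i, h)" by (cases p)
    have i: "i \<in> {1..k}" "h \<in> H i" and ws: "\<forall>(i, h)\<in>set ws. i \<in> {1..k} \<and> h \<in> H i" using Cons.prems by (auto simp: p)
    have h: "h \<in> carrier G" using HG i by auto
    have mT: "mp_aut M (T i)" unfolding T_def by (rule mp_aut_comp[OF R S(1)[OF i(1)]])
    have "\<Gamma> (word_prod G (p # ws)) = (\<lambda>x. T i (\<alpha>' h (inv_into UNIV (T i) (\<Gamma> (word_prod G ws) x))))"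
      using \<Gamma>(1)[OF h closed[OF ws]] \<Gamma>(2)[OF i] by (auto simp: word_prod_def p \<gamma>_def)
    moreover have "mp_aut M (\<lambda>x. T i (\<alpha>' h (inv_into UNIV (T i) (\<Gamma> (word_prod G ws) x))))"
      by (rule mp_aut_comp[OF mT mp_aut_comp[OF \<alpha>'.mp[OF h] mp_aut_comp[OF mp_aut_inv[OF mT] Cons.IH[OF ws]]]])
    ultimately show ?case by simp
  qed
  have mp\<Gamma>: "mp_aut M (\<Gamma> g)" if g: "g \<in> carrier G" for g
  proof -
    obtain ws where ws: "\<forall>(i, h)\<in>set ws. i \<in> {1..k} \<and> h \<in> H i" "g = word_prod G ws"
      by (rule free_product_word[OF fp g])
    show ?thesis unfolding ws(2) by (rule mpw[OF ws(1)])
  qed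
  have ha: "haction M G \<Gamma>"
  proof -
    interpret group G by (rule G)
    show ?thesis by unfold_locales (use mp\<Gamma> \<Gamma>(1) in simp_all)
  qed
  have act: "\<Gamma> \<in> actions G M" using mp\<Gamma> \<Gamma>(1) by (simp add: actions_def)
  have oc: "orbit G \<Gamma> x = R ` orbit G \<alpha>' (inv_into UNIV R x)" for x
    by (rule orbit_conjugate[OF \<alpha>'(1) ha fp R S \<Gamma>h])
  have "orbit_equiv G M \<Gamma> \<alpha>" unfolding orbit_equiv_def
  proof (intro exI[of _ R] conjI R)
    have "AE x in M. orbit G \<alpha>' x = orbit G \<alpha> x"
      using \<alpha>'(2) by eventually_elim (auto simp: orbit_def intro!: image_cong)
    \<comment> \<open>The orbits of \<alpha>' and \<alpha> agree almost everywhere, but they are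
      compared at the R-preimage of x, so the null set has to be transported.\<close>
    from AE_mp_aut[OF mp_aut_inv[OF R] this]
    show "AE x in M. orbit G \<Gamma> x = R ` orbit G \<alpha> (inv_into UNIV R x)"
      by eventually_elim (simp add: oc)
  qed
  then have OE: "\<Gamma> \<in> OE_class G M \<alpha>" using act by (simp add: OE_class_def)
  have "measure M (sym_diff (\<Gamma> g ` A) (\<beta> g ` A)) < \<epsilon>" if A: "A \<in> \<A>" and g: "g \<in> F" for A g
  proof -
    have gc: "g \<in> carrier G" using F g by auto
    have As: "A \<in> sets M" using A \<A> by auto
    have mp\<beta>: "mp_aut M (\<beta> g)" using \<beta> gc by (simp add: actions_def)
    have letter: "measure M (sym_diff (\<Gamma> h ` (\<beta>' (word_prod G vs) ` A)) (\<beta>' h ` (\<beta>' (word_prod G vs) ` A))) \<le> \<eta>"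
      if e: "w g = us @ (i, h) # vs" for us i h vs
    proof -
      have i: "i \<in> {1..k}" "h \<in> H i" using w(1)[OF g] by (auto simp: e)
      have "h \<in> L" unfolding L_def using g by (force simp: e)
      moreover have "\<beta>' (word_prod G vs) ` A \<in> \<B>"
      proof -
        have "vs = drop (Suc (length us)) (w g)" "Suc (length us) \<le> length (w g)" by (simp_all add: e)
        then show ?thesis unfolding \<B>_def using g A by blast
      qed
      moreover have "\<Gamma> h = (\<lambda>x. R (S i (\<alpha>' h (inv_into UNIV (\<lambda>x. R (S i x)) x))))" using \<Gamma>h[OF i] by auto
      ultimately show ?thesis using ap[OF i(1) _ i(2)] by (simp add: less_imp_le)
    qed
    have "measure M (sym_diff (\<Gamma> (word_prod G (w g)) ` A) (\<beta>' (word_prod G (w g)) ` A)) \<le> length (w g) * \<eta>"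
      by (rule word_approximation[OF ha \<beta>'(1) HG As w(1)[OF g] letter])
    then have 1: "measure M (sym_diff (\<Gamma> g ` A) (\<beta>' g ` A)) \<le> length (w g) * \<eta>" using w(2)[OF g] by simp
    have "AE x in M. \<beta>' g x = \<beta> g x" using \<beta>'(2) by eventually_elim (use gc in simp)
    then have 2: "measure M (sym_diff (\<beta>' g ` A) (\<beta> g ` A)) = 0"
      by (rule measure_sym_diff_AE[OF \<beta>'.mp[OF gc] mp\<beta> _ As])
    have "measure M (sym_diff (\<Gamma> g ` A) (\<beta> g ` A)) \<le> length (w g) * \<eta> + 0"
      using measure_sym_diff_triangle[OF mp_autD(3)[OF mp\<Gamma>[OF gc] As] mp_autD(3)[OF \<beta>'.mp[OF gc] As] mp_autD(3)[OF mp\<beta> As]] 1 2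
      by linarith
    also have "\<dots> \<le> real m * \<eta>" using m[OF g] \<eta> by simp
    also have "\<dots> < \<epsilon>" using \<epsilon> by (simp add: \<eta>_def field_simps)
    finally show ?thesis .
  qed
  then show ?thesis using OE by blast
qed

end

theorem theorem3p5:
  fixes G :: "('g, 'b) monoid_scheme" and k :: nat and H :: "nat \<Rightarrow> 'g set"
    and M :: "('a::polish_space) measure"
    and \<alpha> \<beta> :: "'g \<Rightarrow> 'a \<Rightarrow> 'a"
    and F :: "'g set" and \<epsilon> :: real and n :: nat and A :: "nat \<Rightarrow> 'a set"
  assumes "k \<ge> 1"
    and "is_free_product G {1..k} H"
    and "\<forall>i \<in> {1..k}. comm_group (G\<lparr>carrier := H i\<rparr>) \<and> countable (H i) \<and> infinite (H i)"
    and "sets M = sets borel" and "prob_space M" and "atomless M"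
    and "\<alpha> \<in> free_actions G M" and "\<beta> \<in> actions G M"
    and "F \<subseteq> carrier G" and "finite F" and "\<epsilon> > 0"
    and "\<forall>j \<in> {1..n}. A j \<in> sets M"
  shows "(\<exists>\<gamma> \<in> OE_class G M \<alpha>. \<forall>j \<in> {1..n}. \<forall>g \<in> F.
            measure M (sym_diff (\<gamma> g ` A j) (\<beta> g ` A j)) < \<epsilon>)
         \<and> (\<forall>\<alpha>' \<in> free_actions G M.
              (weak_topology G M) closure_of (OE_class G M \<alpha>') = actions G M)"
proof -
  interpret std_space M using assms(4,5) by (simp add: std_space_def std_space_axioms_def)
  note approx = OE_class_approximation[OF assms(1-3,6)]
  have "\<exists>\<gamma>\<in>OE_class G M \<alpha>. \<forall>B\<in>A ` {1..n}. \<forall>g\<in>F. measure M (sym_diff (\<gamma> g ` B) (\<beta> g ` B)) < \<epsilon>"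
    by (rule approx[OF assms(7-10)]) (use assms(11,12) in auto)
  \<comment> \<open>The approximation holds for every target action, which is what
    \<open>weak_dense\<close> asks for.\<close>
  moreover have "weak_topology G M closure_of OE_class G M \<alpha>' = actions G M" if "\<alpha>' \<in> free_actions G M" for \<alpha>'
  proof (rule weak_dense)
    show "OE_class G M \<alpha>' \<subseteq> actions G M" by (auto simp: OE_class_def)
  qed (rule approx[OF that]; assumption)
  ultimately show ?thesis by blast
qed

end
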